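(* Let $X$ be a stable, second countable Stone space. Then the group $\operatorname{Homeo}(X)$ has a unique Polish group topology.
   Context: A second countable Stone space is a compact, totally disconnected, metrizable space. Neighborhoods in $X$ are always clopen. A neighborhood $U$ of $x\in X$ is stable if for every neighborhood $U'\subset U$ of $x$ there is a homeomorphism $U\to U'$ fixing $x$. $X$ is stable if every point of $X$ has a stable neighborhood. A Polish group topology on a group is a separable, completely metrizable topology making it a topological group; having a unique one means that there is exactly one such topology. *)

theory Defs
  imports "HOL-Analysis.Analysis" "HOL-Algebra.Bij"
begin

definition totally_disconnected_space :: "'a topology \<Rightarrow> bool" where
  "totally_disconnected_space X \<longleftrightarrow> (\<forall>S. connectedin X S \<longrightarrow> (\<exists>a. S \<subseteq> {a}))"

(* Second countability is contained in metrizability: a compact metrizable space is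
   second countable.  The empty space is allowed. *)
definition second_countable_Stone_space :: "'a topology \<Rightarrow> bool" where
  "second_countable_Stone_space X \<longleftrightarrow>
     compact_space X \<and> totally_disconnected_space X \<and> metrizable_space X"

definition clopen_nbhd :: "'a topology \<Rightarrow> 'a \<Rightarrow> 'a set \<Rightarrow> bool" where
  "clopen_nbhd X x U \<longleftrightarrow> openin X U \<and> closedin X U \<and> x \<in> U"

definition stable_nbhd :: "'a topology \<Rightarrow> 'a \<Rightarrow> 'a set \<Rightarrow> bool" where
  "stable_nbhd X x U \<longleftrightarrow>
     clopen_nbhd X x U \<and>
     (\<forall>V. clopen_nbhd X x V \<and> V \<subseteq> U \<longrightarrow>
        (\<exists>h. homeomorphic_map (subtopology X U) (subtopology X V) h \<and> h x = x))"

definition stable_space :: "'a topology \<Rightarrow> bool" where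
  "stable_space X \<longleftrightarrow> (\<forall>x \<in> topspace X. \<exists>U. stable_nbhd X x U)"

(* As for Bij, only extensional functions are taken, so that each
   self-homeomorphism of X is represented by exactly one function. *)
definition Homeo :: "'a topology \<Rightarrow> ('a \<Rightarrow> 'a) set" where
  "Homeo X = extensional (topspace X) \<inter> {f. homeomorphic_map X X f}"

definition HomeoGroup :: "'a topology \<Rightarrow> ('a \<Rightarrow> 'a) monoid" where
  "HomeoGroup X = BijGroup (topspace X) \<lparr>carrier := Homeo X\<rparr>"

definition topological_group :: "('g, 'm) monoid_scheme \<Rightarrow> 'g topology \<Rightarrow> bool" where
  "topological_group G T \<longleftrightarrow>
     group G \<and> topspace T = carrier G \<and>
     continuous_map (prod_topology T T) T (\<lambda>(x, y). x \<otimes>\<^bsub>G\<^esub> y) \<and>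
     continuous_map T T (\<lambda>x. inv\<^bsub>G\<^esub> x)"

definition Polish_group_topology :: "('g, 'm) monoid_scheme \<Rightarrow> 'g topology \<Rightarrow> bool" where
  "Polish_group_topology G T \<longleftrightarrow>
     topological_group G T \<and> separable_space T \<and> completely_metrizable_space T"

lemma Homeo_subset_Bij: "Homeo X \<subseteq> Bij (topspace X)"
  using homeomorphic_imp_surjective_map homeomorphic_imp_injective_map
  by (fastforce simp: Homeo_def Bij_def bij_betw_def)

lemma subgroup_Homeo: "subgroup (Homeo X) (BijGroup (topspace X))"
proof (rule subgroup.intro)
  show "Homeo X \<subseteq> carrier (BijGroup (topspace X))"
    using Homeo_subset_Bij by (simp add: BijGroup_def)
next
  fix f g assume fg: "f \<in> Homeo X" "g \<in> Homeo X"
  then have "homeomorphic_map X X (f \<circ> g)"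
    by (auto simp: Homeo_def intro: homeomorphic_map_compose)
  then have "homeomorphic_map X X (compose (topspace X) f g)"
    by (rule homeomorphic_map_eq) (simp add: compose_eq)
  with fg Homeo_subset_Bij show "f \<otimes>\<^bsub>BijGroup (topspace X)\<^esub> g \<in> Homeo X"
    by (auto simp: BijGroup_def Homeo_def subset_iff)
next
  have "homeomorphic_map X X (\<lambda>x\<in>topspace X. x)"
    by (rule homeomorphic_map_eq[of _ _ id]) (auto simp: homeomorphic_map_id)
  then show "\<one>\<^bsub>BijGroup (topspace X)\<^esub> \<in> Homeo X"
    by (simp add: BijGroup_def Homeo_def)
next
  fix f assume f: "f \<in> Homeo X"
  then obtain g where g: "homeomorphic_maps X X f g"
    by (auto simp: Homeo_def homeomorphic_map_maps)
  have inj: "inj_on f (topspace X)"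
    using f by (auto simp: Homeo_def homeomorphic_imp_injective_map)
  have gX: "g y \<in> topspace X" "f (g y) = y" if "y \<in> topspace X" for y
    using g that by (auto simp: homeomorphic_maps_def continuous_map_def)
  have "homeomorphic_map X X g"
    using g homeomorphic_map_maps homeomorphic_maps_sym by blast
  then have "homeomorphic_map X X (\<lambda>x\<in>topspace X. inv_into (topspace X) f x)"
    by (rule homeomorphic_map_eq) (metis gX inj inv_into_f_f restrict_apply')
  moreover have "f \<in> Bij (topspace X)"
    using f Homeo_subset_Bij by blast
  ultimately show "inv\<^bsub>BijGroup (topspace X)\<^esub> f \<in> Homeo X"
    by (simp add: inv_BijGroup Homeo_def)
qed

lemma group_HomeoGroup: "group (HomeoGroup X)"
  unfolding HomeoGroup_def
  by (rule subgroup.subgroup_is_group[OF subgroup_Homeo group_BijGroup])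

end

theory Submission
  imports Defs
begin

text \<open>
Write \<open>G\<close> for the group of homeomorphisms of \<open>X\<close>. The candidate topology \<open>htop\<close> is the one in which the
stabilisers of clopen sets are a subbasis at the identity. By Stone duality \<open>G\<close> is the group of
order automorphisms of the countable algebra of clopen sets, so \<open>htop\<close> embeds \<open>G\<close> as a closed subset
of a countable product of countable discrete spaces; hence it is Polish (\<open>Polish_htop\<close>).

For uniqueness let \<open>T\<close> be any Polish group topology on \<open>G\<close>. It is enough to show that the stabiliser of
every clopen set is open in \<open>T\<close>: then the identity from \<open>T\<close> to \<open>htop\<close> is continuous, and a Baire category
argument (\<open>polish_hom.open_at_one\<close>) makes it open. Now a subgroup that is closed in \<open>T\<close> and
has countable index is open, again by Baire category, and there are only countably many clopen sets,
so one looks for closed subgroups that are close to stabilisers. Centralisers are closed in every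
Hausdorff group topology, and so are normalisers of closed sets. If \<open>G_A\<close> is the group of
homeomorphisms supported in the clopen set \<open>A\<close>, then the normaliser of the centraliser of \<open>G_A\<close> is
therefore closed, and it contains the stabiliser of \<open>A\<close>.

Stability enters through the following trick. If \<open>h\<close> maps a stable neighbourhood \<open>V\<close> of a non-isolated
point into a proper part of itself, then \<open>A = V - h V\<close> has the disjoint copies \<open>h A\<close> and \<open>h (h A)\<close>, and
the two exchanges of neighbouring copies do not commute. So \<open>G_U\<close> is non-abelian for every open \<open>U\<close>
containing a non-isolated point, and this forces an element of the normaliser to move \<open>A\<close> only by a
set of isolated points (\<open>norm_cent_diff_isolated\<close>). The remaining work concerns isolated points.
When there are at least three, transpositions and their centralisers are enough to conclude.

The case of exactly two isolated points \<open>p, q\<close> is different: the transposition \<open>t\<close> of \<open>p\<close> and \<open>q\<close> is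
central, \<open>G\<close> is the product of \<open>{1, t}\<close> and the stabiliser of \<open>p\<close>, and a discontinuous homomorphism of
the latter to \<open>{1, t}\<close> would twist \<open>htop\<close> into another Polish topology. Stability rules this out,
because \<open>G_U\<close> is a perfect group for every stable neighbourhood \<open>U\<close> of a point \<open>x\<close> (\<open>stable_perfect\<close>).
The reason is a swindle: an element \<open>g\<close> that is the identity on infinitely many annuli around \<open>x\<close> can
be copied, with all copies converging to \<open>x\<close>, into infinitely many disjoint places indexed by the
integers; if \<open>F\<close> acts as \<open>g\<close> on the copies with index \<open>k \<ge> 0\<close> and \<open>\<phi>\<close> shifts the index by one, then \<open>g\<close> is
the commutator of \<open>F\<close> and \<open>\<phi>\<close>. An arbitrary element of \<open>G_U\<close> is a product of elements of this form and
commutators.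
\<close>

section \<open>Topological groups and Baire category\<close>

lemma closure_of_meets:
  "x \<in> T closure_of A \<Longrightarrow> openin T U \<Longrightarrow> x \<in> U \<Longrightarrow> \<exists>a\<in>A. a \<in> U"
  by (auto simp: in_closure_of)

lemma (in group) inv_mult_cancel [simp]:
  assumes "a \<in> carrier G" "x \<in> carrier G"
  shows "inv a \<otimes> (a \<otimes> x) = x" and "a \<otimes> (inv a \<otimes> x) = x"
  using assms by (simp_all add: m_assoc[symmetric])

locale topgroup = group G for G (structure) +
  fixes T
  assumes tg: "topological_group G T"
begin

lemma space: "topspace T = carrier G"
  using tg by (simp add: topological_group_def)

lemma cont_mult:
  assumes "continuous_map Y T f" "continuous_map Y T g"
  shows "continuous_map Y T (\<lambda>y. f y \<otimes> g y)"
proof -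
  have "continuous_map Y (prod_topology T T) (\<lambda>y. (f y, g y))"
    using assms by (simp add: continuous_map_pairedI)
  then have "continuous_map Y T ((\<lambda>(x, y). x \<otimes> y) \<circ> (\<lambda>y. (f y, g y)))"
    using tg unfolding topological_group_def by (blast intro: continuous_map_compose)
  then show ?thesis by (simp add: o_def)
qed

lemma cont_inv:
  assumes "continuous_map Y T f"
  shows "continuous_map Y T (\<lambda>y. inv (f y))"
proof -
  have "continuous_map Y T ((\<lambda>x. inv x) \<circ> f)"
    using tg assms unfolding topological_group_def by (blast intro: continuous_map_compose)
  then show ?thesis by (simp add: o_def)
qed

lemma cont_const: "a \<in> carrier G \<Longrightarrow> continuous_map Y T (\<lambda>y. a)"
  by (simp add: space)

lemma cont_id: "continuous_map T T (\<lambda>y. y)"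
  using continuous_map_id by (simp add: id_def)

lemma homeo_lmult:
  assumes a: "a \<in> carrier G"
  shows "homeomorphic_map T T (\<lambda>x. a \<otimes> x)"
proof -
  have "homeomorphic_maps T T (\<lambda>x. a \<otimes> x) (\<lambda>x. inv a \<otimes> x)"
    using a by (auto simp: homeomorphic_maps_def space m_assoc[symmetric]
        intro!: cont_mult cont_const cont_id)
  then show ?thesis
    using homeomorphic_map_maps by blast
qed

lemma open_lmult: "a \<in> carrier G \<Longrightarrow> openin T U \<Longrightarrow> openin T ((\<lambda>x. a \<otimes> x) ` U)"
  using homeo_lmult homeomorphic_imp_open_map open_map_def by blast

lemma closure_lmult:
  "a \<in> carrier G \<Longrightarrow> U \<subseteq> carrier G \<Longrightarrow>
     T closure_of ((\<lambda>x. a \<otimes> x) ` U) = (\<lambda>x. a \<otimes> x) ` (T closure_of U)"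
  using homeomorphic_map_closure_of[OF homeo_lmult] by (simp add: space)

lemma nbhd_pairs:
  assumes q: "continuous_map (prod_topology T T) T (\<lambda>(x, y). q x y)"
    and W: "openin T W" "q \<one> \<one> \<in> W"
  shows "\<exists>V. openin T V \<and> \<one> \<in> V \<and> (\<forall>a\<in>V. \<forall>b\<in>V. q a b \<in> W)"
proof -
  let ?P = "{z \<in> topspace (prod_topology T T). (case z of (x, y) \<Rightarrow> q x y) \<in> W}"
  have "openin (prod_topology T T) ?P"
    using openin_continuous_map_preimage[OF q W(1)] .
  moreover have "(\<one>, \<one>) \<in> ?P"
    using W by (simp add: space)
  ultimately obtain A B where AB: "openin T A" "openin T B" "(\<one>, \<one>) \<in> A \<times> B" "A \<times> B \<subseteq> ?P"
    unfolding openin_prod_topology_alt by (elim allE impE) auto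
  show ?thesis
    by (rule exI[of _ "A \<inter> B"]) (use AB in auto)
qed

lemma nbhd_ldiff:
  assumes "openin T W" "\<one> \<in> W"
  shows "\<exists>V. openin T V \<and> \<one> \<in> V \<and> (\<forall>a\<in>V. \<forall>b\<in>V. inv a \<otimes> b \<in> W)"
proof (rule nbhd_pairs[OF _ assms(1)])
  have "continuous_map (prod_topology T T) T (\<lambda>z. inv (fst z) \<otimes> snd z)"
    by (intro cont_mult cont_inv continuous_map_fst continuous_map_snd)
  then show "continuous_map (prod_topology T T) T (\<lambda>(x, y). inv x \<otimes> y)"
    by (simp add: case_prod_unfold)
qed (use assms in simp)

lemma nbhd_rdiff:
  assumes "openin T W" "\<one> \<in> W"
  shows "\<exists>V. openin T V \<and> \<one> \<in> V \<and> (\<forall>a\<in>V. \<forall>b\<in>V. a \<otimes> inv b \<in> W)"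
proof (rule nbhd_pairs[OF _ assms(1)])
  have "continuous_map (prod_topology T T) T (\<lambda>z. fst z \<otimes> inv (snd z))"
    by (intro cont_mult cont_inv continuous_map_fst continuous_map_snd)
  then show "continuous_map (prod_topology T T) T (\<lambda>(x, y). x \<otimes> inv y)"
    by (simp add: case_prod_unfold)
qed (use assms in simp)

lemma open_of_nbhd:
  assumes S: "subgroup S G" and U: "openin T U" "\<one> \<in> U" "U \<subseteq> S"
  shows "openin T S"
proof -
  have "\<exists>Ta. openin T Ta \<and> s \<in> Ta \<and> Ta \<subseteq> S" if s: "s \<in> S" for s
  proof -
    have sG: "s \<in> carrier G" by (rule subgroup.mem_carrier[OF S s])
    have "s \<in> (\<lambda>x. s \<otimes> x) ` U"
      using U(2) sG by (intro image_eqI[of _ _ \<one>]) auto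
    moreover have "(\<lambda>x. s \<otimes> x) ` U \<subseteq> S"
      using U(3) subgroup.m_closed[OF S s] by blast
    ultimately show ?thesis
      using open_lmult[OF sG U(1)] by blast
  qed
  then show ?thesis
    using openin_subopen[of T S] by blast
qed

text \<open>By Baire category one of the countably many cosets has interior, hence so does the subgroup. The
countable index is given by a map \<open>\<phi>\<close> into a countable set that separates the left cosets; in the
applications \<open>\<phi> g\<close> records the images of finitely many clopen sets under \<open>g\<close>.\<close>

lemma closed_subgroup_countable_index_open:
  assumes cm: "completely_metrizable_space T"
    and S: "subgroup S G" "closedin T S"
    and K: "countable K" "\<phi> ` carrier G \<subseteq> K"
    and \<phi>: "\<And>g h. g \<in> carrier G \<Longrightarrow> h \<in> carrier G \<Longrightarrow> \<phi> g = \<phi> h \<Longrightarrow> inv g \<otimes> h \<in> S"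
  shows "openin T S"
proof -
  define r where "r c = (SOME g. g \<in> carrier G \<and> \<phi> g = c)" for c
  have r: "r (\<phi> g) \<in> carrier G \<and> \<phi> (r (\<phi> g)) = \<phi> g" if "g \<in> carrier G" for g
    unfolding r_def by (rule someI[of _ g]) (use that in simp)
  define \<G> where "\<G> = (\<lambda>c. (\<lambda>x. r c \<otimes> x) ` S) ` (\<phi> ` carrier G)"
  have cover: "\<Union>\<G> = carrier G"
  proof
    show "\<Union>\<G> \<subseteq> carrier G"
    proof
      fix y assume "y \<in> \<Union>\<G>"
      then obtain g s where g: "g \<in> carrier G" "s \<in> S" "y = r (\<phi> g) \<otimes> s"
        unfolding \<G>_def by blast
      then show "y \<in> carrier G" using r[OF g(1)] subgroup.mem_carrier[OF S(1) g(2)] by simp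
    qed
    show "carrier G \<subseteq> \<Union>\<G>"
    proof
      fix g assume g: "g \<in> carrier G"
      have "inv (r (\<phi> g)) \<otimes> g \<in> S" using r[OF g] g \<phi> by auto
      moreover have "g = r (\<phi> g) \<otimes> (inv (r (\<phi> g)) \<otimes> g)"
        using r[OF g] g by simp
      ultimately show "g \<in> \<Union>\<G>" using g unfolding \<G>_def by blast
    qed
  qed
  have "T interior_of (\<Union>\<G>) = carrier G"
    unfolding cover space[symmetric] by simp
  then have "T interior_of (\<Union>\<G>) \<noteq> {}" by auto
  moreover have "countable \<G>"
    unfolding \<G>_def using K countable_subset by blast
  ultimately obtain A where A: "A \<in> \<G>" "\<not> (closedin T A \<and> T interior_of A = {})"
    using Baire_category_alt[of T \<G>] cm by blast
  then obtain g where g: "g \<in> carrier G" "A = (\<lambda>x. r (\<phi> g) \<otimes> x) ` S"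
    unfolding \<G>_def by blast
  let ?a = "r (\<phi> g)"
  have a: "?a \<in> carrier G" using r g by blast
  have "closedin T A"
    unfolding g(2) using homeo_lmult[OF a] homeomorphic_imp_closed_map closed_map_def S(2) by blast
  with A obtain x where x: "x \<in> T interior_of A" by blast
  then obtain U where U: "openin T U" "x \<in> U" "U \<subseteq> A"
    by (auto simp: interior_of_def)
  then obtain s where s: "s \<in> S" "x = ?a \<otimes> s" using g by blast
  have sG: "s \<in> carrier G" by (rule subgroup.mem_carrier[OF S(1) s(1)])
  have xG: "x \<in> carrier G" using s a sG by simp
  let ?U = "(\<lambda>y. inv x \<otimes> y) ` U"
  have "?U \<subseteq> S"
  proof (rule image_subsetI)
    fix y assume "y \<in> U"
    then obtain s' where s': "s' \<in> S" "y = ?a \<otimes> s'" using U g by blast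
    have s'G: "s' \<in> carrier G" by (rule subgroup.mem_carrier[OF S(1) s'(1)])
    have e: "inv x \<otimes> y = inv s \<otimes> (inv ?a \<otimes> (?a \<otimes> s'))"
      using a sG s'G by (simp add: s(2) s'(2) inv_mult_group m_assoc)
    show "inv x \<otimes> y \<in> S"
      unfolding e using a s'G subgroup.m_closed[OF S(1) subgroup.m_inv_closed[OF S(1) s(1)] s'(1)] by simp
  qed
  moreover have "\<one> \<in> ?U" using U(2) xG by (intro image_eqI[of _ _ x]) auto
  ultimately show ?thesis
    using open_of_nbhd[OF S(1) open_lmult[OF inv_closed[OF xG] U(1)]] by blast
qed

end

section \<open>The open mapping theorem\<close>

text \<open>This is applied to the identity between two Polish topologies on one group and, in the case of two
isolated points, to a map that kills a central element of order two and has an open image.\<close>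

locale polish_hom = G: topgroup G S + H: topgroup H T for G (structure) and H (structure) and S T +
  fixes f
  assumes hom: "f \<in> hom G H" and cont: "continuous_map S T f"
    and sep: "separable_space S" and cmS: "completely_metrizable_space S"
    and cmT: "completely_metrizable_space T"
    and img: "openin T (f ` carrier G)"
begin

lemma fmult: "x \<in> carrier G \<Longrightarrow> y \<in> carrier G \<Longrightarrow> f (x \<otimes> y) = f x \<otimes>\<^bsub>H\<^esub> f y"
  using hom by (simp add: hom_def)

lemma fcar: "x \<in> carrier G \<Longrightarrow> f x \<in> carrier H"
  using hom by (auto simp: hom_def)

lemma finv: "x \<in> carrier G \<Longrightarrow> f (inv x) = inv\<^bsub>H\<^esub> f x"
  using hom G.is_group H.is_group by (simp add: group_hom.hom_inv group_hom_axioms_def group_hom_def)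

text \<open>The set \<open>thick W\<close> is the open set in which \<open>f ` W\<close> is dense. The proof of the open mapping theorem
compares \<open>f ` W\<close> with \<open>thick W\<close>: for open \<open>W\<close> the first is contained in the second, and it is comeagre
there.\<close>

definition thick :: "'a set \<Rightarrow> 'c set" where
  "thick W = T interior_of (T closure_of (f ` W))"

lemma thick_open: "openin T (thick W)"
  by (simp add: thick_def)

lemma thick_subset: "thick W \<subseteq> T closure_of (f ` W)"
  by (simp add: thick_def interior_of_subset)

lemma thickI: "openin T U \<Longrightarrow> x \<in> U \<Longrightarrow> U \<subseteq> T closure_of (f ` W) \<Longrightarrow> x \<in> thick W"
  unfolding thick_def using interior_of_maximal[of U "T closure_of (f ` W)" T] by (auto dest: subsetD)

text \<open>If \<open>V\<inverse>V \<subseteq> W\<close>, then countably many translates of \<open>V\<close> cover the separable group \<open>G\<close>, so the closure of \<open>f ` V\<close>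
has an interior point by Baire category; translating it by a point of \<open>f ` V\<close> gives a neighbourhood of
the identity.\<close>

lemma almost_open_one:
  assumes W: "openin S W" "\<one> \<in> W"
  shows "\<one>\<^bsub>H\<^esub> \<in> thick W"
proof -
  obtain V where V: "openin S V" "\<one> \<in> V"
    and VW: "\<And>a b. a \<in> V \<Longrightarrow> b \<in> V \<Longrightarrow> inv a \<otimes> b \<in> W"
    using G.nbhd_ldiff[OF W] by blast
  have VG: "V \<subseteq> carrier G" using openin_subset[OF V(1)] by (simp add: G.space)
  obtain D where D: "countable D" "D \<subseteq> carrier G" "S closure_of D = carrier G"
    using sep unfolding separable_space_def G.space by auto
  \<comment> \<open>The closures of the translates of the image of V by a countable dense set cover the open set f(G).\<close>
  let ?C = "\<lambda>d. T closure_of ((\<lambda>x. f d \<otimes>\<^bsub>H\<^esub> x) ` (f ` V))"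
  have "f ` carrier G \<subseteq> \<Union>(?C ` D)"
  proof (rule image_subsetI)
    fix g assume g: "g \<in> carrier G"
    have "openin S {x \<in> topspace S. inv x \<otimes> g \<in> V}"
      by (rule openin_continuous_map_preimage[OF _ V(1)])
        (intro G.cont_mult G.cont_inv G.cont_const G.cont_id g)
    moreover have "g \<in> {x \<in> topspace S. inv x \<otimes> g \<in> V}"
      using g V by (simp add: G.space)
    moreover have "g \<in> S closure_of D" using D(3) g by simp
    ultimately obtain d where d: "d \<in> D" "inv d \<otimes> g \<in> V"
      using closure_of_meets[of g S D] by blast
    have dG: "d \<in> carrier G" using d D by auto
    have "f g = f (d \<otimes> (inv d \<otimes> g))"
      using dG g by simp
    also have "\<dots> = f d \<otimes>\<^bsub>H\<^esub> f (inv d \<otimes> g)"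
      by (rule fmult) (use dG g in auto)
    finally have "f g \<in> (\<lambda>x. f d \<otimes>\<^bsub>H\<^esub> x) ` (f ` V)"
      using d by blast
    moreover have "(\<lambda>x. f d \<otimes>\<^bsub>H\<^esub> x) ` (f ` V) \<subseteq> ?C d"
      by (rule closure_of_subset) (use VG dG in \<open>auto simp: H.space fcar subset_iff\<close>)
    ultimately show "f g \<in> \<Union>(?C ` D)" using d(1) by blast
  qed
  then have "f ` carrier G \<subseteq> T interior_of \<Union>(?C ` D)"
    using img interior_of_maximal by blast
  then have "T interior_of \<Union>(?C ` D) \<noteq> {}"
    by auto
  moreover have "countable (?C ` D)" using D(1) by simp
  moreover have "closedin T A" if "A \<in> ?C ` D" for A using that by auto
  ultimately have "\<not> (\<forall>A \<in> ?C ` D. T interior_of A = {})"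
    using Baire_category_alt[of T "?C ` D"] cmT by blast
  then obtain d where d: "d \<in> D" "T interior_of ?C d \<noteq> {}"
    by blast
  have dG: "d \<in> carrier G" using d D by auto
  obtain x where x: "x \<in> T interior_of ?C d" using d by blast
  have "x \<in> ?C d" by (rule subsetD[OF interior_of_subset x])
  from closure_of_meets[OF this openin_interior_of x]
  obtain v where v: "v \<in> V" "f d \<otimes>\<^bsub>H\<^esub> f v \<in> T interior_of ?C d" by blast
  have vG: "v \<in> carrier G" using v VG by auto
  let ?a = "inv\<^bsub>H\<^esub> (f d \<otimes>\<^bsub>H\<^esub> f v)"
  have aH: "?a \<in> carrier H" using dG vG fcar by simp
  let ?O = "(\<lambda>x. ?a \<otimes>\<^bsub>H\<^esub> x) ` (T interior_of ?C d)"
  have "openin T ?O" using H.open_lmult aH by simp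
  moreover have "\<one>\<^bsub>H\<^esub> \<in> ?O"
    using v(2) dG vG fcar by (intro image_eqI[OF _ v(2)]) simp
  moreover have "?O \<subseteq> T closure_of (f ` W)"
  proof -
    have "?O \<subseteq> (\<lambda>x. ?a \<otimes>\<^bsub>H\<^esub> x) ` ?C d" by (rule image_mono[OF interior_of_subset])
    also have "\<dots> = T closure_of ((\<lambda>x. ?a \<otimes>\<^bsub>H\<^esub> x) ` (\<lambda>x. f d \<otimes>\<^bsub>H\<^esub> x) ` (f ` V))"
      by (rule H.closure_lmult[symmetric]) (use aH dG VG fcar in \<open>auto simp: subset_iff\<close>)
    also have "\<dots> \<subseteq> T closure_of (f ` W)"
    proof (rule closure_of_mono, clarsimp)
      fix u assume u: "u \<in> V"
      have uG: "u \<in> carrier G" using u VG by auto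
      have "?a \<otimes>\<^bsub>H\<^esub> (f d \<otimes>\<^bsub>H\<^esub> f u) = inv\<^bsub>H\<^esub> f v \<otimes>\<^bsub>H\<^esub> (inv\<^bsub>H\<^esub> f d \<otimes>\<^bsub>H\<^esub> (f d \<otimes>\<^bsub>H\<^esub> f u))"
        using dG vG uG fcar by (simp add: H.inv_mult_group H.m_assoc)
      also have "\<dots> = f (inv v \<otimes> u)"
        using dG vG uG fcar by (simp add: fmult finv)
      finally show "?a \<otimes>\<^bsub>H\<^esub> (f d \<otimes>\<^bsub>H\<^esub> f u) \<in> f ` W"
        using VW[OF v(1) u] by simp
    qed
    finally show ?thesis .
  qed
  ultimately show ?thesis
    by (rule thickI)
qed

lemma almost_open:
  assumes W: "openin S W" "w \<in> W"
  shows "f w \<in> thick W"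
proof -
  have WG: "W \<subseteq> carrier G" using openin_subset[OF W(1)] by (simp add: G.space)
  have wG: "w \<in> carrier G" using W WG by auto
  let ?W = "(\<lambda>x. inv w \<otimes> x) ` W"
  have "\<one> \<in> ?W" using W wG by (intro image_eqI[of _ _ w]) auto
  then have 1: "\<one>\<^bsub>H\<^esub> \<in> thick ?W"
    using almost_open_one[of ?W] G.open_lmult[OF _ W(1)] wG by simp
  let ?O = "(\<lambda>x. f w \<otimes>\<^bsub>H\<^esub> x) ` thick ?W"
  have fw: "f w \<in> carrier H" using wG fcar by simp
  have "openin T ?O" using H.open_lmult fw thick_open by blast
  moreover have "f w \<in> ?O" using 1 fw by (intro image_eqI[of _ _ "\<one>\<^bsub>H\<^esub>"]) auto
  moreover have "?O \<subseteq> T closure_of (f ` W)"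
  proof -
    have "?O \<subseteq> (\<lambda>x. f w \<otimes>\<^bsub>H\<^esub> x) ` (T closure_of (f ` ?W))"
      unfolding thick_def by (rule image_mono[OF interior_of_subset])
    also have "\<dots> = T closure_of ((\<lambda>x. f w \<otimes>\<^bsub>H\<^esub> x) ` (f ` ?W))"
      by (rule H.closure_lmult[symmetric]) (use fw wG WG fcar in \<open>auto simp: subset_iff\<close>)
    also have "\<dots> \<subseteq> T closure_of (f ` W)"
    proof (rule closure_of_mono, clarsimp)
      fix u assume u: "u \<in> W"
      have uG: "u \<in> carrier G" using u WG by auto
      have "f w \<otimes>\<^bsub>H\<^esub> f (inv w \<otimes> u) = f (w \<otimes> (inv w \<otimes> u))"
        by (rule fmult[symmetric]) (use wG uG in auto)
      also have "\<dots> = f u"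
        using wG uG by simp
      finally show "f w \<otimes>\<^bsub>H\<^esub> f (inv w \<otimes> u) \<in> f ` W"
        using u by simp
    qed
    finally show ?thesis .
  qed
  ultimately show ?thesis
    by (rule thickI)
qed

text \<open>A point \<open>x\<close> of \<open>thick V\<close> that avoids countably many nowhere dense sets is the image of a point of \<open>V\<close>: one
builds a decreasing sequence of open sets \<open>Q n\<close> with \<open>x \<in> thick (Q n)\<close> and radii tending to zero, each
closure being contained in the previous set. By completeness the \<open>Q n\<close> shrink to a point \<open>y\<close>, and \<open>x\<close>
is in the closure of the image of every neighbourhood of \<open>y\<close>, so that \<open>x = f y\<close>.\<close>

lemma thick_comeagre:
  assumes V: "openin S V"
  shows "\<exists>\<D>. countable \<D> \<and> (\<forall>E\<in>\<D>. openin T E \<and> T closure_of E = topspace T) \<and> thick V \<inter> \<Inter>\<D> \<subseteq> f ` V"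
proof -
  obtain M d where Md: "Metric_space M d" "Metric_space.mcomplete M d" "S = Metric_space.mtopology M d"
    using cmS unfolding completely_metrizable_space_def by blast
  interpret M: Metric_space M d by (rule Md)
  have M: "M = carrier G" using Md(3) G.space by simp
  obtain D where D: "countable D" "D \<subseteq> carrier G" "S closure_of D = carrier G"
    using sep unfolding separable_space_def G.space by auto
  define bb where "bb = (\<lambda>(c, m). M.mball c (1 / real (Suc m)))"
  \<comment> \<open>Ch W n: basic balls of radius at most 1/(n+1) whose closed ball lies in W.\<close>
  define Ch where "Ch W n = {bb (c, m) |c m. c \<in> D \<and> n \<le> m \<and> M.mcball c (1 / real (Suc m)) \<subseteq> W}" for W and n :: nat
  have Ch_cover: "\<exists>B\<in>Ch W n. w \<in> B" if W: "openin S W" "w \<in> W" for W w n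
  proof -
    obtain r where r: "r > 0" "M.mball w r \<subseteq> W"
      using W Md(3) M.openin_mtopology by blast
    obtain m0 :: nat where m0: "2 / r < real m0" using reals_Archimedean2 by blast
    define m where "m = max m0 n"
    have "2 / r < real (Suc m)" using m0 by (simp add: m_def)
    then have m: "2 * (1 / real (Suc m)) < r" using r by (simp add: field_simps)
    have wM: "w \<in> M" using W openin_subset G.space M by blast
    have "openin S (M.mball w (1 / real (Suc m)))" using Md(3) by simp
    moreover have "w \<in> M.mball w (1 / real (Suc m))" using wM by simp
    moreover have "w \<in> S closure_of D" using D(3) wM M by simp
    ultimately obtain c where c: "c \<in> D" "c \<in> M.mball w (1 / real (Suc m))"
      using closure_of_meets[of w S D] by blast
    have "M.mcball c (1 / real (Suc m)) \<subseteq> M.mball w r"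
    proof
      fix z assume z: "z \<in> M.mcball c (1 / real (Suc m))"
      have "d w z \<le> d w c + d c z" using z c by (intro M.triangle) auto
      also have "\<dots> < 2 * (1 / real (Suc m))" using z c by (simp add: M.in_mcball M.in_mball)
      finally show "z \<in> M.mball w r" using z wM m by auto
    qed
    then have "M.mcball c (1 / real (Suc m)) \<subseteq> W" using r(2) by (rule subset_trans)
    moreover have "n \<le> m" by (simp add: m_def)
    ultimately have "bb (c, m) \<in> Ch W n"
      unfolding Ch_def using c(1) by blast
    moreover have "w \<in> bb (c, m)"
      using c wM by (auto simp: bb_def M.in_mball M.commute)
    ultimately show ?thesis by blast
  qed
  have Ch_open: "openin S B \<and> B \<subseteq> W" if "B \<in> Ch W n" for B W n
    using that Md(3) M.mball_subset_mcball unfolding Ch_def bb_def by fastforce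
  define \<B> where "\<B> = bb ` (D \<times> UNIV)"
  have ChB: "Ch W n \<subseteq> \<B>" for W n unfolding Ch_def \<B>_def by auto
  have \<B>: "countable \<B>" unfolding \<B>_def using D(1) by simp
  \<comment> \<open>Generic points of thick W lie in thick B for a small B inside W; this is the dense open set that expresses it.\<close>
  define DD where "DD = (\<lambda>(W, n). (\<Union>B\<in>Ch W n. thick B) \<union> (topspace T - T closure_of (thick W)))"
  define \<D> where "\<D> = DD ` (insert V \<B> \<times> UNIV)"
  have \<D>: "openin T E \<and> T closure_of E = topspace T" if "E \<in> \<D>" for E
  proof -
    obtain W n where W: "W \<in> insert V \<B>" "E = DD (W, n)" using \<open>E \<in> \<D>\<close> unfolding \<D>_def by blast
    have "openin S W" using W(1) V Md(3) unfolding \<B>_def bb_def by auto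
    have op: "openin T E"
      unfolding W DD_def by (auto intro!: openin_Un openin_Union openin_diff simp: thick_open)
    have "\<exists>y\<in>E. y \<in> Q" if Q: "openin T Q" "x \<in> Q" for Q x
    proof (cases "Q \<inter> thick W = {}")
      case True
      then have "Q \<inter> T closure_of (thick W) = {}"
        using openin_Int_closure_of_eq_empty Q by metis
      then have "x \<in> topspace T - T closure_of (thick W)" using Q openin_subset by blast
      then show ?thesis using Q unfolding W DD_def by auto
    next
      case False
      then obtain z where z: "z \<in> Q \<inter> thick W" by blast
      then have "z \<in> T closure_of (f ` W)" using thick_subset by blast
      moreover have "openin T (Q \<inter> thick W)" using Q thick_open by blast
      ultimately obtain w where w: "w \<in> W" "f w \<in> Q \<inter> thick W"
        using closure_of_meets[of z T "f ` W"] z by blast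
      obtain B where B: "B \<in> Ch W n" "w \<in> B" using Ch_cover[OF \<open>openin S W\<close> w(1)] by blast
      have "f w \<in> thick B" using almost_open Ch_open B by blast
      then show ?thesis using w B unfolding W DD_def by auto
    qed
    then have "T closure_of E = topspace T"
      unfolding closure_of_def by auto
    with op show ?thesis by blast
  qed
  have "thick V \<inter> \<Inter>\<D> \<subseteq> f ` V"
  proof
    fix x assume x: "x \<in> thick V \<inter> \<Inter>\<D>"
    have step: "\<exists>B\<in>Ch W n. x \<in> thick B" if W: "W \<in> insert V \<B>" "x \<in> thick W" for W n
    proof -
      have "DD (W, n) \<in> \<D>" unfolding \<D>_def using W by blast
      then have "x \<in> DD (W, n)" using x by blast
      moreover have "x \<in> T closure_of (thick W)"
        using W closure_of_subset[OF openin_subset[OF thick_open]] by blast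
      ultimately show ?thesis unfolding DD_def by auto
    qed
    obtain Q where Q: "\<And>n. Q n \<in> insert V \<B> \<and> x \<in> thick (Q n) \<and> (n = 0 \<longrightarrow> Q n = V)"
      and Qs: "\<And>n. Q (Suc n) \<in> Ch (Q n) n"
    proof -
      have "\<exists>Q. \<forall>n. (Q n \<in> insert V \<B> \<and> x \<in> thick (Q n) \<and> (n = 0 \<longrightarrow> Q n = V)) \<and> Q (Suc n) \<in> Ch (Q n) n"
        apply (rule dependent_nat_choice)
        subgoal using x by blast
        subgoal for W n using step[of W n] ChB[of W n] by blast
        done
      then show ?thesis using that by blast
    qed
    have "\<forall>n. \<exists>c m. Q (Suc n) = M.mball c (1 / real (Suc m)) \<and> c \<in> D \<and> n \<le> m \<and> M.mcball c (1 / real (Suc m)) \<subseteq> Q n"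
      using Qs unfolding Ch_def bb_def by auto
    then obtain c m where cm: "\<And>n. Q (Suc n) = M.mball (c n) (1 / real (Suc (m n)))"
      "\<And>n. c n \<in> D" "\<And>n. n \<le> m n" "\<And>n. M.mcball (c n) (1 / real (Suc (m n))) \<subseteq> Q n"
      by metis
    define C where "C n = M.mcball (c n) (1 / real (Suc (m n)))" for n
    have CQ: "Q (Suc n) \<subseteq> C n" "C n \<subseteq> Q n" for n
      using cm M.mball_subset_mcball by (auto simp: C_def)
    have dec: "decseq C"
      by (rule decseq_SucI) (use CQ in blast)
    have small: "d y z \<le> 2 / real (Suc n)" if "y \<in> C n" "z \<in> C n" for y z n
    proof -
      have "d y z \<le> d y (c n) + d (c n) z" using that by (intro M.triangle) (auto simp: C_def)
      also have "\<dots> \<le> 1 / real (Suc (m n)) + 1 / real (Suc (m n))"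
        using that by (auto simp: C_def M.commute intro!: add_mono)
      also have "\<dots> = 2 / real (Suc (m n))" by simp
      also have "\<dots> \<le> 2 / real (Suc n)" using cm(3)[of n] by (intro divide_left_mono) auto
      finally show ?thesis .
    qed
    have ne: "C n \<noteq> {}" for n
    proof -
      have "c n \<in> M" using cm(2) D(2) M by blast
      then have "c n \<in> C n" by (simp add: C_def)
      then show ?thesis by blast
    qed
    have cl: "closedin M.mtopology (C n)" for n by (simp add: C_def)
    have small': "\<exists>n a. C n \<subseteq> M.mcball a e" if "e > 0" for e
    proof -
      obtain n :: nat where n: "1 / e < real n" using reals_Archimedean2 by blast
      have "1 / e < real (Suc (m n))" using n cm(3)[of n] by simp
      then have "1 / real (Suc (m n)) < e" using \<open>e > 0\<close> by (simp add: field_simps)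
      then have "C n \<subseteq> M.mcball (c n) e"
        unfolding C_def by (intro M.mcball_subset_concentric) simp
      then show ?thesis by blast
    qed
    obtain y where y: "y \<in> M" "\<Inter>(range C) = {y}"
      using M.mcomplete_nest_sing[THEN iffD1, OF Md(2), rule_format, of C] cl ne dec small' by auto
    have yC: "y \<in> C n" for n using y by blast
    have yV: "y \<in> V" using yC[of 0] CQ(2)[of 0] Q[of 0] by auto
    have yG: "y \<in> carrier G" using y M by simp
    have "x = f y"
    proof (rule ccontr)
      assume "x \<noteq> f y"
      have "Hausdorff_space T" using cmT completely_metrizable_imp_metrizable_space metrizable_imp_Hausdorff_space by blast
      moreover have "x \<in> topspace T" using x openin_subset[OF thick_open] by blast
      moreover have "f y \<in> topspace T" using fcar yG H.space by simp
      ultimately obtain A B where AB: "openin T A" "openin T B" "x \<in> A" "f y \<in> B" "disjnt A B"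
        using \<open>x \<noteq> f y\<close> unfolding Hausdorff_space_def by metis
      have "openin S {z \<in> topspace S. f z \<in> B}"
        using openin_continuous_map_preimage[OF cont AB(2)] .
      then have "openin M.mtopology {z \<in> topspace S. f z \<in> B}" using Md(3) by simp
      moreover have "y \<in> {z \<in> topspace S. f z \<in> B}" using AB(4) yG G.space by simp
      ultimately obtain r where r: "r > 0" "M.mball y r \<subseteq> {z \<in> topspace S. f z \<in> B}"
        unfolding M.openin_mtopology by blast
      obtain n :: nat where n: "2 / r < real n" using reals_Archimedean2 by blast
      then have "2 / r < real (Suc n)" by simp
      then have n': "2 / real (Suc n) < r" using r by (simp add: field_simps)
      have "Q (Suc n) \<subseteq> M.mball y r"
      proof
        fix z assume "z \<in> Q (Suc n)"
        then have z: "z \<in> C n" using CQ by blast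
        then have "z \<in> M" by (simp add: C_def)
        then show "z \<in> M.mball y r" using small[OF yC z] n' y by (auto simp: M.in_mball)
      qed
      then have "f ` Q (Suc n) \<subseteq> B" using r by blast
      moreover have "x \<in> T closure_of (f ` Q (Suc n))"
        using Q[of "Suc n"] using thick_subset by blast
      then obtain z where "z \<in> f ` Q (Suc n)" "z \<in> A"
        using closure_of_meets[OF _ AB(1,3)] by blast
      ultimately show False using AB(5) by (auto simp: disjnt_def)
    qed
    then show "x \<in> f ` V" using yV by blast
  qed
  moreover have "countable \<D>" unfolding \<D>_def using \<B> by simp
  ultimately show ?thesis using \<D> by blast
qed

text \<open>For \<open>h \<in> thick V\<close> the open sets \<open>thick V\<close> and \<open>h (thick V)\<close> both contain \<open>h\<close>, and \<open>f ` V\<close> and \<open>h (f ` V)\<close> are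
comeagre in them. So they meet, and \<open>h\<close> is a quotient of two elements of \<open>f ` V\<close>.\<close>

theorem open_at_one:
  assumes W: "openin S W" "\<one> \<in> W"
  shows "\<exists>N. openin T N \<and> \<one>\<^bsub>H\<^esub> \<in> N \<and> N \<subseteq> f ` W"
proof -
  obtain V where V: "openin S V" "\<one> \<in> V"
    and VW: "\<And>a b. a \<in> V \<Longrightarrow> b \<in> V \<Longrightarrow> a \<otimes> inv b \<in> W"
    using G.nbhd_rdiff[OF W] by blast
  have VG: "V \<subseteq> carrier G" using openin_subset[OF V(1)] by (simp add: G.space)
  obtain \<D> where \<D>: "countable \<D>" "\<And>E. E \<in> \<D> \<Longrightarrow> openin T E \<and> T closure_of E = topspace T"
    "thick V \<inter> \<Inter>\<D> \<subseteq> f ` V"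
    using thick_comeagre[OF V(1)] by blast
  have "thick V \<subseteq> f ` W"
  proof
    fix h assume h: "h \<in> thick V"
    have hH: "h \<in> carrier H" using h openin_subset[OF thick_open] H.space by blast
    let ?L = "\<lambda>x. h \<otimes>\<^bsub>H\<^esub> x"
    let ?\<D> = "\<D> \<union> (\<lambda>E. ?L ` E) ` \<D>"
    have "T closure_of \<Inter>?\<D> = topspace T"
    proof (rule Baire_category)
      show "completely_metrizable_space T \<or> locally_compact_space T \<and> regular_space T" using cmT by blast
      show "countable ?\<D>" using \<D>(1) by simp
      fix E assume "E \<in> ?\<D>"
      then consider "E \<in> \<D>" | E' where "E' \<in> \<D>" "E = ?L ` E'" by blast
      then show "openin T E \<and> T closure_of E = topspace T"
      proof cases
        case 1 then show ?thesis using \<D>(2) by blast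
      next
        case 2
        have "openin T E" using 2 \<D>(2) H.open_lmult[OF hH] by blast
        moreover have "T closure_of E = ?L ` (T closure_of E')"
          unfolding 2(2) by (rule H.closure_lmult[OF hH]) (use 2 \<D>(2) openin_subset H.space in blast)
        moreover have "?L ` topspace T = topspace T"
          using H.homeo_lmult[OF hH] homeomorphic_imp_surjective_map by blast
        ultimately show ?thesis using 2 \<D>(2) by auto
      qed
    qed
    moreover have "h \<in> ?L ` thick V"
      using almost_open_one[OF V] hH by (intro image_eqI[of _ _ "\<one>\<^bsub>H\<^esub>"]) auto
    moreover have "openin T (thick V \<inter> ?L ` thick V)"
      using H.open_lmult[OF hH thick_open] thick_open by blast
    moreover have "h \<in> T closure_of \<Inter>?\<D>"
      using calculation(1) hH H.space by simp
    ultimately obtain x where x: "x \<in> \<Inter>?\<D>" "x \<in> thick V" "x \<in> ?L ` thick V"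
      using closure_of_meets[of h T "\<Inter>?\<D>" "thick V \<inter> ?L ` thick V"] h by blast
    then obtain y where y: "y \<in> thick V" "x = ?L y" by blast
    have yH: "y \<in> carrier H" using y openin_subset[OF thick_open] H.space by blast
    have "y \<in> E" if "E \<in> \<D>" for E
    proof -
      have "x \<in> ?L ` E" using x that by blast
      then obtain z where z: "z \<in> E" "x = ?L z" by (rule imageE)
      have "E \<subseteq> carrier H" using that \<D>(2) openin_subset[of T E] H.space by simp
      then have "z \<in> carrier H" using z by blast
      then show ?thesis using z y(2) yH hH by simp
    qed
    then have "y \<in> f ` V" using \<D>(3) y by blast
    moreover have "x \<in> f ` V" using \<D>(3) x by blast
    ultimately obtain a b where ab: "a \<in> V" "b \<in> V" "x = f a" "y = f b" by blast
    have abG: "a \<in> carrier G" "b \<in> carrier G" using ab VG by auto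
    have "f (a \<otimes> inv b) = x \<otimes>\<^bsub>H\<^esub> inv\<^bsub>H\<^esub> y"
      using abG ab by (simp add: fmult finv)
    also have "\<dots> = h" using y(2) hH yH by (simp add: H.m_assoc)
    finally show "h \<in> f ` W" using VW ab by blast
  qed
  then show ?thesis using almost_open_one[OF V] thick_open by blast
qed

end

section \<open>Clopen subsets of a Stone space\<close>

locale stone_space =
  fixes X :: "'a topology"
  assumes stone: "second_countable_Stone_space X"
begin

definition clop :: "'a set set" where
  "clop = {A. openin X A \<and> closedin X A}"

lemma compact: "compact_space X" and haus: "Hausdorff_space X"
  using stone metrizable_imp_Hausdorff_space by (auto simp: second_countable_Stone_space_def)

lemma clopD: "A \<in> clop \<Longrightarrow> openin X A" "A \<in> clop \<Longrightarrow> closedin X A"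
  by (auto simp: clop_def)

lemma clop_subset: "A \<in> clop \<Longrightarrow> A \<subseteq> topspace X"
  by (rule openin_subset[OF clopD(1)])

lemma clop_in: "A \<in> clop \<Longrightarrow> x \<in> A \<Longrightarrow> x \<in> topspace X"
  using clop_subset by blast

lemma clop_empty [simp]: "{} \<in> clop"
  by (simp add: clop_def)

lemma clop_top [simp]: "topspace X \<in> clop"
  by (simp add: clop_def)

lemma clop_Int [intro]: "A \<in> clop \<Longrightarrow> B \<in> clop \<Longrightarrow> A \<inter> B \<in> clop"
  by (auto simp: clop_def)

lemma clop_Un [intro]: "A \<in> clop \<Longrightarrow> B \<in> clop \<Longrightarrow> A \<union> B \<in> clop"
  by (auto simp: clop_def)

lemma clop_Diff [intro]: "A \<in> clop \<Longrightarrow> B \<in> clop \<Longrightarrow> A - B \<in> clop"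
  by (auto simp: clop_def openin_diff closedin_diff)

lemma clop_Union: "finite \<A> \<Longrightarrow> \<A> \<subseteq> clop \<Longrightarrow> \<Union>\<A> \<in> clop"
  by (induction rule: finite_induct) auto

lemma clop_Inter: "finite \<A> \<Longrightarrow> \<A> \<subseteq> clop \<Longrightarrow> topspace X \<inter> \<Inter>\<A> \<in> clop"
proof (induction rule: finite_induct)
  case (insert A \<A>)
  then have "A \<inter> (topspace X \<inter> \<Inter>\<A>) \<in> clop" by blast
  then show ?case by (simp add: Int_left_commute)
qed auto

text \<open>In a compact Hausdorff space quasi-components are connected components, and the latter are points here.\<close>

lemma separate_points:
  assumes "x \<in> topspace X" "y \<in> topspace X" "x \<noteq> y"
  shows "\<exists>A\<in>clop. x \<in> A \<and> y \<notin> A"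
proof (rule ccontr)
  assume no: "\<not> ?thesis"
  have "x \<in> A \<longleftrightarrow> y \<in> A" if A: "A \<in> clop" for A
  proof -
    have "topspace X - A \<in> clop" using A by (intro clop_Diff clop_top)
    then show ?thesis using no A assms(1,2) by (metis DiffD2 DiffI)
  qed
  then have "quasi_component_of X x y"
    using assms by (auto simp: quasi_component_of_def clop_def)
  then have "connected_component_of X x y"
    using quasi_eq_connected_component_of compact haus by metis
  then obtain T where "connectedin X T" "x \<in> T" "y \<in> T"
    by (auto simp: connected_component_of_def)
  then show False
    using stone assms(3) unfolding second_countable_Stone_space_def totally_disconnected_space_def
    by (metis singletonD subsetD)
qed

lemma clop_basis:
  assumes U: "openin X U" "x \<in> U"
  shows "\<exists>A\<in>clop. x \<in> A \<and> A \<subseteq> U"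
proof -
  have x: "x \<in> topspace X" by (rule subsetD[OF openin_subset[OF U(1)] U(2)])
  let ?\<U> = "insert (topspace X - U) {A \<in> clop. x \<in> A}"
  have "\<Inter>?\<U> = {}"
  proof (rule ccontr)
    assume "\<Inter>?\<U> \<noteq> {}"
    then obtain y where y: "y \<in> topspace X - U" "\<And>A. A \<in> clop \<Longrightarrow> x \<in> A \<Longrightarrow> y \<in> A" by blast
    then have "x \<noteq> y" using U by blast
    then show False using separate_points[of x y] x y by blast
  qed
  moreover have "\<forall>C\<in>?\<U>. closedin X C" using U clopD by auto
  ultimately obtain \<F> where \<F>: "finite \<F>" "\<F> \<subseteq> ?\<U>" "\<Inter>\<F> = {}"
    using compact[unfolded compact_space_fip, rule_format, of ?\<U>] by blast
  let ?A = "topspace X \<inter> \<Inter>(\<F> - {topspace X - U})"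
  have "?A \<in> clop" using \<F> by (intro clop_Inter) auto
  moreover have "x \<in> ?A" using x \<F>(2) by blast
  moreover have "?A \<subseteq> U" using \<F>(3) by blast
  ultimately show ?thesis by (intro bexI[of _ ?A]) simp_all
qed

text \<open>Total boundedness gives a countable basis of balls, and a clopen set, being compact, is a finite
union of them.\<close>

lemma countable_clop: "countable clop"
proof -
  have "metrizable_space X" using stone by (simp add: second_countable_Stone_space_def)
  then obtain M d where Md: "Metric_space M d" "X = Metric_space.mtopology M d"
    unfolding metrizable_space_def by blast
  interpret M: Metric_space M d by (rule Md)
  have XM: "topspace X = M" using Md by simp
  have tb: "M.mtotally_bounded M"
    using compact Md M.compact_space_eq_mcomplete_mtotally_bounded by blast
  have "\<forall>n::nat. \<exists>K. finite K \<and> K \<subseteq> M \<and> M \<subseteq> (\<Union>x\<in>K. M.mball x (1 / real (Suc n)))"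
    using tb unfolding M.mtotally_bounded_def by simp
  then obtain K where K: "\<And>n. finite (K n)" "\<And>n. K n \<subseteq> M"
    "\<And>n::nat. M \<subseteq> (\<Union>x\<in>K n. M.mball x (1 / real (Suc n)))"
    by metis
  define \<B> where "\<B> = (\<Union>n. (\<lambda>x. M.mball x (1 / real (Suc n))) ` K n)"
  have \<B>: "countable \<B>" unfolding \<B>_def using K(1) by (simp add: countable_finite)
  have base: "\<exists>B\<in>\<B>. w \<in> B \<and> B \<subseteq> W" if W: "openin X W" "w \<in> W" for W w
  proof -
    obtain r where r: "r > 0" "M.mball w r \<subseteq> W"
      using W unfolding Md(2) M.openin_mtopology by blast
    obtain n :: nat where "2 / r < real n" using reals_Archimedean2 by blast
    then have "2 / r < real (Suc n)" by simp
    then have n: "2 * (1 / real (Suc n)) < r" using r by (simp add: field_simps)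
    have wM: "w \<in> M" using W openin_subset[OF W(1)] XM by blast
    then obtain c where c: "c \<in> K n" "w \<in> M.mball c (1 / real (Suc n))" using K(3) by blast
    have "M.mball c (1 / real (Suc n)) \<subseteq> M.mball w r"
    proof
      fix z assume z: "z \<in> M.mball c (1 / real (Suc n))"
      have "d w z \<le> d w c + d c z" using z c by (intro M.triangle) auto
      also have "\<dots> < 2 * (1 / real (Suc n))" using z c by (simp add: M.commute[of w c])
      finally show "z \<in> M.mball w r" using z wM n by auto
    qed
    then show ?thesis using c r(2) unfolding \<B>_def by blast
  qed
  have \<B>o: "openin X B" if "B \<in> \<B>" for B
    using that unfolding \<B>_def Md(2) by auto
  have "clop \<subseteq> Union ` {\<F>. finite \<F> \<and> \<F> \<subseteq> \<B>}"
  proof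
    fix A assume A: "A \<in> clop"
    have "compactin X A" using closedin_compact_space[OF compact clopD(2)[OF A]] .
    moreover have "A \<subseteq> \<Union>{B \<in> \<B>. B \<subseteq> A}"
      using base[OF clopD(1)[OF A]] by blast
    ultimately obtain \<F> where "finite \<F>" "\<F> \<subseteq> {B \<in> \<B>. B \<subseteq> A}" "A \<subseteq> \<Union>\<F>"
      unfolding compactin_def using \<B>o by (metis (no_types, lifting) mem_Collect_eq)
    then have "A = \<Union>\<F>" "finite \<F> \<and> \<F> \<subseteq> \<B>" by auto
    then show "A \<in> Union ` {\<F>. finite \<F> \<and> \<F> \<subseteq> \<B>}" by blast
  qed
  moreover have "countable {\<F>. finite \<F> \<and> \<F> \<subseteq> \<B>}"
    using countable_Collect_finite_subset[OF \<B>] .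
  ultimately show ?thesis by (meson countable_image countable_subset)
qed

section \<open>The homeomorphism group\<close>

abbreviation HG :: "('a \<Rightarrow> 'a) monoid" where "HG \<equiv> HomeoGroup X"

abbreviation mul :: "('a \<Rightarrow> 'a) \<Rightarrow> ('a \<Rightarrow> 'a) \<Rightarrow> 'a \<Rightarrow> 'a" (infixl "\<star>" 70) where
  "f \<star> g \<equiv> f \<otimes>\<^bsub>HomeoGroup X\<^esub> g"

abbreviation hinv :: "('a \<Rightarrow> 'a) \<Rightarrow> 'a \<Rightarrow> 'a" where
  "hinv f \<equiv> inv\<^bsub>HomeoGroup X\<^esub> f"

abbreviation hone :: "'a \<Rightarrow> 'a" where
  "hone \<equiv> \<one>\<^bsub>HomeoGroup X\<^esub>"

lemma carrier_HG [simp]: "carrier HG = Homeo X"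
  by (simp add: HomeoGroup_def)

lemma HomeoI:
  assumes "f \<in> extensional (topspace X)" "continuous_map X X f"
    "inj_on f (topspace X)" "f ` topspace X = topspace X"
  shows "f \<in> Homeo X"
  using assms continuous_imp_homeomorphic_map[OF _ compact haus] by (simp add: Homeo_def)

lemma Homeo_cont: "f \<in> Homeo X \<Longrightarrow> continuous_map X X f"
  by (auto simp: Homeo_def dest: homeomorphic_imp_continuous_map)

lemma Homeo_inj: "f \<in> Homeo X \<Longrightarrow> inj_on f (topspace X)"
  by (auto simp: Homeo_def dest: homeomorphic_imp_injective_map)

lemma Homeo_surj: "f \<in> Homeo X \<Longrightarrow> f ` topspace X = topspace X"
  by (auto simp: Homeo_def dest: homeomorphic_imp_surjective_map)

lemma Homeo_in [simp]: "f \<in> Homeo X \<Longrightarrow> x \<in> topspace X \<Longrightarrow> f x \<in> topspace X"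
  using Homeo_surj by blast

lemma Homeo_eqI:
  "f \<in> Homeo X \<Longrightarrow> g \<in> Homeo X \<Longrightarrow> (\<And>x. x \<in> topspace X \<Longrightarrow> f x = g x) \<Longrightarrow> f = g"
  by (auto simp: Homeo_def intro: extensionalityI)

lemma Homeo_inj_eq: "f \<in> Homeo X \<Longrightarrow> x \<in> topspace X \<Longrightarrow> y \<in> topspace X \<Longrightarrow> f x = f y \<longleftrightarrow> x = y"
  using Homeo_inj inj_on_eq_iff by metis

sublocale H: group "HomeoGroup X"
  by (rule group_HomeoGroup)

lemma mul_closed [simp]: "f \<in> Homeo X \<Longrightarrow> g \<in> Homeo X \<Longrightarrow> f \<star> g \<in> Homeo X"
  using H.m_closed by simp

lemma hinv_closed [simp]: "f \<in> Homeo X \<Longrightarrow> hinv f \<in> Homeo X"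
  using H.inv_closed by simp

lemma hone_closed [simp]: "hone \<in> Homeo X"
  using H.one_closed by simp

lemma mul_app [simp]:
  "f \<in> Homeo X \<Longrightarrow> g \<in> Homeo X \<Longrightarrow> x \<in> topspace X \<Longrightarrow> (f \<star> g) x = f (g x)"
  using subsetD[OF Homeo_subset_Bij, of f X] subsetD[OF Homeo_subset_Bij, of g X]
  by (simp add: HomeoGroup_def BijGroup_def compose_eq)

lemma hone_app [simp]: "x \<in> topspace X \<Longrightarrow> hone x = x"
  by (simp add: HomeoGroup_def BijGroup_def)

lemma hinv_app [simp]:
  assumes "f \<in> Homeo X" "x \<in> topspace X"
  shows "hinv f (f x) = x" "f (hinv f x) = x"
proof -
  have "hinv f (f x) = (hinv f \<star> f) x" "f (hinv f x) = (f \<star> hinv f) x"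
    using assms by (simp_all only: mul_app hinv_closed)
  then show "hinv f (f x) = x" "f (hinv f x) = x"
    using assms H.l_inv[of f] H.r_inv[of f] by simp_all
qed

lemma mul_image:
  assumes "f \<in> Homeo X" "g \<in> Homeo X" "A \<subseteq> topspace X"
  shows "(f \<star> g) ` A = f ` (g ` A)"
  unfolding image_image using assms by (intro image_cong) auto

lemma hinv_image:
  assumes "f \<in> Homeo X" "A \<subseteq> topspace X"
  shows "hinv f ` (f ` A) = A" "f ` (hinv f ` A) = A"
proof -
  have "(\<lambda>x. hinv f (f x)) ` A = (\<lambda>x. x) ` A" "(\<lambda>x. f (hinv f x)) ` A = (\<lambda>x. x) ` A"
    by (rule image_cong; use assms in auto)+
  then show "hinv f ` (f ` A) = A" "f ` (hinv f ` A) = A"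
    by (simp_all add: image_image)
qed

lemma hinv_image_eq:
  assumes "f \<in> Homeo X" "A \<subseteq> topspace X" "B \<subseteq> topspace X"
  shows "hinv f ` A = B \<longleftrightarrow> f ` B = A"
  using hinv_image[OF assms(1,2)] hinv_image[OF assms(1,3)] by auto

lemma hone_image: "A \<subseteq> topspace X \<Longrightarrow> hone ` A = A"
  by (force simp: image_iff subset_iff)

lemma Homeo_clop: "f \<in> Homeo X \<Longrightarrow> A \<in> clop \<Longrightarrow> f ` A \<in> clop"
  using homeomorphic_imp_open_map[of X X f] homeomorphic_imp_closed_map[of X X f]
  by (auto simp: clop_def Homeo_def open_map_def closed_map_def)

lemma Homeo_image_subset: "f \<in> Homeo X \<Longrightarrow> A \<subseteq> topspace X \<Longrightarrow> f ` A \<subseteq> topspace X"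
  by (auto simp: subset_iff)

lemma mem_hinv_image:
  assumes "f \<in> Homeo X" "A \<subseteq> topspace X" "x \<in> topspace X"
  shows "x \<in> hinv f ` A \<longleftrightarrow> f x \<in> A"
proof
  assume "x \<in> hinv f ` A"
  then show "f x \<in> A" using assms by (auto simp: subset_iff)
next
  assume "f x \<in> A"
  then have "hinv f (f x) \<in> hinv f ` A" by blast
  then show "x \<in> hinv f ` A" using assms by simp
qed

section \<open>The topology of clopen stabilisers\<close>

abbreviation Pt where "Pt \<equiv> product_topology (\<lambda>_. discrete_topology clop) clop"

text \<open>The inverse is recorded as well because the maps \<open>A \<mapsto> g ` A\<close> alone do not form a closed set: a pointwise
limit of bijections of the clopen algebra need not be surjective.\<close>

definition act :: "('a \<Rightarrow> 'a) \<Rightarrow> ('a set \<Rightarrow> 'a set) \<times> ('a set \<Rightarrow> 'a set)" where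
  "act g = (\<lambda>A\<in>clop. g ` A, \<lambda>A\<in>clop. hinv g ` A)"

definition htop :: "('a \<Rightarrow> 'a) topology" where
  "htop = pullback_topology (Homeo X) act (prod_topology Pt Pt)"

lemma act_in: "g \<in> Homeo X \<Longrightarrow> act g \<in> topspace (prod_topology Pt Pt)"
  by (auto simp: act_def topspace_product_topology Homeo_clop)

lemma topspace_htop [simp]: "topspace htop = Homeo X"
  unfolding htop_def topspace_pullback_topology using act_in by blast

lemma continuous_map_to_discrete:
  assumes "\<And>y. y \<in> topspace Y \<Longrightarrow> f y \<in> D"
    and "\<And>d. d \<in> D \<Longrightarrow> openin Y {y \<in> topspace Y. f y = d}"
  shows "continuous_map Y (discrete_topology D) f"
  unfolding continuous_map_def
proof (intro conjI allI impI)
  fix U assume "openin (discrete_topology D) U"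
  then have "{y \<in> topspace Y. f y \<in> U} = (\<Union>d\<in>U. {y \<in> topspace Y. f y = d})" and "U \<subseteq> D"
    by auto
  moreover have "openin Y (\<Union>d\<in>U. {y \<in> topspace Y. f y = d})"
    using assms(2) \<open>U \<subseteq> D\<close> by (intro openin_clauses(3)) auto
  ultimately show "openin Y {y \<in> topspace Y. f y \<in> U}" by simp
qed (use assms(1) in auto)

lemma act_cont: "continuous_map htop (prod_topology Pt Pt) act"
  using continuous_map_pullback[OF continuous_map_id] by (simp add: htop_def)

lemma coord_cont:
  assumes A: "A \<in> clop"
  shows "continuous_map (prod_topology Pt Pt) (discrete_topology clop) (\<lambda>z. fst z A)"
    and "continuous_map (prod_topology Pt Pt) (discrete_topology clop) (\<lambda>z. snd z A)"
  using continuous_map_compose[OF continuous_map_fst continuous_map_product_projection[OF A]]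
    continuous_map_compose[OF continuous_map_snd continuous_map_product_projection[OF A]]
  by (simp_all add: o_def)

lemma open_transporter:
  assumes A: "A \<in> clop"
  shows "openin htop {g \<in> Homeo X. g ` A = B}"
proof -
  have "continuous_map htop (discrete_topology clop) ((\<lambda>z. fst z A) \<circ> act)"
    by (rule continuous_map_compose[OF act_cont coord_cont(1)[OF A]])
  then have "openin htop {g \<in> topspace htop. ((\<lambda>z. fst z A) \<circ> act) g \<in> {B} \<inter> clop}"
    by (rule openin_continuous_map_preimage) simp
  moreover have "{g \<in> topspace htop. ((\<lambda>z. fst z A) \<circ> act) g \<in> {B} \<inter> clop} = {g \<in> Homeo X. g ` A = B}"
    using A by (auto simp: act_def Homeo_clop)
  ultimately show ?thesis by simp
qed

text \<open>A condition on the image of \<open>A\<close> under the inverse of \<open>g\<close> is a condition on the image of the clopen set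
\<open>g\<inverse> A\<close> under \<open>g\<close>, so finitely many conditions on images suffice.\<close>

lemma htop_basis:
  assumes W: "openin htop W" "g \<in> W"
  shows "\<exists>F. finite F \<and> F \<subseteq> clop \<and> {h \<in> Homeo X. \<forall>A\<in>F. h ` A = g ` A} \<subseteq> W"
proof -
  obtain U where U: "openin (prod_topology Pt Pt) U" "W = act -` U \<inter> Homeo X"
    using W(1) unfolding htop_def openin_pullback_topology by blast
  have g: "g \<in> Homeo X" "act g \<in> U" using U W by auto
  obtain P Q where PQ: "openin Pt P" "openin Pt Q" "fst (act g) \<in> P" "snd (act g) \<in> Q" "P \<times> Q \<subseteq> U"
    using openin_prod_topology_alt[THEN iffD1, OF U(1), rule_format, of "fst (act g)" "snd (act g)"] g(2)
    by auto
  obtain p where p: "finite {A \<in> clop. p A \<noteq> clop}" "fst (act g) \<in> Pi\<^sub>E clop p" "Pi\<^sub>E clop p \<subseteq> P"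
    using openin_product_topology_alt[THEN iffD1, OF PQ(1), rule_format, OF PQ(3)] by auto
  obtain q where q: "finite {A \<in> clop. q A \<noteq> clop}" "snd (act g) \<in> Pi\<^sub>E clop q" "Pi\<^sub>E clop q \<subseteq> Q"
    using openin_product_topology_alt[THEN iffD1, OF PQ(2), rule_format, OF PQ(4)] by auto
  define F where "F = {A \<in> clop. p A \<noteq> clop} \<union> (\<lambda>A. hinv g ` A) ` {A \<in> clop. q A \<noteq> clop}"
  have "{h \<in> Homeo X. \<forall>A\<in>F. h ` A = g ` A} \<subseteq> W"
  proof
    fix h assume "h \<in> {h \<in> Homeo X. \<forall>A\<in>F. h ` A = g ` A}"
    then have h: "h \<in> Homeo X" "\<And>A. A \<in> F \<Longrightarrow> h ` A = g ` A" by auto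
    have "fst (act h) A \<in> p A" if A: "A \<in> clop" for A
    proof (cases "p A = clop")
      case True then show ?thesis using A h(1) by (simp add: act_def Homeo_clop)
    next
      case False
      then have "h ` A = g ` A" using A h(2) by (auto simp: F_def)
      then have "fst (act h) A = fst (act g) A" using A by (simp add: act_def)
      then show ?thesis using p(2) A by auto
    qed
    then have "fst (act h) \<in> P" using p(3) by (auto simp: act_def PiE_iff)
    moreover have "snd (act h) A \<in> q A" if A: "A \<in> clop" for A
    proof (cases "q A = clop")
      case True then show ?thesis using A h(1) by (simp add: act_def Homeo_clop)
    next
      case False
      then have "h ` (hinv g ` A) = g ` (hinv g ` A)" using A by (intro h(2)) (auto simp: F_def)
      then have "h ` (hinv g ` A) = A" using hinv_image(2)[OF g(1) clop_subset[OF A]] by simp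
      then have "hinv h ` A = hinv g ` A"
        using hinv_image_eq[OF h(1) clop_subset[OF A]] clop_subset[OF Homeo_clop[OF hinv_closed[OF g(1)] A]] by blast
      then have "snd (act h) A = snd (act g) A" using A by (simp add: act_def)
      then show ?thesis using q(2) A by auto
    qed
    then have "snd (act h) \<in> Q" using q(3) by (auto simp: act_def PiE_iff)
    ultimately have "act h \<in> P \<times> Q" by (simp add: mem_Times_iff)
    then have "act h \<in> U" by (rule subsetD[OF PQ(5)])
    then show "h \<in> W" using U h by auto
  qed
  moreover have "finite F" using p(1) q(1) by (simp add: F_def)
  moreover have "F \<subseteq> clop" using Homeo_clop[OF hinv_closed[OF g(1)]] by (auto simp: F_def)
  ultimately show ?thesis by blast
qed

lemma continuous_map_into_htop:
  assumes f: "f \<in> topspace Y \<rightarrow> Homeo X"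
    and op: "\<And>A B. A \<in> clop \<Longrightarrow> B \<in> clop \<Longrightarrow> openin Y {y \<in> topspace Y. f y ` A = B}"
  shows "continuous_map Y htop f"
  unfolding htop_def
proof (rule continuous_map_pullback')
  have fH: "f y \<in> Homeo X" if "y \<in> topspace Y" for y using f that by auto
  have 1: "continuous_map Y (discrete_topology clop) (\<lambda>y. f y ` A)" if A: "A \<in> clop" for A
  proof (rule continuous_map_to_discrete)
    show "f y ` A \<in> clop" if "y \<in> topspace Y" for y
      using Homeo_clop[OF fH[OF that] A] .
    show "openin Y {y \<in> topspace Y. f y ` A = B}" if "B \<in> clop" for B
      using op[OF A that] .
  qed
  have 2: "continuous_map Y (discrete_topology clop) (\<lambda>y. hinv (f y) ` A)" if A: "A \<in> clop" for A
  proof (rule continuous_map_to_discrete)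
    show "hinv (f y) ` A \<in> clop" if "y \<in> topspace Y" for y
      using Homeo_clop[OF hinv_closed[OF fH[OF that]] A] .
    show "openin Y {y \<in> topspace Y. hinv (f y) ` A = B}" if B: "B \<in> clop" for B
    proof -
      have "{y \<in> topspace Y. hinv (f y) ` A = B} = {y \<in> topspace Y. f y ` B = A}"
        using hinv_image_eq[OF fH clop_subset[OF A] clop_subset[OF B]] by blast
      then show ?thesis using op[OF B A] by simp
    qed
  qed
  have "continuous_map Y Pt (\<lambda>y. \<lambda>A\<in>clop. f y ` A)" "continuous_map Y Pt (\<lambda>y. \<lambda>A\<in>clop. hinv (f y) ` A)"
    unfolding continuous_map_componentwise using 1 2 by auto
  then have "continuous_map Y (prod_topology Pt Pt) (\<lambda>y. (\<lambda>A\<in>clop. f y ` A, \<lambda>A\<in>clop. hinv (f y) ` A))"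
    by (rule continuous_map_pairedI)
  then show "continuous_map Y (prod_topology Pt Pt) (act \<circ> f)"
    by (simp add: act_def o_def)
  show "topspace Y \<subseteq> f -` Homeo X" using f by auto
qed

lemma topological_group_htop: "topological_group HG htop"
  unfolding topological_group_def
proof (intro conjI)
  show "group HG" by (rule group_HomeoGroup)
  show "topspace htop = carrier HG" by simp
  show "continuous_map (prod_topology htop htop) htop (\<lambda>(f, g). f \<star> g)"
  proof (rule continuous_map_into_htop)
    fix A B assume AB: "A \<in> clop" "B \<in> clop"
    have "{y \<in> topspace (prod_topology htop htop). (case y of (f, g) \<Rightarrow> f \<star> g) ` A = B} =
      (\<Union>C\<in>clop. {f \<in> Homeo X. f ` C = B} \<times> {g \<in> Homeo X. g ` A = C})"
    proof (rule Set.set_eqI)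
      fix z :: "('a \<Rightarrow> 'a) \<times> ('a \<Rightarrow> 'a)"
      obtain f g where z: "z = (f, g)" by force
      have "(f \<star> g) ` A = B \<longleftrightarrow> (\<exists>C\<in>clop. f ` C = B \<and> g ` A = C)" if "f \<in> Homeo X" "g \<in> Homeo X"
        using mul_image[OF that clop_subset[OF AB(1)]] Homeo_clop[OF that(2) AB(1)] by simp
      then show "z \<in> {y \<in> topspace (prod_topology htop htop). (case y of (f, g) \<Rightarrow> f \<star> g) ` A = B} \<longleftrightarrow>
        z \<in> (\<Union>C\<in>clop. {f \<in> Homeo X. f ` C = B} \<times> {g \<in> Homeo X. g ` A = C})"
        by (auto simp: z simp del: mul_app)
    qed
    also have "openin (prod_topology htop htop) \<dots>"
      using open_transporter AB
      by (intro openin_clauses(3)) (auto simp: openin_prod_Times_iff)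
    finally show "openin (prod_topology htop htop)
      {y \<in> topspace (prod_topology htop htop). (case y of (f, g) \<Rightarrow> f \<star> g) ` A = B}" .
  qed auto
  show "continuous_map htop htop (\<lambda>x. hinv x)"
  proof (rule continuous_map_into_htop)
    fix A B assume AB: "A \<in> clop" "B \<in> clop"
    have "{y \<in> topspace htop. hinv y ` A = B} = {y \<in> Homeo X. y ` B = A}"
      using hinv_image_eq[OF _ clop_subset[OF AB(1)] clop_subset[OF AB(2)]] by (simp cong: conj_cong)
    then show "openin htop {y \<in> topspace htop. hinv y ` A = B}"
      using open_transporter[OF AB(2)] by simp
  qed auto
qed

text \<open>Finitely many conditions of the form \<open>h ` A = B\<close> define a basic open set, and there are countably many such
sets of conditions.\<close>

lemma separable_htop: "separable_space htop"
proof (rule second_countable_imp_separable_space)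
  define N where "N R = {h \<in> Homeo X. \<forall>(A, B)\<in>R. h ` A = B}" for R
  have op: "openin htop (N R)" if R: "finite R" "R \<subseteq> clop \<times> clop" for R
    using R
  proof (induction rule: finite_induct)
    case empty
    have "N {} = topspace htop" by (auto simp: N_def)
    then show ?case by (metis openin_topspace)
  next
    case (insert z R)
    obtain A B where z: "z = (A, B)" by force
    have "N (insert z R) = {h \<in> Homeo X. h ` A = B} \<inter> N R" by (auto simp: N_def z)
    then show ?case using insert open_transporter[of A B] z by auto
  qed
  let ?\<B> = "N ` {R. finite R \<and> R \<subseteq> clop \<times> clop}"
  show "second_countable htop"
    unfolding second_countable_def
  proof (intro exI[of _ ?\<B>] conjI ballI allI impI)
    show "countable ?\<B>"
      by (intro countable_image countable_Collect_finite_subset countable_SIGMA countable_clop)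
    show "openin htop V" if "V \<in> ?\<B>" for V using that op by auto
    fix W g assume W: "openin htop W \<and> g \<in> W"
    obtain F where F: "finite F" "F \<subseteq> clop" "{h \<in> Homeo X. \<forall>A\<in>F. h ` A = g ` A} \<subseteq> W"
      using htop_basis[OF conjunct1[OF W] conjunct2[OF W]] by blast
    have g: "g \<in> Homeo X" using W openin_subset[of htop W] by auto
    let ?R = "(\<lambda>A. (A, g ` A)) ` F"
    have R: "?R \<in> {R. finite R \<and> R \<subseteq> clop \<times> clop}"
      using F Homeo_clop[OF g] by auto
    have N: "N ?R = {h \<in> Homeo X. \<forall>A\<in>F. h ` A = g ` A}" by (auto simp: N_def)
    show "\<exists>V\<in>?\<B>. g \<in> V \<and> V \<subseteq> W"
    proof (intro bexI conjI)
      show "N ?R \<in> ?\<B>" by (rule imageI[OF R])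
      show "g \<in> N ?R" unfolding N using g by simp
      show "N ?R \<subseteq> W" unfolding N by (rule F(3))
    qed
  qed
qed

section \<open>Stone duality and completeness\<close>

text \<open>A pair of mutually inverse order automorphisms of the clopen algebra; since complements and meets are
determined by the order, these are the automorphisms of the Boolean algebra.\<close>

definition dual_pair :: "('a set \<Rightarrow> 'a set) \<Rightarrow> ('a set \<Rightarrow> 'a set) \<Rightarrow> bool" where
  "dual_pair \<sigma> \<rho> \<longleftrightarrow> \<sigma> \<in> clop \<rightarrow> clop \<and> \<rho> \<in> clop \<rightarrow> clop \<and>
     (\<forall>A\<in>clop. \<rho> (\<sigma> A) = A \<and> \<sigma> (\<rho> A) = A) \<and>
     (\<forall>A\<in>clop. \<forall>B\<in>clop. A \<subseteq> B \<longrightarrow> \<sigma> A \<subseteq> \<sigma> B \<and> \<rho> A \<subseteq> \<rho> B)"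

text \<open>The graph of the point map that belongs to \<open>\<sigma>\<close>: the clopen neighbourhoods of \<open>x\<close> form an ultrafilter, \<open>\<sigma>\<close>
carries it to another one, and \<open>y\<close> is the point to which that one converges.\<close>

definition dual_rel :: "('a set \<Rightarrow> 'a set) \<Rightarrow> 'a \<Rightarrow> 'a \<Rightarrow> bool" where
  "dual_rel \<sigma> x y \<longleftrightarrow> x \<in> topspace X \<and> y \<in> topspace X \<and> (\<forall>A\<in>clop. x \<in> A \<longrightarrow> y \<in> \<sigma> A)"

lemma dual_pair_sym: "dual_pair \<sigma> \<rho> \<Longrightarrow> dual_pair \<rho> \<sigma>"
  by (auto simp: dual_pair_def)

lemma dual_pairD:
  assumes "dual_pair \<sigma> \<rho>" "A \<in> clop"
  shows "\<sigma> A \<in> clop" "\<rho> A \<in> clop" "\<rho> (\<sigma> A) = A" "\<sigma> (\<rho> A) = A"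
  using assms by (auto simp: dual_pair_def)

lemma dual_pair_mono:
  assumes "dual_pair \<sigma> \<rho>" "A \<in> clop" "B \<in> clop" "A \<subseteq> B"
  shows "\<sigma> A \<subseteq> \<sigma> B"
  using assms by (auto simp: dual_pair_def)

lemma dual_pair_empty:
  assumes "dual_pair \<sigma> \<rho>"
  shows "\<sigma> {} = {}"
proof -
  have "\<sigma> {} \<subseteq> \<sigma> (\<rho> {})"
    using dual_pair_mono[OF assms clop_empty dual_pairD(2)[OF assms clop_empty]] by simp
  then show ?thesis using dual_pairD(4)[OF assms clop_empty] by simp
qed

lemma dual_pair_disjoint:
  assumes dp: "dual_pair \<sigma> \<rho>" and AB: "A \<in> clop" "B \<in> clop" "A \<inter> B = {}"
  shows "\<sigma> A \<inter> \<sigma> B = {}"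
proof -
  have dp': "dual_pair \<rho> \<sigma>" by (rule dual_pair_sym[OF dp])
  let ?D = "\<sigma> A \<inter> \<sigma> B"
  have D: "?D \<in> clop" using dual_pairD[OF dp] AB by blast
  have "\<rho> ?D \<subseteq> \<rho> (\<sigma> A)" "\<rho> ?D \<subseteq> \<rho> (\<sigma> B)"
    using dual_pair_mono[OF dp' D] dual_pairD(1)[OF dp] AB by auto
  then have "\<rho> ?D = {}" using dual_pairD(3)[OF dp] AB by auto
  then have "\<sigma> (\<rho> ?D) = {}" using dual_pair_empty[OF dp] by simp
  then show ?thesis using dual_pairD(4)[OF dp D] by simp
qed

lemma dual_rel_sym:
  assumes dp: "dual_pair \<sigma> \<rho>" and xy: "dual_rel \<sigma> x y"
  shows "dual_rel \<rho> y x"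
  unfolding dual_rel_def
proof (intro conjI ballI impI)
  show "y \<in> topspace X" "x \<in> topspace X" using xy by (auto simp: dual_rel_def)
  fix B assume B: "B \<in> clop" "y \<in> B"
  show "x \<in> \<rho> B"
  proof (rule ccontr)
    assume "x \<notin> \<rho> B"
    let ?C = "topspace X - \<rho> B"
    have C: "?C \<in> clop" "\<rho> B \<in> clop" using dual_pairD(2)[OF dp B(1)] by auto
    then have "y \<in> \<sigma> ?C" using xy \<open>x \<notin> \<rho> B\<close> by (auto simp: dual_rel_def)
    moreover have "\<sigma> ?C \<inter> \<sigma> (\<rho> B) = {}" by (rule dual_pair_disjoint[OF dp C]) auto
    ultimately show False using B dual_pairD(4)[OF dp B(1)] by auto
  qed
qed

text \<open>The images under \<open>\<sigma>\<close> of the clopen neighbourhoods of \<open>x\<close> have the finite intersection property, because \<open>\<sigma>\<close>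
is monotone and maps non-empty sets to non-empty sets.\<close>

lemma dual_rel_exists:
  assumes dp: "dual_pair \<sigma> \<rho>" and x: "x \<in> topspace X"
  shows "\<exists>y. dual_rel \<sigma> x y"
proof -
  let ?\<U> = "\<sigma> ` {A \<in> clop. x \<in> A}"
  have "\<forall>C\<in>?\<U>. closedin X C" using dual_pairD(1)[OF dp] clopD(2) by auto
  moreover have "\<Inter>\<F> \<noteq> {}" if \<F>: "finite \<F>" "\<F> \<subseteq> ?\<U>" for \<F>
  proof -
    obtain \<A> where \<A>: "finite \<A>" "\<A> \<subseteq> {A \<in> clop. x \<in> A}" "\<F> = \<sigma> ` \<A>"
      using finite_subset_image[OF \<F>] by blast
    let ?B = "topspace X \<inter> \<Inter>\<A>"
    have B: "?B \<in> clop" using \<A> by (intro clop_Inter) auto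
    have "x \<in> ?B" using \<A> x by auto
    then have "\<sigma> ?B \<noteq> {}"
      using dual_pairD(3)[OF dp B] dual_pair_empty[OF dual_pair_sym[OF dp]] by (metis empty_iff)
    moreover have "\<sigma> ?B \<subseteq> \<sigma> A" if "A \<in> \<A>" for A
      using \<A>(2) that by (intro dual_pair_mono[OF dp B]) auto
    ultimately show ?thesis unfolding \<A>(3) by blast
  qed
  ultimately have "\<Inter>?\<U> \<noteq> {}"
    using compact[unfolded compact_space_fip] by (metis (no_types, lifting))
  then have "\<exists>y. y \<in> \<Inter>?\<U>" unfolding ex_in_conv .
  then obtain y where y: "y \<in> \<Inter>?\<U>" ..
  have "y \<in> \<sigma> (topspace X)" using y x by auto
  then have "y \<in> topspace X" using clop_subset[OF dual_pairD(1)[OF dp clop_top]] by auto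
  then have "dual_rel \<sigma> x y" using y x by (auto simp: dual_rel_def)
  then show ?thesis ..
qed

lemma dual_rel_unique:
  assumes dp: "dual_pair \<sigma> \<rho>" and "dual_rel \<sigma> x y" "dual_rel \<sigma> x z"
  shows "y = z"
proof (rule ccontr)
  assume "y \<noteq> z"
  then obtain B where B: "B \<in> clop" "y \<in> B" "z \<notin> B"
    using separate_points[of y z] assms by (auto simp: dual_rel_def)
  then have "x \<in> \<rho> B" using dual_rel_sym[OF dp assms(2)] by (auto simp: dual_rel_def)
  then have "z \<in> \<sigma> (\<rho> B)" using assms(3) dual_pairD(2)[OF dp B(1)] by (auto simp: dual_rel_def)
  then show False using B dual_pairD(4)[OF dp B(1)] by simp
qed

lemma dual_pair_homeo:
  assumes dp: "dual_pair \<sigma> \<rho>"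
  shows "\<exists>g\<in>Homeo X. \<forall>A\<in>clop. g ` A = \<sigma> A"
proof -
  have dp': "dual_pair \<rho> \<sigma>" by (rule dual_pair_sym[OF dp])
  define g where "g = (\<lambda>x\<in>topspace X. SOME y. dual_rel \<sigma> x y)"
  have g: "dual_rel \<sigma> x (g x)" if "x \<in> topspace X" for x
    using someI_ex[OF dual_rel_exists[OF dp that]] that by (simp add: g_def)
  have gX: "g x \<in> topspace X" if "x \<in> topspace X" for x
    using g[OF that] by (simp add: dual_rel_def)
  have pre: "\<exists>x. x \<in> topspace X \<and> dual_rel \<rho> y x \<and> g x = y" if y: "y \<in> topspace X" for y
  proof -
    obtain x where x: "dual_rel \<rho> y x" using dual_rel_exists[OF dp' y] by blast
    then have "x \<in> topspace X" by (simp add: dual_rel_def)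
    moreover have "dual_rel \<sigma> x y" by (rule dual_rel_sym[OF dp' x])
    ultimately show ?thesis using x g dual_rel_unique[OF dp] by blast
  qed
  have img: "g ` A = \<sigma> A" if A: "A \<in> clop" for A
  proof
    show "g ` A \<subseteq> \<sigma> A" using g A clop_in[OF A] by (auto simp: dual_rel_def)
    show "\<sigma> A \<subseteq> g ` A"
    proof
      fix y assume y: "y \<in> \<sigma> A"
      have "y \<in> topspace X" using y dual_pairD(1)[OF dp A] clop_in by blast
      then obtain x where x: "dual_rel \<rho> y x" "g x = y" using pre by blast
      then have "x \<in> \<rho> (\<sigma> A)" using y dual_pairD(1)[OF dp A] by (simp add: dual_rel_def)
      then show "y \<in> g ` A" using x(2) dual_pairD(3)[OF dp A] by auto
    qed
  qed
  have "g \<in> Homeo X"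
  proof (rule HomeoI)
    show "g \<in> extensional (topspace X)" by (simp add: g_def)
    show "g ` topspace X = topspace X" using gX pre by (auto simp: image_iff)
    show "inj_on g (topspace X)"
    proof (rule inj_onI)
      fix x x' assume "x \<in> topspace X" "x' \<in> topspace X" "g x = g x'"
      then show "x = x'"
        using dual_rel_sym[OF dp g] dual_rel_unique[OF dp'] by metis
    qed
    show "continuous_map X X g"
      unfolding continuous_map_def
    proof (intro conjI allI impI)
      show "g \<in> topspace X \<rightarrow> topspace X" using gX by blast
      fix U assume U: "openin X U"
      show "openin X {x \<in> topspace X. g x \<in> U}"
      proof (subst openin_subopen, intro ballI)
        fix x assume "x \<in> {x \<in> topspace X. g x \<in> U}"
        then have x: "x \<in> topspace X" "g x \<in> U" by auto
        obtain B where B: "B \<in> clop" "g x \<in> B" "B \<subseteq> U" using clop_basis[OF U x(2)] by blast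
        have "x \<in> \<rho> B" using dual_rel_sym[OF dp g[OF x(1)]] B by (simp add: dual_rel_def)
        moreover have "\<rho> B \<subseteq> {x \<in> topspace X. g x \<in> U}"
          using img[OF dual_pairD(2)[OF dp B(1)]] dual_pairD(4)[OF dp B(1)] B(3)
            clop_subset[OF dual_pairD(2)[OF dp B(1)]] by auto
        ultimately show "\<exists>T. openin X T \<and> x \<in> T \<and> T \<subseteq> {x \<in> topspace X. g x \<in> U}"
          using clopD(1)[OF dual_pairD(2)[OF dp B(1)]] by blast
      qed
    qed
  qed
  with img show ?thesis by blast
qed

text \<open>Being a \<open>dual_pair\<close> is a conjunction of conditions on finitely many coordinates each, and by Stone
duality it characterises the image.\<close>

lemma act_image_closed: "closedin (prod_topology Pt Pt) (act ` Homeo X)"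
proof -
  let ?Q = "\<lambda>A B (a, b, c, d). (a = B \<longleftrightarrow> d = A) \<and> (A \<subseteq> B \<longrightarrow> a \<subseteq> b \<and> c \<subseteq> d)"
  let ?h = "\<lambda>A B z. (fst z A, fst z B, snd z A, snd z B)"
  let ?K = "\<lambda>A B. {z \<in> topspace (prod_topology Pt Pt). ?Q A B (?h A B z)}"
  have K: "closedin (prod_topology Pt Pt) (?K A B)" if AB: "A \<in> clop" "B \<in> clop" for A B
  proof -
    let ?D = "discrete_topology (clop \<times> clop \<times> clop \<times> clop)"
    have "continuous_map (prod_topology Pt Pt) ?D (?h A B)"
      unfolding prod_topology_discrete_topology
      by (intro continuous_map_pairedI coord_cont AB)
    then have "closedin (prod_topology Pt Pt)
      {z \<in> topspace (prod_topology Pt Pt). ?h A B z \<in> {t \<in> clop \<times> clop \<times> clop \<times> clop. ?Q A B t}}"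
      by (rule closedin_continuous_map_preimage) auto
    moreover have "{z \<in> topspace (prod_topology Pt Pt). ?h A B z \<in> {t \<in> clop \<times> clop \<times> clop \<times> clop. ?Q A B t}} = ?K A B"
      using AB by (auto simp: topspace_product_topology)
    ultimately show ?thesis by simp
  qed
  have "act ` Homeo X = \<Inter>((\<lambda>(A, B). ?K A B) ` (clop \<times> clop))"
  proof
    show "act ` Homeo X \<subseteq> \<Inter>((\<lambda>(A, B). ?K A B) ` (clop \<times> clop))"
    proof (intro subsetI InterI)
      fix z K assume "z \<in> act ` Homeo X" "K \<in> (\<lambda>(A, B). ?K A B) ` (clop \<times> clop)"
      then obtain g A B where g: "g \<in> Homeo X" and AB: "A \<in> clop" "B \<in> clop"
        and zK: "z = act g" "K = ?K A B"
        by auto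
      have "?Q A B (?h A B (act g))"
        using AB hinv_image_eq[OF g clop_subset[OF AB(2)] clop_subset[OF AB(1)]]
        by (auto simp: act_def)
      then show "z \<in> K" using act_in[OF g] unfolding zK by blast
    qed
    show "\<Inter>((\<lambda>(A, B). ?K A B) ` (clop \<times> clop)) \<subseteq> act ` Homeo X"
    proof
      fix z assume zI: "z \<in> \<Inter>((\<lambda>(A, B). ?K A B) ` (clop \<times> clop))"
      have z: "z \<in> ?K A B" if "A \<in> clop" "B \<in> clop" for A B
      proof (rule InterD[OF zI])
        show "?K A B \<in> (\<lambda>(A, B). ?K A B) ` (clop \<times> clop)"
          using that by (intro image_eqI[of _ _ "(A, B)"]) auto
      qed
      obtain \<sigma> \<rho> where sr: "z = (\<sigma>, \<rho>)" by force
      have top: "\<sigma> \<in> clop \<rightarrow>\<^sub>E clop" "\<rho> \<in> clop \<rightarrow>\<^sub>E clop"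
        using z[OF clop_empty clop_empty] by (auto simp: sr topspace_product_topology)
      have eq: "\<sigma> A = B \<longleftrightarrow> \<rho> B = A" if "A \<in> clop" "B \<in> clop" for A B
        using z[OF that] by (simp add: sr)
      have mono: "\<sigma> A \<subseteq> \<sigma> B \<and> \<rho> A \<subseteq> \<rho> B" if "A \<in> clop" "B \<in> clop" "A \<subseteq> B" for A B
        using z[OF that(1,2)] that(3) by (simp add: sr)
      have cl: "\<sigma> A \<in> clop" "\<rho> A \<in> clop" if "A \<in> clop" for A
        using top that by auto
      have "\<rho> (\<sigma> A) = A \<and> \<sigma> (\<rho> A) = A" if "A \<in> clop" for A
        using eq[OF that cl(1)[OF that]] eq[OF cl(2)[OF that] that] by simp
      then have "dual_pair \<sigma> \<rho>"
        unfolding dual_pair_def using cl mono by (intro conjI funcsetI ballI impI) simp_all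
      then obtain g where g: "g \<in> Homeo X" "\<And>A. A \<in> clop \<Longrightarrow> g ` A = \<sigma> A"
        using dual_pair_homeo[OF \<open>dual_pair \<sigma> \<rho>\<close>] by auto
      have "hinv g ` A = \<rho> A" if A: "A \<in> clop" for A
      proof -
        have rA: "\<rho> A \<in> clop" using top A by auto
        have "\<sigma> (\<rho> A) = A" using eq[OF rA A] by simp
        then have "g ` (\<rho> A) = A" using g(2)[OF rA] by simp
        then show ?thesis
          using hinv_image_eq[OF g(1) clop_subset[OF A] clop_subset[OF rA]] by simp
      qed
      moreover have "\<sigma> \<in> extensional clop" "\<rho> \<in> extensional clop" using top by (auto simp: PiE_iff)
      ultimately have "(\<lambda>A\<in>clop. g ` A) = \<sigma>" "(\<lambda>A\<in>clop. hinv g ` A) = \<rho>"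
        using g(2) by (auto intro: extensionalityI)
      then have "act g = z" by (simp add: act_def sr)
      then show "z \<in> act ` Homeo X" using g(1) by blast
    qed
  qed
  moreover have "closedin (prod_topology Pt Pt) (\<Inter>((\<lambda>(A, B). ?K A B) ` (clop \<times> clop)))"
  proof (rule closedin_Inter)
    show "(\<lambda>(A, B). ?K A B) ` (clop \<times> clop) \<noteq> {}" using clop_empty by blast
  qed (use K in auto)
  ultimately show ?thesis by simp
qed

lemma completely_metrizable_htop: "completely_metrizable_space htop"
proof -
  have "completely_metrizable_space Pt"
    unfolding completely_metrizable_space_product_topology
    using countable_clop by (auto simp: completely_metrizable_space_discrete_topology intro: countable_subset)
  then have cm: "completely_metrizable_space (prod_topology Pt Pt)"
    by (simp add: completely_metrizable_space_prod_topology)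
  have inj: "inj_on act (Homeo X)"
  proof (rule inj_onI)
    fix g h assume gh: "g \<in> Homeo X" "h \<in> Homeo X" "act g = act h"
    have "g x = h x" if x: "x \<in> topspace X" for x
    proof (rule ccontr)
      assume "g x \<noteq> h x"
      then obtain B where B: "B \<in> clop" "g x \<in> B" "h x \<notin> B"
        using separate_points[of "g x" "h x"] gh x by auto
      have "hinv g ` B = hinv h ` B"
        using arg_cong[OF gh(3), of "\<lambda>z. snd z B"] B(1) by (simp add: act_def)
      then show False
        using mem_hinv_image[OF gh(1) clop_subset[OF B(1)] x] mem_hinv_image[OF gh(2) clop_subset[OF B(1)] x] B
        by simp
    qed
    then show "g = h" using gh Homeo_eqI by blast
  qed
  have "homeomorphic_map htop (subtopology (prod_topology Pt Pt) (act ` Homeo X)) act"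
  proof (rule bijective_open_imp_homeomorphic_map)
    show "continuous_map htop (subtopology (prod_topology Pt Pt) (act ` Homeo X)) act"
      using act_cont by (simp add: continuous_map_in_subtopology)
    show "open_map htop (subtopology (prod_topology Pt Pt) (act ` Homeo X)) act"
      unfolding open_map_def
    proof (intro allI impI)
      fix U assume "openin htop U"
      then obtain V where V: "openin (prod_topology Pt Pt) V" "U = act -` V \<inter> Homeo X"
        unfolding htop_def openin_pullback_topology by blast
      have "act ` U = V \<inter> act ` Homeo X" using V(2) by auto
      then show "openin (subtopology (prod_topology Pt Pt) (act ` Homeo X)) (act ` U)"
        using V(1) by (auto simp: openin_subtopology)
    qed
    show "act ` topspace htop = topspace (subtopology (prod_topology Pt Pt) (act ` Homeo X))"
    proof -
      have "act ` Homeo X \<subseteq> topspace (prod_topology Pt Pt)" using act_in by blast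
      then show ?thesis by (simp only: topspace_subtopology topspace_htop Int_absorb1)
    qed
    show "inj_on act (topspace htop)" using inj by simp
  qed
  then have "htop homeomorphic_space subtopology (prod_topology Pt Pt) (act ` Homeo X)"
    using homeomorphic_map_imp_homeomorphic_space by blast
  then show ?thesis
    using homeomorphic_completely_metrizable_space completely_metrizable_space_closedin[OF cm act_image_closed]
    by blast
qed

theorem Polish_htop: "Polish_group_topology HG htop"
  by (simp add: Polish_group_topology_def topological_group_htop separable_htop completely_metrizable_htop)


section \<open>Embeddings of clopen sets and exchanges\<close>

text \<open>Homeomorphisms are built below from infinitely many pieces that accumulate at one point, so continuity
is checked point by point.\<close>

definition cont_at :: "('a \<Rightarrow> 'a) \<Rightarrow> 'a \<Rightarrow> bool" where
  "cont_at f x \<longleftrightarrow> (\<forall>W. openin X W \<and> f x \<in> W \<longrightarrow> (\<exists>N. openin X N \<and> x \<in> N \<and> f ` N \<subseteq> W))"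

lemma cont_atD:
  "cont_at f x \<Longrightarrow> openin X W \<Longrightarrow> f x \<in> W \<Longrightarrow> \<exists>N. openin X N \<and> x \<in> N \<and> f ` N \<subseteq> W"
  by (simp add: cont_at_def)

lemma cont_at_cong:
  assumes f: "cont_at f x" and N: "openin X N" "x \<in> N" "\<And>y. y \<in> N \<Longrightarrow> g y = f y"
  shows "cont_at g x"
  unfolding cont_at_def
proof (intro allI impI)
  fix W assume W: "openin X W \<and> g x \<in> W"
  then obtain N' where N': "openin X N'" "x \<in> N'" "f ` N' \<subseteq> W"
    using cont_atD[OF f] N(2,3) by metis
  have "g ` (N \<inter> N') \<subseteq> W" using N(3) N'(3) by auto
  then show "\<exists>M. openin X M \<and> x \<in> M \<and> g ` M \<subseteq> W"
    using N(1,2) N'(1,2) by (intro exI[of _ "N \<inter> N'"]) auto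
qed

lemma cont_at_comp:
  assumes f: "cont_at f x" and g: "cont_at g (f x)"
  shows "cont_at (\<lambda>y. g (f y)) x"
  unfolding cont_at_def
proof (intro allI impI)
  fix W assume W: "openin X W \<and> g (f x) \<in> W"
  then obtain N where N: "openin X N" "f x \<in> N" "g ` N \<subseteq> W"
    using cont_atD[OF g] by blast
  obtain N' where N': "openin X N'" "x \<in> N'" "f ` N' \<subseteq> N"
    using cont_atD[OF f N(1,2)] by blast
  have "(\<lambda>y. g (f y)) ` N' \<subseteq> W" using N(3) N'(3) by auto
  then show "\<exists>M. openin X M \<and> x \<in> M \<and> (\<lambda>y. g (f y)) ` M \<subseteq> W"
    using N' by blast
qed

lemma cont_at_id: "cont_at (\<lambda>y. y) x"
  unfolding cont_at_def by auto

lemma continuous_map_cont_at: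
  assumes f: "continuous_map X X f" and x: "x \<in> topspace X"
  shows "cont_at f x"
  unfolding cont_at_def
proof (intro allI impI)
  fix W assume W: "openin X W \<and> f x \<in> W"
  then have "openin X {y \<in> topspace X. f y \<in> W}"
    using openin_continuous_map_preimage[OF f] by blast
  then show "\<exists>N. openin X N \<and> x \<in> N \<and> f ` N \<subseteq> W"
    using W x by (intro exI[of _ "{y \<in> topspace X. f y \<in> W}"]) auto
qed

lemma Homeo_cont_at: "f \<in> Homeo X \<Longrightarrow> x \<in> topspace X \<Longrightarrow> cont_at f x"
  by (rule continuous_map_cont_at[OF Homeo_cont])

lemma continuous_map_from_cont_at:
  assumes f: "\<And>x. x \<in> topspace X \<Longrightarrow> f x \<in> topspace X" "\<And>x. x \<in> topspace X \<Longrightarrow> cont_at f x"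
  shows "continuous_map X X f"
  unfolding continuous_map_def
proof (intro conjI allI impI)
  show "f \<in> topspace X \<rightarrow> topspace X" using f(1) by blast
  fix W assume W: "openin X W"
  show "openin X {x \<in> topspace X. f x \<in> W}"
  proof (subst openin_subopen, intro ballI)
    fix x assume "x \<in> {x \<in> topspace X. f x \<in> W}"
    then obtain N where N: "openin X N" "x \<in> N" "f ` N \<subseteq> W"
      using cont_atD[OF f(2) W] by blast
    then have "N \<subseteq> {x \<in> topspace X. f x \<in> W}"
      using openin_subset[OF N(1)] by auto
    then show "\<exists>T. openin X T \<and> x \<in> T \<and> T \<subseteq> {x \<in> topspace X. f x \<in> W}"
      using N by blast
  qed
qed

text \<open>Continuity of the inverse is automatic by compactness. Restricting makes the function extensional, as the
elements of \<open>Homeo X\<close> are.\<close>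

lemma Homeo_restrictI:
  assumes "bij_betw f (topspace X) (topspace X)" "\<And>x. x \<in> topspace X \<Longrightarrow> cont_at f x"
  shows "restrict f (topspace X) \<in> Homeo X"
proof (rule HomeoI)
  show "restrict f (topspace X) ` topspace X = topspace X" "inj_on (restrict f (topspace X)) (topspace X)"
    using assms(1) by (auto simp: bij_betw_def inj_on_def)
  have "cont_at (restrict f (topspace X)) x" if "x \<in> topspace X" for x
    by (rule cont_at_cong[OF assms(2)[OF that] openin_topspace that]) simp
  then show "continuous_map X X (restrict f (topspace X))"
    using assms(1) by (intro continuous_map_from_cont_at) (auto simp: bij_betw_def)
qed simp

definition emb :: "'a set \<Rightarrow> ('a \<Rightarrow> 'a) \<Rightarrow> bool" where
  "emb A h \<longleftrightarrow> A \<in> clop \<and> h ` A \<in> clop \<and> inj_on h A \<and> (\<forall>x\<in>A. cont_at h x)"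

lemma embD:
  assumes "emb A h"
  shows "A \<in> clop" "h ` A \<in> clop" "inj_on h A" "x \<in> A \<Longrightarrow> cont_at h x"
  using assms by (auto simp: emb_def)

lemma emb_continuous:
  assumes "emb A h"
  shows "continuous_map (subtopology X A) X h"
  unfolding continuous_map_def
proof (intro conjI allI impI)
  show "h \<in> topspace (subtopology X A) \<rightarrow> topspace X"
    using clop_subset[OF embD(2)[OF assms]] by auto
  fix W assume W: "openin X W"
  have "openin X {x \<in> A. h x \<in> W}"
  proof (subst openin_subopen, intro ballI)
    fix x assume x: "x \<in> {x \<in> A. h x \<in> W}"
    then obtain N where N: "openin X N" "x \<in> N" "h ` N \<subseteq> W"
      using cont_atD[OF embD(4)[OF assms] W] by blast
    then have "openin X (N \<inter> A)" "x \<in> N \<inter> A" "N \<inter> A \<subseteq> {x \<in> A. h x \<in> W}"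
      using clopD(1)[OF embD(1)[OF assms]] x by auto
    then show "\<exists>T. openin X T \<and> x \<in> T \<and> T \<subseteq> {x \<in> A. h x \<in> W}" by blast
  qed
  moreover have "{x \<in> topspace (subtopology X A). h x \<in> W} = {x \<in> A. h x \<in> W}"
    using clop_subset[OF embD(1)[OF assms]] by auto
  ultimately show "openin (subtopology X A) {x \<in> topspace (subtopology X A). h x \<in> W}"
    by (auto simp: openin_subtopology intro!: exI[of _ "{x \<in> A. h x \<in> W}"])
qed

lemma embI:
  assumes A: "A \<in> clop" "h ` A \<in> clop" "inj_on h A" and c: "continuous_map (subtopology X A) X h"
  shows "emb A h"
  unfolding emb_def
proof (intro conjI ballI A)
  fix x assume x: "x \<in> A"
  show "cont_at h x"
    unfolding cont_at_def
  proof (intro allI impI)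
    fix W assume W: "openin X W \<and> h x \<in> W"
    have "openin (subtopology X A) {y \<in> topspace (subtopology X A). h y \<in> W}"
      using openin_continuous_map_preimage[OF c] W by blast
    then have "openin X {y \<in> topspace (subtopology X A). h y \<in> W}"
      by (rule openin_trans_full[OF _ clopD(1)[OF A(1)]])
    then show "\<exists>N. openin X N \<and> x \<in> N \<and> h ` N \<subseteq> W"
      using W x clop_in[OF A(1) x] by (intro exI[of _ "{y \<in> topspace (subtopology X A). h y \<in> W}"]) auto
  qed
qed

lemma emb_closed_image:
  assumes h: "emb A h" and C: "closedin X C" "C \<subseteq> A"
  shows "closedin X (h ` C)"
proof -
  have "compactin X C" using closedin_compact_space[OF compact C(1)] .
  then have "compactin (subtopology X A) C" using C(2) by (simp add: compactin_subtopology)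
  then have "compactin X (h ` C)" by (rule image_compactin[OF _ emb_continuous[OF h]])
  then show ?thesis by (rule compactin_imp_closedin[OF haus])
qed

text \<open>The image of a clopen part is closed by compactness, and open because it is the image of the whole set minus the
closed image of the complementary part.\<close>

lemma emb_sub:
  assumes h: "emb A h" and B: "B \<in> clop" "B \<subseteq> A"
  shows "emb B h"
  unfolding emb_def
proof (intro conjI ballI B(1))
  have "A - B \<in> clop" using embD(1)[OF h] B by blast
  then have "closedin X (h ` (A - B))" using emb_closed_image[OF h clopD(2)] by blast
  then have "openin X (h ` A - h ` (A - B))" using clopD(1)[OF embD(2)[OF h]] by blast
  moreover have "h ` A - h ` (A - B) = h ` B"
    using embD(3)[OF h] B(2) by (auto simp: inj_on_def)
  ultimately show "h ` B \<in> clop"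
    using emb_closed_image[OF h clopD(2)[OF B(1)] B(2)] by (simp add: clop_def)
  show "inj_on h B" by (rule inj_on_subset[OF embD(3)[OF h] B(2)])
  show "cont_at h x" if "x \<in> B" for x using embD(4)[OF h] B(2) that by blast
qed

lemma emb_image: "emb A h \<Longrightarrow> B \<in> clop \<Longrightarrow> B \<subseteq> A \<Longrightarrow> h ` B \<in> clop"
  by (rule embD(2)[OF emb_sub])

lemma emb_comp:
  assumes h: "emb A h" and k: "emb (h ` A) k"
  shows "emb A (\<lambda>x. k (h x))"
  unfolding emb_def
proof (intro conjI ballI embD(1)[OF h])
  show "(\<lambda>x. k (h x)) ` A \<in> clop" using embD(2)[OF k] by (simp add: image_image)
  show "inj_on (\<lambda>x. k (h x)) A" using embD(3)[OF h] embD(3)[OF k] by (auto simp: inj_on_def)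
  show "cont_at (\<lambda>x. k (h x)) x" if "x \<in> A" for x
    by (rule cont_at_comp[OF embD(4)[OF h that] embD(4)[OF k]]) (use that in blast)
qed

lemma emb_inv:
  assumes h: "emb A h"
  shows "emb (h ` A) (inv_into A h)" and "inv_into A h ` h ` A = A"
proof -
  show img: "inv_into A h ` h ` A = A"
    using embD(3)[OF h] by (simp add: inv_into_image_cancel)
  show "emb (h ` A) (inv_into A h)"
  proof (rule embI)
    show "h ` A \<in> clop" "inv_into A h ` h ` A \<in> clop" using img embD[OF h] by simp_all
    show "inj_on (inv_into A h) (h ` A)" by (rule inj_on_inv_into) simp
    show "continuous_map (subtopology X (h ` A)) X (inv_into A h)"
      unfolding continuous_map_closedin
    proof (intro conjI allI impI)
      show "inv_into A h \<in> topspace (subtopology X (h ` A)) \<rightarrow> topspace X"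
        using img clop_subset[OF embD(1)[OF h]] by auto
      fix C assume C: "closedin X C"
      have "closedin X (h ` (A \<inter> C))"
        by (rule emb_closed_image[OF h]) (use C clopD(2)[OF embD(1)[OF h]] in auto)
      moreover have "{y \<in> topspace (subtopology X (h ` A)). inv_into A h y \<in> C} = h ` (A \<inter> C)"
        using embD(3)[OF h] clop_subset[OF embD(2)[OF h]] by (auto simp: inv_into_f_f)
      ultimately show "closedin (subtopology X (h ` A)) {y \<in> topspace (subtopology X (h ` A)). inv_into A h y \<in> C}"
        using closedin_subset_topspace[of X "h ` (A \<inter> C)" "h ` A"] by auto
    qed
  qed
qed

lemma Homeo_emb: "f \<in> Homeo X \<Longrightarrow> A \<in> clop \<Longrightarrow> emb A f"
  unfolding emb_def using Homeo_clop Homeo_cont_at clop_in inj_on_subset[OF Homeo_inj clop_subset]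
  by (intro conjI ballI) auto

text \<open>The involution that exchanges \<open>A\<close> with its copy \<open>h ` A\<close>. It is a homeomorphism when the copy is clopen and disjoint
from \<open>A\<close>; all homeomorphisms in the proof are made from these.\<close>

definition swap :: "'a set \<Rightarrow> ('a \<Rightarrow> 'a) \<Rightarrow> 'a \<Rightarrow> 'a" where
  "swap A h = (\<lambda>y\<in>topspace X. if y \<in> A then h y else if y \<in> h ` A then inv_into A h y else y)"

lemma swap_apply:
  assumes h: "emb A h" and dis: "A \<inter> h ` A = {}"
  shows "y \<in> A \<Longrightarrow> swap A h y = h y"
    and "y \<in> A \<Longrightarrow> swap A h (h y) = y"
    and "y \<in> topspace X \<Longrightarrow> y \<notin> A \<Longrightarrow> y \<notin> h ` A \<Longrightarrow> swap A h y = y"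
proof -
  show "y \<in> A \<Longrightarrow> swap A h y = h y" using clop_in[OF embD(1)[OF h]] by (simp add: swap_def)
  show "swap A h (h y) = y" if y: "y \<in> A"
  proof -
    have "h y \<in> h ` A" "h y \<notin> A" using y dis by auto
    then show ?thesis
      using y clop_in[OF embD(2)[OF h]] inv_into_f_f[OF embD(3)[OF h] y] by (simp add: swap_def)
  qed
qed (simp add: swap_def)

lemma swap_Homeo:
  assumes h: "emb A h" and dis: "A \<inter> h ` A = {}"
  shows "swap A h \<in> Homeo X"
proof -
  note ap = swap_apply[OF h dis]
  have inX: "A \<subseteq> topspace X" "h ` A \<subseteq> topspace X"
    using clop_subset[OF embD(1)[OF h]] clop_subset[OF embD(2)[OF h]] by auto
  have invol: "swap A h y \<in> topspace X \<and> swap A h (swap A h y) = y" if y: "y \<in> topspace X" for y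
  proof -
    consider "y \<in> A" | z where "z \<in> A" "y = h z" | "y \<notin> A" "y \<notin> h ` A" by blast
    then show ?thesis using y ap inX by cases auto
  qed
  have "bij_betw (swap A h) (topspace X) (topspace X)"
    by (rule bij_betw_byWitness[where f' = "swap A h"]) (use invol in auto)
  moreover have "cont_at (swap A h) y" if y: "y \<in> topspace X" for y
  proof -
    consider "y \<in> A" | "y \<in> h ` A" "y \<notin> A" | "y \<in> topspace X - (A \<union> h ` A)" using y by blast
    then show ?thesis
    proof cases
      case 1
      then show ?thesis
        by (intro cont_at_cong[OF embD(4)[OF h] clopD(1)[OF embD(1)[OF h]]]) (auto simp: ap)
    next
      case 2
      show ?thesis
      proof (rule cont_at_cong[OF embD(4)[OF emb_inv(1)[OF h]] clopD(1)[OF embD(2)[OF h]]])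
        fix z assume "z \<in> h ` A"
        then show "swap A h z = inv_into A h z"
          using ap(2) inv_into_f_f[OF embD(3)[OF h]] by auto
      qed (use 2 in auto)
    next
      case 3
      have "topspace X - (A \<union> h ` A) \<in> clop" using embD(1,2)[OF h] by (intro clop_Diff clop_Un clop_top)
      then show ?thesis
        using 3 by (intro cont_at_cong[OF cont_at_id clopD(1)]) (auto simp: ap(3))
    qed
  qed
  ultimately have "restrict (swap A h) (topspace X) \<in> Homeo X" by (rule Homeo_restrictI)
  then show ?thesis by (simp add: swap_def cong: restrict_cong)
qed

definition supp_in :: "'a set \<Rightarrow> ('a \<Rightarrow> 'a) set" where
  "supp_in W = {g \<in> Homeo X. \<forall>y\<in>topspace X - W. g y = y}"

lemma supp_inD: "g \<in> supp_in W \<Longrightarrow> g \<in> Homeo X" "g \<in> supp_in W \<Longrightarrow> y \<in> topspace X \<Longrightarrow> y \<notin> W \<Longrightarrow> g y = y"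
  by (auto simp: supp_in_def)

lemma supp_in_mono: "W \<subseteq> W' \<Longrightarrow> supp_in W \<subseteq> supp_in W'"
  by (auto simp: supp_in_def)

lemma supp_in_mul: "g \<in> supp_in W \<Longrightarrow> h \<in> supp_in W \<Longrightarrow> g \<star> h \<in> supp_in W"
  by (auto simp: supp_in_def)

lemma supp_in_hinv: "g \<in> supp_in W \<Longrightarrow> hinv g \<in> supp_in W"
  unfolding supp_in_def using hinv_app(1) by fastforce

lemma supp_in_image:
  assumes g: "g \<in> supp_in W" and y: "y \<in> topspace X"
  shows "g y \<in> W \<longleftrightarrow> y \<in> W"
  using supp_inD[OF g] y Homeo_inj_eq[OF supp_inD(1)[OF g], of "g y" y] Homeo_in by metis

lemma supp_in_set_image:
  assumes g: "g \<in> supp_in W" and W: "W \<subseteq> A" "A \<subseteq> topspace X"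
  shows "g ` A = A"
proof
  have m: "h ` A \<subseteq> A" if "h \<in> supp_in W" for h
    using supp_in_image[OF that] supp_inD[OF that] W by (auto simp: subset_iff) metis
  show "g ` A \<subseteq> A" by (rule m[OF g])
  have "hinv g ` A \<subseteq> A" by (rule m[OF supp_in_hinv[OF g]])
  then have "g ` (hinv g ` A) \<subseteq> g ` A" by (rule image_mono)
  then show "A \<subseteq> g ` A" using hinv_image(2)[OF supp_inD(1)[OF g] W(2)] by simp
qed

lemma supp_in_disjoint_image:
  assumes g: "g \<in> supp_in W" and W: "W \<inter> A = {}" "A \<subseteq> topspace X"
  shows "g ` A = A"
proof -
  have "g y = y" if "y \<in> A" for y
    using supp_inD(2)[OF g, of y] that W by auto
  then show ?thesis by simp
qed

lemma supp_in_conj: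
  assumes g: "g \<in> Homeo X" and h: "h \<in> supp_in W" and W: "W \<subseteq> topspace X"
  shows "g \<star> h \<star> hinv g \<in> supp_in (g ` W)"
proof -
  have hX: "h \<in> Homeo X" by (rule supp_inD(1)[OF h])
  have "(g \<star> h \<star> hinv g) y = y" if y: "y \<in> topspace X - g ` W" for y
  proof -
    have "hinv g y \<notin> W" using y g by (metis DiffD1 DiffD2 hinv_app(2) imageI)
    then have "h (hinv g y) = hinv g y" using supp_inD(2)[OF h] y g by simp
    then show ?thesis using y g hX by simp
  qed
  then show ?thesis using g hX by (simp add: supp_in_def)
qed

lemma supp_in_commute:
  assumes g: "g \<in> supp_in V" and h: "h \<in> supp_in W" and VW: "V \<inter> W = {}"
  shows "g \<star> h = h \<star> g"
proof (rule Homeo_eqI)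
  have gh: "g \<in> Homeo X" "h \<in> Homeo X" using g h supp_inD by auto
  show "g \<star> h \<in> Homeo X" "h \<star> g \<in> Homeo X" using gh by auto
  fix y assume y: "y \<in> topspace X"
  show "(g \<star> h) y = (h \<star> g) y"
  proof (cases "y \<in> V")
    case True
    then have "y \<notin> W" "g y \<notin> W" using VW supp_in_image[OF g y] by auto
    then show ?thesis using supp_inD(2)[OF h] y gh by simp
  next
    case False
    then have "h y \<notin> V"
      using VW supp_in_image[OF h y] supp_inD(2)[OF h y] by (cases "y \<in> W") auto
    then show ?thesis using supp_inD(2)[OF g] y gh False by simp
  qed
qed

lemma swap_supp:
  assumes "emb A h" "A \<inter> h ` A = {}"
  shows "swap A h \<in> supp_in (A \<union> h ` A)"
  using swap_Homeo[OF assms] swap_apply(3)[OF assms] by (auto simp: supp_in_def)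

section \<open>Stable neighbourhoods\<close>

lemma stable_nbhdD:
  assumes "stable_nbhd X x U"
  shows "U \<in> clop" "x \<in> U"
  using assms by (auto simp: stable_nbhd_def clopen_nbhd_def clop_def)

lemma stable_emb:
  assumes U: "stable_nbhd X x U" and V: "V \<in> clop" "x \<in> V" "V \<subseteq> U"
  shows "\<exists>h. emb U h \<and> h ` U = V \<and> h x = x"
proof -
  have "clopen_nbhd X x V" using V clopD by (auto simp: clopen_nbhd_def)
  then obtain h where h: "homeomorphic_map (subtopology X U) (subtopology X V) h" "h x = x"
    using U V(3) unfolding stable_nbhd_def by blast
  have UX: "U \<subseteq> topspace X" "V \<subseteq> topspace X"
    using clop_subset stable_nbhdD(1)[OF U] V(1) by auto
  have img: "h ` U = V"
    using homeomorphic_imp_surjective_map[OF h(1)] UX by (simp add: topspace_subtopology Int_absorb1)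
  have "emb U h"
  proof (rule embI)
    show "U \<in> clop" by (rule stable_nbhdD(1)[OF U])
    show "h ` U \<in> clop" using img V by simp
    show "inj_on h U"
      using homeomorphic_imp_injective_map[OF h(1)] UX by (simp add: topspace_subtopology Int_absorb1)
    show "continuous_map (subtopology X U) X h"
      using homeomorphic_imp_continuous_map[OF h(1)] continuous_map_into_fulltopology by blast
  qed
  with img h(2) show ?thesis by blast
qed

lemma emb_homeomorphic:
  assumes h: "emb A h"
  shows "homeomorphic_map (subtopology X A) (subtopology X (h ` A)) h"
proof (rule continuous_imp_homeomorphic_map)
  have AX: "A \<subseteq> topspace X" "h ` A \<subseteq> topspace X"
    using clop_subset embD(1,2)[OF h] by auto
  show "continuous_map (subtopology X A) (subtopology X (h ` A)) h"
    using emb_continuous[OF h] by (auto simp: continuous_map_in_subtopology)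
  show "compact_space (subtopology X A)"
    using closedin_compact_space[OF compact clopD(2)[OF embD(1)[OF h]]] compact_space_subtopology by blast
  show "Hausdorff_space (subtopology X (h ` A))"
    by (rule Hausdorff_space_subtopology[OF haus])
  show "h ` topspace (subtopology X A) = topspace (subtopology X (h ` A))"
    using AX by (simp add: topspace_subtopology Int_absorb1)
  show "inj_on h (topspace (subtopology X A))"
    using AX embD(3)[OF h] by (simp add: topspace_subtopology Int_absorb1)
qed

lemma stable_subset:
  assumes U: "stable_nbhd X x U" and V: "V \<in> clop" "x \<in> V" "V \<subseteq> U"
  shows "stable_nbhd X x V"
  unfolding stable_nbhd_def
proof (intro conjI allI impI)
  show "clopen_nbhd X x V" using V clopD by (auto simp: clopen_nbhd_def)
  fix W assume W: "clopen_nbhd X x W \<and> W \<subseteq> V"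
  then have Wc: "W \<in> clop" "x \<in> W" "W \<subseteq> U" using V by (auto simp: clopen_nbhd_def clop_def)
  obtain h where h: "emb U h" "h ` U = V" "h x = x" using stable_emb[OF U V] by blast
  obtain k where k: "emb U k" "k ` U = W" "k x = x" using stable_emb[OF U Wc] by blast
  let ?g = "\<lambda>y. k (inv_into U h y)"
  have i: "emb V (inv_into U h)" "inv_into U h ` V = U" using emb_inv[OF h(1)] h(2) by auto
  have "emb V ?g" by (rule emb_comp[OF i(1)]) (simp add: i(2) k(1))
  moreover have "?g ` V = W" using i(2) k(2) by (metis image_image)
  moreover have "?g x = x"
    using h(3) k(3) inv_into_f_f[OF embD(3)[OF h(1)] stable_nbhdD(2)[OF U]] by simp
  ultimately show "\<exists>h. homeomorphic_map (subtopology X V) (subtopology X W) h \<and> h x = x"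
    using emb_homeomorphic by metis
qed

lemma stable_nbhd_in:
  assumes "stable_space X" and U: "openin X U" "x \<in> U"
  shows "\<exists>V. stable_nbhd X x V \<and> V \<subseteq> U"
proof -
  have "x \<in> topspace X" using subsetD[OF openin_subset[OF U(1)] U(2)] .
  then obtain V where V: "stable_nbhd X x V" using assms(1) by (auto simp: stable_space_def)
  have "openin X (U \<inter> V)" "x \<in> U \<inter> V" using U stable_nbhdD[OF V] clopD(1) by auto
  then obtain A where A: "A \<in> clop" "x \<in> A" "A \<subseteq> U \<inter> V" using clop_basis by blast
  then show ?thesis using stable_subset[OF V A(1,2)] by blast
qed

definition isolated :: "'a set" where
  "isolated = {x \<in> topspace X. {x} \<in> clop}"

lemma openin_singleton_isolated: "openin X {x} \<Longrightarrow> x \<in> isolated"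
  using openin_subset[of X "{x}"] closedin_Hausdorff_singleton[OF haus, of x]
  by (auto simp: isolated_def clop_def)

text \<open>A stable neighbourhood \<open>V \<subseteq> U\<close> of \<open>x\<close> has an embedding \<open>h\<close> onto a smaller one. The set \<open>A\<close> that \<open>h\<close> leaves
uncovered has the disjoint copies \<open>h ` A\<close> and \<open>h ` h ` A\<close>, and the exchanges of \<open>A\<close> with \<open>h ` A\<close> and of \<open>h ` A\<close> with
\<open>h ` h ` A\<close> behave like the transpositions \<open>(1 2)\<close> and \<open>(2 3)\<close>.\<close>

lemma noncommuting_at_nonisolated:
  assumes st: "stable_space X" and x: "x \<notin> isolated" and U: "openin X U" "x \<in> U"
  shows "\<exists>a\<in>supp_in U. \<exists>b\<in>supp_in U. a \<star> b \<noteq> b \<star> a"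
proof -
  obtain V where V: "stable_nbhd X x V" "V \<subseteq> U" using stable_nbhd_in[OF st U] by blast
  note Vc = stable_nbhdD[OF V(1)]
  have "V \<noteq> {x}" using x openin_singleton_isolated clopD(1)[OF Vc(1)] by blast
  then obtain y where y: "y \<in> V" "y \<noteq> x" using Vc(2) by blast
  obtain B where B: "B \<in> clop" "x \<in> B" "y \<notin> B"
    using separate_points[of x y] y Vc clop_in[OF Vc(1)] by metis
  obtain h where h: "emb V h" "h ` V = V \<inter> B"
    using stable_emb[OF V(1), of "V \<inter> B"] B Vc by blast
  let ?A = "V - B"
  have A: "?A \<in> clop" using Vc B by blast
  have hA: "emb ?A h" using emb_sub[OF h(1) A] by blast
  have hhA: "emb (h ` ?A) h" by (rule emb_sub[OF h(1) embD(2)[OF hA]]) (use h(2) in auto)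
  have d1: "?A \<inter> h ` ?A = {}" using h(2) by auto
  have d2: "h ` ?A \<inter> h ` (h ` ?A) = {}"
  proof -
    have "h ` ?A \<inter> h ` (h ` ?A) = h ` (?A \<inter> h ` ?A)"
      by (rule inj_on_image_Int[OF embD(3)[OF h(1)], symmetric]) (use h(2) in auto)
    then show ?thesis using d1 by simp
  qed
  let ?a = "swap ?A h" and ?b = "swap (h ` ?A) h"
  have sub: "?A \<subseteq> U" "h ` ?A \<subseteq> U" "h ` h ` ?A \<subseteq> U" using h(2) V(2) by auto
  have ab: "?a \<in> supp_in U" "?b \<in> supp_in U"
    by (rule subsetD[OF supp_in_mono swap_supp[OF hA d1]], use sub in blast)
      (rule subsetD[OF supp_in_mono swap_supp[OF hhA d2]], use sub in blast)
  have yA: "y \<in> ?A" using y B by blast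
  have yX: "y \<in> topspace X" using clop_in[OF Vc(1) y(1)] .
  have "y \<notin> h ` ?A" "y \<notin> h ` h ` ?A" using h(2) yA by auto
  then have "(?a \<star> ?b) y = h y"
    using ab yX yA supp_inD(1) swap_apply(3)[OF hhA d2] swap_apply(1)[OF hA d1] by simp
  moreover have "(?b \<star> ?a) y = h (h y)"
    using ab yX yA supp_inD(1) swap_apply(1)[OF hhA d2] swap_apply(1)[OF hA d1] by simp
  moreover have "h y \<noteq> h (h y)" using d2 yA by blast
  ultimately have "?a \<star> ?b \<noteq> ?b \<star> ?a" by metis
  with ab show ?thesis by blast
qed

end

section \<open>Isolated points, centralisers and normalisers\<close>

context stone_space begin

lemma isolatedD: "p \<in> isolated \<Longrightarrow> p \<in> topspace X" "p \<in> isolated \<Longrightarrow> {p} \<in> clop"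
  by (auto simp: isolated_def)

lemma Homeo_isolated:
  assumes g: "g \<in> Homeo X"
  shows "g ` isolated = isolated"
proof -
  have *: "h ` isolated \<subseteq> isolated" if h: "h \<in> Homeo X" for h
    using Homeo_clop[OF h isolatedD(2)] Homeo_in[OF h isolatedD(1)] by (auto simp: isolated_def)
  have "hinv g ` isolated \<subseteq> isolated" by (rule *[OF hinv_closed[OF g]])
  then have "g ` (hinv g ` isolated) \<subseteq> g ` isolated" by (rule image_mono)
  moreover have "isolated \<subseteq> topspace X" using isolatedD(1) by blast
  ultimately show ?thesis
    using *[OF g] hinv_image(2)[OF g, of isolated] by simp
qed

lemma finite_isolated_clop:
  assumes "finite F" "F \<subseteq> isolated"
  shows "F \<in> clop"
proof -
  have "\<Union>((\<lambda>p. {p}) ` F) \<in> clop"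
    using assms isolatedD(2) by (intro clop_Union) auto
  then show ?thesis by simp
qed

definition flip :: "'a \<Rightarrow> 'a \<Rightarrow> 'a \<Rightarrow> 'a" where
  "flip p q = swap {p} (\<lambda>_. q)"

lemma flip:
  assumes pq: "p \<in> isolated" "q \<in> isolated" "p \<noteq> q"
  shows "flip p q \<in> supp_in {p, q}" "flip p q \<in> Homeo X" "flip p q p = q" "flip p q q = p"
    "\<And>y. y \<in> topspace X \<Longrightarrow> y \<noteq> p \<Longrightarrow> y \<noteq> q \<Longrightarrow> flip p q y = y"
proof -
  have e: "emb {p} (\<lambda>_. q)"
    unfolding emb_def using isolatedD(2)[OF pq(1)] isolatedD(2)[OF pq(2)]
    by (auto simp: cont_at_def clopD intro!: exI[of _ "{p}"])
  have d: "{p} \<inter> (\<lambda>_. q) ` {p} = {}" using pq(3) by simp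
  show 1: "flip p q \<in> supp_in {p, q}" using swap_supp[OF e d] by (simp add: flip_def insert_commute)
  then show "flip p q \<in> Homeo X" by (rule supp_inD(1))
  show "flip p q p = q" "flip p q q = p"
    using swap_apply(1,2)[OF e d, of p] by (simp_all add: flip_def)
  show "flip p q y = y" if "y \<in> topspace X" "y \<noteq> p" "y \<noteq> q" for y
    using supp_inD(2)[OF 1 that(1)] that by simp
qed

definition stab :: "'a set \<Rightarrow> ('a \<Rightarrow> 'a) set" where
  "stab A = {g \<in> Homeo X. g ` A = A}"

lemma stab_subgroup:
  assumes "A \<subseteq> topspace X"
  shows "subgroup (stab A) HG"
proof (rule H.subgroupI)
  show "stab A \<subseteq> carrier HG" by (auto simp: stab_def)
  have "hone \<in> stab A" using hone_image[OF assms] by (simp add: stab_def)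
  then show "stab A \<noteq> {}" by blast
  show "hinv g \<in> stab A" if "g \<in> stab A" for g
    using that assms hinv_image_eq[of g A A] by (simp add: stab_def)
  show "g \<star> h \<in> stab A" if "g \<in> stab A" "h \<in> stab A" for g h
    using that mul_image[of g h A] assms by (simp add: stab_def)
qed

lemma stab_compl:
  assumes A: "A \<subseteq> topspace X"
  shows "stab (topspace X - A) = stab A"
proof -
  have *: "stab B \<subseteq> stab (topspace X - B)" if "B \<subseteq> topspace X" for B
  proof
    fix g assume g: "g \<in> stab B"
    then have gX: "g \<in> Homeo X" by (simp add: stab_def)
    have "g ` (topspace X - B) = g ` topspace X - g ` B"
      by (rule inj_on_image_set_diff[OF Homeo_inj[OF gX]]) (use that in auto)
    then show "g \<in> stab (topspace X - B)" using g Homeo_surj[OF gX] by (simp add: stab_def)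
  qed
  have "topspace X - (topspace X - A) = A" using A by auto
  then show ?thesis using *[OF A] *[of "topspace X - A"] by auto
qed

definition cent :: "('a \<Rightarrow> 'a) set \<Rightarrow> ('a \<Rightarrow> 'a) set" where
  "cent F = {g \<in> Homeo X. \<forall>f\<in>F. g \<star> f = f \<star> g}"

lemma conj_conj:
  assumes "g \<in> Homeo X" "h \<in> Homeo X" "z \<in> Homeo X"
  shows "(g \<star> h) \<star> z \<star> hinv (g \<star> h) = g \<star> (h \<star> z \<star> hinv h) \<star> hinv g"
  using assms by (simp add: H.inv_mult_group H.m_assoc)

lemma conj_cancel:
  assumes "g \<in> Homeo X" "z \<in> Homeo X"
  shows "hinv g \<star> (g \<star> z \<star> hinv g) \<star> g = z" "g \<star> (hinv g \<star> z \<star> g) \<star> hinv g = z"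
  using assms H.inv_mult_cancel by (simp_all add: H.m_assoc)

lemma conj_mult:
  assumes "g \<in> Homeo X" "y \<in> Homeo X" "z \<in> Homeo X"
  shows "(g \<star> y \<star> hinv g) \<star> (g \<star> z \<star> hinv g) = g \<star> (y \<star> z) \<star> hinv g"
  using assms H.inv_mult_cancel by (simp add: H.m_assoc)

lemma cent_conj:
  assumes g: "g \<in> Homeo X" and z: "z \<in> cent (supp_in A)" and A: "A \<subseteq> topspace X"
  shows "g \<star> z \<star> hinv g \<in> cent (supp_in (g ` A))"
proof -
  have zX: "z \<in> Homeo X" using z by (simp add: cent_def)
  have "(g \<star> z \<star> hinv g) \<star> f = f \<star> (g \<star> z \<star> hinv g)" if f: "f \<in> supp_in (g ` A)" for f
  proof -
    have fX: "f \<in> Homeo X" by (rule supp_inD(1)[OF f])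
    let ?f = "hinv g \<star> f \<star> g"
    have "?f \<in> supp_in (hinv g ` (g ` A))"
      using supp_in_conj[OF hinv_closed[OF g] f Homeo_image_subset[OF g A]] g by simp
    then have f': "?f \<in> supp_in A" using hinv_image(1)[OF g A] by simp
    then have f'X: "?f \<in> Homeo X" by (rule supp_inD(1))
    have fe: "f = g \<star> ?f \<star> hinv g" using conj_cancel(2)[OF g fX] by simp
    have "(g \<star> z \<star> hinv g) \<star> (g \<star> ?f \<star> hinv g) = g \<star> (z \<star> ?f) \<star> hinv g"
      by (rule conj_mult[OF g zX f'X])
    also have "z \<star> ?f = ?f \<star> z" using z f' by (simp add: cent_def)
    also have "g \<star> (?f \<star> z) \<star> hinv g = (g \<star> ?f \<star> hinv g) \<star> (g \<star> z \<star> hinv g)"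
      by (rule conj_mult[OF g f'X zX, symmetric])
    finally show ?thesis using fe by simp
  qed
  then show ?thesis using g zX by (simp add: cent_def)
qed

text \<open>The normaliser of the centraliser of the group of homeomorphisms supported in \<open>A\<close>. It is defined by group
operations alone, which makes it closed in every Hausdorff group topology.\<close>

definition norm_cent :: "'a set \<Rightarrow> ('a \<Rightarrow> 'a) set" where
  "norm_cent A = {g \<in> Homeo X. \<forall>z\<in>cent (supp_in A).
     g \<star> z \<star> hinv g \<in> cent (supp_in A) \<and> hinv g \<star> z \<star> g \<in> cent (supp_in A)}"

lemma norm_cent_hinv: "g \<in> norm_cent A \<Longrightarrow> hinv g \<in> norm_cent A"
  by (auto simp: norm_cent_def)

lemma cent_in: "z \<in> cent F \<Longrightarrow> z \<in> Homeo X"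
  by (simp add: cent_def)

lemma norm_cent_subgroup: "subgroup (norm_cent A) HG"
proof (rule H.subgroupI)
  show "norm_cent A \<subseteq> carrier HG" by (auto simp: norm_cent_def)
  have "hone \<in> norm_cent A" using cent_in by (simp add: norm_cent_def)
  then show "norm_cent A \<noteq> {}" by blast
  show "hinv g \<in> norm_cent A" if "g \<in> norm_cent A" for g
    by (rule norm_cent_hinv[OF that])
  show "g \<star> h \<in> norm_cent A" if g: "g \<in> norm_cent A" and h: "h \<in> norm_cent A" for g h
  proof -
    have gh: "g \<in> Homeo X" "h \<in> Homeo X" using g h by (simp_all add: norm_cent_def)
    have "g \<star> h \<star> z \<star> hinv (g \<star> h) \<in> cent (supp_in A) \<and> hinv (g \<star> h) \<star> z \<star> (g \<star> h) \<in> cent (supp_in A)"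
      if z: "z \<in> cent (supp_in A)" for z
    proof
      have zX: "z \<in> Homeo X" by (rule cent_in[OF z])
      show "g \<star> h \<star> z \<star> hinv (g \<star> h) \<in> cent (supp_in A)"
        unfolding conj_conj[OF gh zX] using g h z by (simp add: norm_cent_def)
      have "hinv (g \<star> h) \<star> z \<star> (g \<star> h) = hinv h \<star> (hinv g \<star> z \<star> g) \<star> h"
        using gh zX by (simp add: H.inv_mult_group H.m_assoc)
      then show "hinv (g \<star> h) \<star> z \<star> (g \<star> h) \<in> cent (supp_in A)"
        using g h z by (simp add: norm_cent_def)
    qed
    then show ?thesis using gh by (simp add: norm_cent_def)
  qed
qed

lemma stab_subset_norm_cent:
  assumes A: "A \<subseteq> topspace X"
  shows "stab A \<subseteq> norm_cent A"
proof
  fix g assume g: "g \<in> stab A"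
  then have gX: "g \<in> Homeo X" "g ` A = A" by (auto simp: stab_def)
  have h: "hinv g ` A = A" using hinv_image_eq[OF gX(1) A A] gX(2) by simp
  show "g \<in> norm_cent A"
    unfolding norm_cent_def
    using cent_conj[OF gX(1) _ A] cent_conj[OF hinv_closed[OF gX(1)] _ A] gX h by simp
qed

text \<open>Such an \<open>h\<close> centralises the group supported in \<open>g ` A\<close>. The centraliser of that group is the conjugate by \<open>g\<close> of the
centraliser of the group supported in \<open>A\<close>, and \<open>g\<close> normalises the latter, so the two centralisers agree.\<close>

lemma norm_cent_commute:
  assumes g: "g \<in> norm_cent A" and A: "A \<subseteq> topspace X"
    and h: "h \<in> supp_in (topspace X - g ` A)" and k: "k \<in> supp_in A"
  shows "h \<star> k = k \<star> h"
proof -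
  have gX: "g \<in> Homeo X" using g by (simp add: norm_cent_def)
  have hX: "h \<in> Homeo X" by (rule supp_inD(1)[OF h])
  have "h \<star> f = f \<star> h" if "f \<in> supp_in (g ` A)" for f
    by (rule supp_in_commute[OF h that]) auto
  then have hZ: "h \<in> cent (supp_in (g ` A))" using hX by (simp add: cent_def)
  have "hinv g \<star> h \<star> hinv (hinv g) \<in> cent (supp_in (hinv g ` (g ` A)))"
    by (rule cent_conj[OF hinv_closed[OF gX] hZ Homeo_image_subset[OF gX A]])
  then have "hinv g \<star> h \<star> g \<in> cent (supp_in A)"
    using gX hinv_image(1)[OF gX A] by simp
  then have "g \<star> (hinv g \<star> h \<star> g) \<star> hinv g \<in> cent (supp_in A)"
    using g by (simp add: norm_cent_def)
  then have "h \<in> cent (supp_in A)" using conj_cancel(2)[OF gX hX] by simp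
  then show ?thesis using k by (simp add: cent_def)
qed

text \<open>Otherwise the open set \<open>A - g ` A\<close> carries two homeomorphisms that do not commute; one of them is supported
off \<open>g ` A\<close> and the other in \<open>A\<close>.\<close>

lemma norm_cent_diff_isolated:
  assumes st: "stable_space X" and g: "g \<in> norm_cent A" and A: "A \<in> clop" and x: "x \<in> A - g ` A"
  shows "x \<in> isolated"
proof (rule ccontr)
  assume ni: "x \<notin> isolated"
  have gX: "g \<in> Homeo X" using g by (simp add: norm_cent_def)
  have "A - g ` A \<in> clop" using A Homeo_clop[OF gX A] by blast
  then obtain a b where ab: "a \<in> supp_in (A - g ` A)" "b \<in> supp_in (A - g ` A)" "a \<star> b \<noteq> b \<star> a"
    using noncommuting_at_nonisolated[OF st ni clopD(1) x] by blast
  have "a \<in> supp_in (topspace X - g ` A)" "b \<in> supp_in A"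
    by (rule subsetD[OF supp_in_mono ab(1)], use clop_subset[OF A] in blast)
      (rule subsetD[OF supp_in_mono ab(2)], blast)
  then show False using norm_cent_commute[OF g clop_subset[OF A]] ab(3) by blast
qed

text \<open>The transpositions of \<open>x, y\<close> and of \<open>x, z\<close> do not commute, but the first is supported off \<open>g ` A\<close> and the second
in \<open>A\<close>.\<close>

lemma norm_cent_diff_few:
  assumes g: "g \<in> norm_cent A" and A: "A \<in> clop" and x: "x \<in> A - g ` A" "x \<in> isolated"
    and y: "y \<in> isolated" "y \<notin> g ` A" "y \<noteq> x" and z: "z \<in> isolated" "z \<in> A" "z \<noteq> x" "z \<noteq> y"
  shows False
proof -
  have xX: "x \<in> topspace X" "y \<in> topspace X" "z \<in> topspace X" using x y z isolatedD(1) by auto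
  note tz = flip[OF x(2) z(1) z(3)[symmetric]] and ty = flip[OF x(2) y(1) y(3)[symmetric]]
  have "flip x y \<in> supp_in (topspace X - g ` A)"
    using ty(1) supp_in_mono[of "{x, y}" "topspace X - g ` A"] x(1) y(2) xX by blast
  moreover have "flip x z \<in> supp_in A"
    using tz(1) supp_in_mono[of "{x, z}" A] x(1) z(2) by blast
  ultimately have "flip x y \<star> flip x z = flip x z \<star> flip x y"
    by (rule norm_cent_commute[OF g clop_subset[OF A]])
  moreover have "(flip x y \<star> flip x z) x = z"
    using xX ty tz z by simp
  moreover have "(flip x z \<star> flip x y) x = y"
    using xX ty tz z y by simp
  ultimately show False using z(4) by simp
qed

end

section \<open>Open stabilisers in an arbitrary Polish group topology\<close>

text \<open>An arbitrary Polish group topology \<open>T\<close>, which is to be identified with \<open>htop\<close>.\<close>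

locale polish_homeo = stone_space X for X :: "'a topology" +
  fixes T
  assumes st: "stable_space X" and pol: "Polish_group_topology (HomeoGroup X) T"
begin

sublocale PT: topgroup "HomeoGroup X" T
  using pol by unfold_locales (simp add: Polish_group_topology_def)

lemma topspace_T [simp]: "topspace T = Homeo X"
  using PT.space by simp

lemma cmT: "completely_metrizable_space T" and sepT: "separable_space T"
  using pol by (auto simp: Polish_group_topology_def)

lemma hausT: "Hausdorff_space T"
  using cmT completely_metrizable_imp_metrizable_space metrizable_imp_Hausdorff_space by blast

text \<open>The coset of \<open>g\<close> modulo \<open>stab A \<inter> stab B\<close> is determined by the images of \<open>A\<close> and \<open>B\<close>, so the index is countable.\<close>

lemma open_of_stab_subset:
  assumes S: "subgroup S HG" "closedin T S" and A: "A \<in> clop" "B \<in> clop" "stab A \<inter> stab B \<subseteq> S"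
  shows "openin T S"
proof (rule PT.closed_subgroup_countable_index_open[OF cmT S, of "clop \<times> clop" "\<lambda>g. (g ` A, g ` B)"])
  show "countable (clop \<times> clop)" using countable_clop by simp
  show "(\<lambda>g. (g ` A, g ` B)) ` carrier HG \<subseteq> clop \<times> clop" using Homeo_clop A by auto
  fix g h assume "g \<in> carrier HG" "h \<in> carrier HG" and eq: "(g ` A, g ` B) = (h ` A, h ` B)"
  then have gh: "g \<in> Homeo X" "h \<in> Homeo X" by simp_all
  have "(hinv g \<star> h) ` A = A" "(hinv g \<star> h) ` B = B"
    using eq mul_image[OF hinv_closed[OF gh(1)] gh(2) clop_subset] hinv_image(1)[OF gh(1) clop_subset] A
    by (metis prod.inject)+
  then have "hinv g \<star> h \<in> stab A \<inter> stab B" using gh by (simp add: stab_def)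
  then show "hinv g \<star> h \<in> S" using A(3) by blast
qed

lemma closed_commuting:
  assumes f: "f \<in> Homeo X"
  shows "closedin T {g \<in> Homeo X. g \<star> f = f \<star> g}"
proof -
  have "closedin T {g \<in> topspace T. g \<star> f = f \<star> g}"
    by (rule closedin_continuous_maps_eq[OF hausT])
      (intro PT.cont_mult PT.cont_const PT.cont_id; use f in simp)+
  then show ?thesis by simp
qed

lemma closed_cent:
  assumes F: "F \<subseteq> Homeo X"
  shows "closedin T (cent F)"
proof -
  have "closedin T (topspace T \<inter> \<Inter>((\<lambda>f. {g \<in> Homeo X. g \<star> f = f \<star> g}) ` F))"
  proof (cases "F = {}")
    case False
    then have "closedin T (\<Inter>((\<lambda>f. {g \<in> Homeo X. g \<star> f = f \<star> g}) ` F))"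
      using F closed_commuting by (intro closedin_Inter) auto
    then show ?thesis by (intro closedin_Int closedin_topspace)
  next
    case True
    then show ?thesis by (simp only: image_empty Inter_empty Int_UNIV_right closedin_topspace)
  qed
  moreover have "topspace T \<inter> \<Inter>((\<lambda>f. {g \<in> Homeo X. g \<star> f = f \<star> g}) ` F) = cent F"
    by (auto simp: cent_def)
  ultimately show ?thesis by simp
qed

lemma closed_norm_cent: "closedin T (norm_cent A)"
proof -
  let ?Z = "cent (supp_in A)"
  let ?K = "\<lambda>z. {g \<in> topspace T. g \<star> z \<star> hinv g \<in> ?Z} \<inter> {g \<in> topspace T. hinv g \<star> z \<star> g \<in> ?Z}"
  have Z: "closedin T ?Z" by (rule closed_cent) (use supp_inD(1) in blast)
  have K: "closedin T (?K z)" if z: "z \<in> ?Z" for z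
  proof -
    have zG: "z \<in> carrier HG" using cent_in[OF z] by simp
    have "continuous_map T T (\<lambda>g. g \<star> z \<star> hinv g)" "continuous_map T T (\<lambda>g. hinv g \<star> z \<star> g)"
      by (intro PT.cont_mult PT.cont_inv PT.cont_const[OF zG] PT.cont_id)+
    then show ?thesis
      by (intro closedin_Int closedin_continuous_map_preimage[OF _ Z])
  qed
  have "hone \<in> ?Z" using supp_inD(1) by (auto simp: cent_def)
  then have "closedin T (\<Inter>(?K ` ?Z))"
    using K by (intro closedin_Inter) auto
  moreover have "\<Inter>(?K ` ?Z) = norm_cent A"
    using \<open>hone \<in> ?Z\<close> by (auto simp: norm_cent_def)
  ultimately show ?thesis by simp
qed

lemma open_norm_cent: "A \<in> clop \<Longrightarrow> openin T (norm_cent A)"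
  using open_of_stab_subset[OF norm_cent_subgroup closed_norm_cent, of A A]
    stab_subset_norm_cent[OF clop_subset] by blast

text \<open>One inclusion suffices because \<open>norm_cent A\<close> is closed under inverses.\<close>

lemma stab_openI:
  assumes A: "A \<in> clop" and sub: "\<And>g. g \<in> norm_cent A \<Longrightarrow> A \<subseteq> g ` A"
  shows "openin T (stab A)"
proof -
  have "norm_cent A \<subseteq> stab A"
  proof
    fix g assume g: "g \<in> norm_cent A"
    have gX: "g \<in> Homeo X" using g by (simp add: norm_cent_def)
    have "g ` A \<subseteq> g ` (hinv g ` A)" by (rule image_mono[OF sub[OF norm_cent_hinv[OF g]]])
    then show "g \<in> stab A"
      using sub[OF g] gX hinv_image(2)[OF gX clop_subset[OF A]] by (simp add: stab_def)
  qed
  then have "stab A = norm_cent A" using stab_subset_norm_cent[OF clop_subset[OF A]] by simp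
  then show ?thesis using open_norm_cent[OF A] by simp
qed

lemma stab_open_perfect:
  assumes A: "A \<in> clop" "A \<inter> isolated = {}"
  shows "openin T (stab A)"
  by (rule stab_openI[OF A(1)]) (use norm_cent_diff_isolated[OF st _ A(1)] A(2) in blast)

text \<open>A point of \<open>A - g ` A\<close> would be isolated. As \<open>g\<close> permutes the isolated points, infinitely many of them are off
\<open>g ` A\<close> and infinitely many are in \<open>A\<close>, so that \<open>norm_cent_diff_few\<close> applies.\<close>

lemma stab_open_infinite:
  assumes A: "A \<in> clop" and inf: "infinite (A \<inter> isolated)" "infinite (isolated - A)"
  shows "openin T (stab A)"
proof (rule stab_openI[OF A], rule subsetI, rule ccontr)
  fix g x assume g: "g \<in> norm_cent A" and "x \<in> A" "x \<notin> g ` A"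
  then have x: "x \<in> A - g ` A" by blast
  have gX: "g \<in> Homeo X" using g by (simp add: norm_cent_def)
  have xi: "x \<in> isolated" by (rule norm_cent_diff_isolated[OF st g A x])
  have iX: "isolated \<subseteq> topspace X" using isolatedD(1) by blast
  have "g ` (isolated - A) = g ` isolated - g ` A"
    by (rule inj_on_image_set_diff[OF Homeo_inj[OF gX]]) (use iX clop_subset[OF A] in auto)
  moreover have "infinite (g ` (isolated - A))"
    using inf(2) finite_imageD inj_on_subset[OF Homeo_inj[OF gX], of "isolated - A"] iX by blast
  ultimately have "infinite (isolated - g ` A)" using Homeo_isolated[OF gX] by simp
  then have "infinite (isolated - g ` A - {x})" by simp
  then obtain y where y: "y \<in> isolated - g ` A - {x}" using infinite_imp_nonempty by blast
  have "infinite (A \<inter> isolated - {x, y})" using inf(1) by simp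
  then obtain z where z: "z \<in> A \<inter> isolated - {x, y}" using infinite_imp_nonempty by blast
  show False by (rule norm_cent_diff_few[OF g A x xi, of y z]) (use y z in auto)
qed

text \<open>A homeomorphism that commutes with the transposition of \<open>p\<close> and \<open>q\<close> preserves its set of moved points \<open>{p, q}\<close>.\<close>

lemma open_cent_flip:
  assumes pq: "p \<in> isolated" "q \<in> isolated" "p \<noteq> q"
  shows "openin T (cent {flip p q})" and "\<And>g. g \<in> cent {flip p q} \<Longrightarrow> g p \<in> {p, q}"
    and "subgroup (cent {flip p q}) HG"
proof -
  note t = flip[OF pq]
  have pX: "p \<in> topspace X" "q \<in> topspace X" using pq isolatedD(1) by auto
  show sg: "subgroup (cent {flip p q}) HG"
  proof (rule H.subgroupI)
    show "cent {flip p q} \<subseteq> carrier HG" using cent_in by auto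
    show "cent {flip p q} \<noteq> {}" using t(2) by (auto simp: cent_def intro!: exI[of _ hone])
    show "hinv g \<in> cent {flip p q}" if "g \<in> cent {flip p q}" for g
    proof -
      have g: "g \<in> Homeo X" "g \<star> flip p q = flip p q \<star> g" using that by (auto simp: cent_def)
      have "hinv g \<star> (g \<star> flip p q) \<star> hinv g = hinv g \<star> (flip p q \<star> g) \<star> hinv g" using g(2) by simp
      then have "flip p q \<star> hinv g = hinv g \<star> flip p q"
        using g(1) t(2) H.inv_mult_cancel by (simp add: H.m_assoc)
      then show ?thesis using g(1) by (simp add: cent_def)
    qed
    show "g \<star> h \<in> cent {flip p q}" if "g \<in> cent {flip p q}" "h \<in> cent {flip p q}" for g h
    proof -
      have g: "g \<in> Homeo X" "g \<star> flip p q = flip p q \<star> g"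
        and h: "h \<in> Homeo X" "h \<star> flip p q = flip p q \<star> h" using that by (auto simp: cent_def)
      have "g \<star> h \<star> flip p q = g \<star> flip p q \<star> h" using g(1) h t(2) by (simp add: H.m_assoc)
      also have "\<dots> = flip p q \<star> (g \<star> h)" using g h(1) t(2) by (simp add: H.m_assoc)
      finally show ?thesis using g h by (simp add: cent_def)
    qed
  qed
  show "openin T (cent {flip p q})"
  proof (rule open_of_stab_subset[OF sg closed_cent isolatedD(2)[OF pq(1)] isolatedD(2)[OF pq(2)]])
    show "{flip p q} \<subseteq> Homeo X" using t(2) by simp
    show "stab {p} \<inter> stab {q} \<subseteq> cent {flip p q}"
    proof
      fix g assume "g \<in> stab {p} \<inter> stab {q}"
      then have g: "g \<in> Homeo X" "g p = p" "g q = q" by (auto simp: stab_def)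
      have "g \<star> flip p q = flip p q \<star> g"
      proof (rule Homeo_eqI)
        fix y assume y: "y \<in> topspace X"
        have "g y \<noteq> p" "g y \<noteq> q" if "y \<noteq> p" "y \<noteq> q"
          using that g y pX Homeo_inj_eq[OF g(1)] by metis+
        then show "(g \<star> flip p q) y = (flip p q \<star> g) y"
          using y g t pX by (cases "y = p"; cases "y = q") simp_all
      qed (use g t in simp_all)
      then show "g \<in> cent {flip p q}" using g by (simp add: cent_def)
    qed
  qed
  show "g p \<in> {p, q}" if "g \<in> cent {flip p q}" for g
  proof (rule ccontr)
    assume np: "g p \<notin> {p, q}"
    have g: "g \<in> Homeo X" "g \<star> flip p q = flip p q \<star> g" using that by (auto simp: cent_def)
    have "(g \<star> flip p q) p = g q" using g(1) t pX by simp
    moreover have "(flip p q \<star> g) p = g p" using g(1) t pX np by simp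
    ultimately have "g q = g p" using g(2) by metis
    then show False using Homeo_inj_eq[OF g(1)] pX pq(3) by metis
  qed
qed

text \<open>With a third isolated point \<open>r\<close>, commuting with the transpositions of \<open>p, q\<close> and of \<open>p, r\<close> forces \<open>p\<close> into
\<open>{p, q} \<inter> {p, r}\<close>. For exactly two isolated points the argument breaks down, since their transposition is central.\<close>

lemma stab_point_open:
  assumes p: "p \<in> isolated" and no2: "\<And>q. q \<noteq> p \<Longrightarrow> isolated \<noteq> {p, q}"
  shows "openin T (stab {p})"
proof -
  have pX: "p \<in> topspace X" using p isolatedD(1) by blast
  have sg: "subgroup (stab {p}) HG" by (rule stab_subgroup) (use pX in simp)
  show ?thesis
  proof (cases "isolated = {p}")
    case True
    have "stab {p} = topspace T" using Homeo_isolated True by (auto simp: stab_def)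
    then show ?thesis by (metis openin_topspace)
  next
    case False
    then obtain q where q: "q \<in> isolated" "q \<noteq> p" using p by blast
    then obtain r where r: "r \<in> isolated" "r \<noteq> p" "r \<noteq> q" using no2[OF q(2)] p by blast
    let ?U = "cent {flip p q} \<inter> cent {flip p r}"
    note cq = open_cent_flip[OF p q(1) q(2)[symmetric]] and cr = open_cent_flip[OF p r(1) r(2)[symmetric]]
    have "openin T ?U" using cq(1) cr(1) by blast
    moreover have "hone \<in> ?U" using subgroup.one_closed[OF cq(3)] subgroup.one_closed[OF cr(3)] by blast
    moreover have "?U \<subseteq> stab {p}"
    proof
      fix g assume g: "g \<in> ?U"
      then have "g p \<in> {p, q}" "g p \<in> {p, r}" using cq(2) cr(2) by blast+
      then have "g p = p" using r by auto
      then show "g \<in> stab {p}" using g by (simp add: stab_def cent_def)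
    qed
    ultimately show ?thesis by (rule PT.open_of_nbhd[OF sg])
  qed
qed

text \<open>If \<open>A\<close> contains only finitely many isolated points, these are split off one by one and the rest has none. The
complement of \<open>A\<close> has the same stabiliser, which settles the case where only finitely many isolated points lie
outside \<open>A\<close>.\<close>

lemma stab_open:
  assumes pts: "\<And>p. p \<in> isolated \<Longrightarrow> openin T (stab {p})" and A: "A \<in> clop"
  shows "openin T (stab A)"
proof -
  have fin: "openin T (stab A)" if A: "A \<in> clop" and fi: "finite (A \<inter> isolated)" for A
  proof -
    let ?I = "A \<inter> isolated"
    have Ic: "?I \<in> clop" by (rule finite_isolated_clop[OF fi]) blast
    have B: "A - ?I \<in> clop" using A Ic by blast
    have ob: "openin T (stab (A - ?I))" by (rule stab_open_perfect[OF B]) auto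
    let ?U = "stab (A - ?I) \<inter> \<Inter>((\<lambda>p. stab {p}) ` ?I)"
    have "openin T ?U"
    proof (cases "?I = {}")
      case False
      then have "openin T (\<Inter>((\<lambda>p. stab {p}) ` ?I))" using fi pts by (intro openin_Inter) auto
      then show ?thesis using ob by blast
    qed (use ob in simp)
    moreover have "hone \<in> ?U"
    proof -
      have "hone \<in> stab {p}" if "p \<in> ?I" for p
        using that isolatedD(1) by (simp add: stab_def)
      moreover have "hone \<in> stab (A - ?I)"
        using hone_image[OF clop_subset[OF B]] by (simp add: stab_def)
      ultimately show ?thesis by blast
    qed
    moreover have "?U \<subseteq> stab A"
    proof
      fix g assume g: "g \<in> ?U"
      then have gX: "g \<in> Homeo X" and gB: "g ` (A - ?I) = A - ?I" by (auto simp: stab_def)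
      have "g p = p" if "p \<in> ?I" for p using g that by (auto simp: stab_def)
      then have "g ` ?I = ?I" by simp
      then have "g ` ((A - ?I) \<union> ?I) = (A - ?I) \<union> ?I" using gB by (simp only: image_Un)
      moreover have "(A - ?I) \<union> ?I = A" by auto
      ultimately show "g \<in> stab A" using gX by (simp add: stab_def)
    qed
    ultimately show ?thesis by (rule PT.open_of_nbhd[OF stab_subgroup[OF clop_subset[OF A]]])
  qed
  consider "finite (A \<inter> isolated)" | "finite (isolated - A)" | "infinite (A \<inter> isolated)" "infinite (isolated - A)" by blast
  then show ?thesis
  proof cases
    case 1 then show ?thesis by (rule fin[OF A])
  next
    case 2
    have "(topspace X - A) \<inter> isolated = isolated - A" using isolatedD(1) by blast
    then have "openin T (stab (topspace X - A))" using fin[OF clop_Diff[OF clop_top A]] 2 by simp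
    then show ?thesis using stab_compl[OF clop_subset[OF A]] by simp
  next
    case 3 then show ?thesis by (rule stab_open_infinite[OF A])
  qed
qed

lemma open_transporter_T:
  assumes A: "A \<in> clop" and op: "openin T (stab A)"
  shows "openin T {g \<in> Homeo X. g ` A = B}"
proof (subst openin_subopen, intro ballI)
  fix g assume "g \<in> {g \<in> Homeo X. g ` A = B}"
  then have g: "g \<in> Homeo X" "g ` A = B" by auto
  let ?U = "(\<lambda>x. g \<star> x) ` stab A"
  have "openin T ?U" by (rule PT.open_lmult[OF _ op]) (use g in simp)
  moreover have "g \<in> ?U"
    using g hone_image[OF clop_subset[OF A]] by (intro image_eqI[of _ _ hone]) (auto simp: stab_def)
  moreover have "?U \<subseteq> {g \<in> Homeo X. g ` A = B}"
  proof (rule image_subsetI)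
    fix h assume "h \<in> stab A"
    then have h: "h \<in> Homeo X" "h ` A = A" by (auto simp: stab_def)
    show "g \<star> h \<in> {g \<in> Homeo X. g ` A = B}"
      using g h mul_image[OF g(1) h(1) clop_subset[OF A]] by simp
  qed
  ultimately show "\<exists>U. openin T U \<and> g \<in> U \<and> U \<subseteq> {g \<in> Homeo X. g ` A = B}" by blast
qed

theorem eq_htop:
  assumes op: "\<And>A. A \<in> clop \<Longrightarrow> openin T (stab A)"
  shows "T = htop"
proof -
  have cont: "continuous_map T htop (\<lambda>g. g)"
    by (rule continuous_map_into_htop) (use open_transporter_T op in auto)
  interpret PH: topgroup HG htop
    by unfold_locales (rule topological_group_htop)
  interpret P: polish_hom HG HG T htop "\<lambda>g. g"
  proof unfold_locales
    show "(\<lambda>g. g) \<in> hom HG HG" by (simp add: hom_def)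
    show "openin htop ((\<lambda>g. g) ` carrier HG)" using openin_topspace[of htop] by simp
  qed (use cont sepT cmT completely_metrizable_htop in auto)
  show ?thesis
    unfolding topology_eq
  proof (intro allI iffI)
    fix W assume W: "openin htop W"
    have "openin T {g \<in> topspace T. g \<in> W}" by (rule openin_continuous_map_preimage[OF cont W])
    moreover have "{g \<in> topspace T. g \<in> W} = W" using openin_subset[OF W] by auto
    ultimately show "openin T W" by simp
  next
    fix W assume W: "openin T W"
    show "openin htop W"
    proof (subst openin_subopen, intro ballI)
      fix w assume w: "w \<in> W"
      have WX: "W \<subseteq> Homeo X" using openin_subset[OF W] by simp
      have wX: "w \<in> Homeo X" using w WX by blast
      let ?V = "(\<lambda>x. hinv w \<star> x) ` W"
      have "openin T ?V" by (rule PT.open_lmult[OF _ W]) (use wX in simp)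
      moreover have "hone \<in> ?V" using w wX H.l_inv[of w] by (intro image_eqI[of _ _ w]) auto
      ultimately obtain N where N: "openin htop N" "hone \<in> N" "N \<subseteq> ?V"
        using P.open_at_one[of ?V] by auto
      let ?M = "(\<lambda>x. w \<star> x) ` N"
      have "openin htop ?M" by (rule PH.open_lmult[OF _ N(1)]) (use wX in simp)
      moreover have "w \<in> ?M" using N(2) wX H.r_one[of w] by (intro image_eqI[of _ _ hone]) auto
      moreover have "?M \<subseteq> W"
      proof
        fix m assume "m \<in> ?M"
        then obtain x where x: "x \<in> W" "m = w \<star> (hinv w \<star> x)" using N(3) by blast
        then show "m \<in> W" using H.inv_mult_cancel(2)[of w x] wX WX by auto
      qed
      ultimately show "\<exists>M. openin htop M \<and> w \<in> M \<and> M \<subseteq> W" by blast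
    qed
  qed
qed

end

section \<open>Gluing infinitely many pieces that converge to a point\<close>

context stone_space begin

text \<open>The only delicate point is \<open>x\<close>. Given a clopen neighbourhood \<open>V\<close> of \<open>x\<close>, only finitely many pieces leave \<open>V\<close>, and by
the last hypothesis only finitely many pieces are mapped so as to meet one of those. Removing the
latter pieces from \<open>V\<close> leaves a neighbourhood of \<open>x\<close> that is mapped into \<open>V\<close>.\<close>

lemma converging_homeo:
  fixes I :: "'i set" and B :: "'i \<Rightarrow> 'a set"
  defines "M \<equiv> \<Union>(B ` I)"
  assumes x: "x \<in> topspace X"
    and B: "\<And>i. i \<in> I \<Longrightarrow> B i \<in> clop" "\<And>i. i \<in> I \<Longrightarrow> x \<notin> B i"
    and conv: "\<And>V. V \<in> clop \<Longrightarrow> x \<in> V \<Longrightarrow> finite {i \<in> I. \<not> B i \<subseteq> V}"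
    and bij: "bij_betw F M M" and cont: "\<And>y. y \<in> M \<Longrightarrow> cont_at F y"
    and fin: "\<And>i. i \<in> I \<Longrightarrow> finite {j \<in> I. F ` B j \<inter> B i \<noteq> {}}"
  shows "restrict (\<lambda>y. if y \<in> M then F y else y) (topspace X) \<in> Homeo X"
proof (rule Homeo_restrictI)
  let ?F = "\<lambda>y. if y \<in> M then F y else y"
  have MX: "M \<subseteq> topspace X" using clop_subset[OF B(1)] by (auto simp: M_def)
  have FM: "F y \<in> M" if "y \<in> M" for y using bij that by (auto simp: bij_betw_def)
  have "bij_betw ?F M M" using bij by (simp cong: bij_betw_cong)
  moreover have "bij_betw ?F (topspace X - M) (topspace X - M)"
    by (rule bij_betw_cong[THEN iffD2, OF _ bij_betw_id]) simp
  ultimately have "bij_betw ?F (M \<union> (topspace X - M)) (M \<union> (topspace X - M))"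
    by (rule bij_betw_combine) auto
  moreover have "M \<union> (topspace X - M) = topspace X" using MX by auto
  ultimately show "bij_betw ?F (topspace X) (topspace X)" by simp
  fix y assume y: "y \<in> topspace X"
  show "cont_at ?F y"
  proof (cases "y \<in> M")
    case True
    then obtain i where i: "i \<in> I" "y \<in> B i" by (auto simp: M_def)
    show ?thesis
    proof (rule cont_at_cong[OF cont[OF True] clopD(1)[OF B(1)[OF i(1)]] i(2)])
      show "?F z = F z" if "z \<in> B i" for z using that i by (auto simp: M_def)
    qed
  next
    case yM: False
    show ?thesis
    proof (cases "y = x")
      case False
      obtain V where V: "V \<in> clop" "x \<in> V" "y \<notin> V"
        using separate_points[OF x y] False by blast
        let ?J = "{i \<in> I. \<not> B i \<subseteq> V}"
        let ?N = "topspace X - V - \<Union>(B ` ?J)"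
        have "\<Union>(B ` ?J) \<in> clop" by (intro clop_Union) (use conv[OF V(1,2)] B(1) in auto)
        then have N: "?N \<in> clop" using V(1) clop_top by blast
        have yN: "y \<in> ?N" using y yM V(3) by (auto simp: M_def)
        show ?thesis
        proof (rule cont_at_cong[OF cont_at_id clopD(1)[OF N] yN])
          fix z assume z: "z \<in> ?N"
          have "z \<notin> M"
          proof
            assume "z \<in> M"
            then obtain i where i: "i \<in> I" "z \<in> B i" by (auto simp: M_def)
            then show False using z by (cases "B i \<subseteq> V") auto
          qed
          then show "?F z = z" by simp
        qed
    next
      case yx: True
      show ?thesis
        unfolding cont_at_def
      proof (intro allI impI)
        fix W assume W: "openin X W \<and> ?F y \<in> W"
        then have "x \<in> W" using yM yx by simp
        then obtain V where V: "V \<in> clop" "x \<in> V" "V \<subseteq> W" using clop_basis[OF conjunct1[OF W]] by blast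
        let ?J = "{i \<in> I. \<not> B i \<subseteq> V}"
        let ?K = "\<Union>i\<in>?J. {j \<in> I. F ` B j \<inter> B i \<noteq> {}}"
        have finK: "finite ?K" using conv[OF V(1,2)] fin by auto
        let ?N = "V - \<Union>(B ` ?K)"
        have "\<Union>(B ` ?K) \<in> clop" by (intro clop_Union finite_imageI finK) (use B(1) in auto)
        then have N: "?N \<in> clop" using V(1) by blast
        have xN: "x \<in> ?N" using V(2) B(2) by auto
        have "?F ` ?N \<subseteq> W"
        proof (rule image_subsetI)
          fix z assume z: "z \<in> ?N"
          show "?F z \<in> W"
          proof (cases "z \<in> M")
            case True
            then obtain j where j: "j \<in> I" "z \<in> B j" by (auto simp: M_def)
            obtain i where i: "i \<in> I" "F z \<in> B i" using FM[OF True] by (auto simp: M_def)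
            have "B i \<subseteq> V"
            proof (rule ccontr)
              assume "\<not> B i \<subseteq> V"
              then have "j \<in> ?K" using i j by auto
              then show False using z j by auto
            qed
            then show ?thesis using True i V(3) by auto
          qed (use z V in auto)
        qed
        then show "\<exists>N. openin X N \<and> y \<in> N \<and> ?F ` N \<subseteq> W"
          using clopD(1)[OF N] xN yx by blast
      qed
    qed
  qed
qed

lemma swap_involution:
  assumes h: "emb A h" and d: "A \<inter> h ` A = {}" and y: "y \<in> topspace X"
  shows "swap A h (swap A h y) = y"
proof -
  consider "y \<in> A" | z where "z \<in> A" "y = h z" | "y \<notin> A" "y \<notin> h ` A" by blast
  then show ?thesis using y swap_apply[OF h d] by cases auto
qed

end

section \<open>The swindle at a stable point\<close>

text \<open>The sets \<open>V n\<close> shrink to \<open>x\<close>, and the annuli \<open>R n = V n - V (Suc n)\<close> partition \<open>U - {x}\<close>. The embeddings \<open>\<kappa> n\<close> are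
what remains of stability: everything outside \<open>V n\<close>, in particular every earlier annulus, has a
copy inside the annulus \<open>R n\<close>.\<close>

locale annuli = stone_space X for X :: "'a topology" +
  fixes x :: 'a and U :: "'a set" and V :: "nat \<Rightarrow> 'a set" and \<kappa> :: "nat \<Rightarrow> 'a \<Rightarrow> 'a"
  assumes V0: "V 0 = U" and Vclop: "\<And>n. V n \<in> clop" and xV: "\<And>n. x \<in> V n"
    and Vdec: "\<And>n. V (Suc n) \<subseteq> V n"
    and Vconv: "\<And>W. W \<in> clop \<Longrightarrow> x \<in> W \<Longrightarrow> \<exists>n. V n \<subseteq> W"
    and \<kappa>: "\<And>n. emb (U - V n) (\<kappa> n)" "\<And>n. \<kappa> n ` (U - V n) \<subseteq> V n - V (Suc n)"
begin

definition R :: "nat \<Rightarrow> 'a set" where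
  "R n = V n - V (Suc n)"

lemma Vanti: "m \<le> n \<Longrightarrow> V n \<subseteq> V m"
  using decseqD[OF decseq_SucI[of V, OF Vdec]] .

lemma xX: "x \<in> topspace X"
  by (rule clop_in[OF Vclop xV])

lemma VU: "V n \<subseteq> U"
  using Vanti[of 0 n] V0 by simp

lemma UX: "U \<subseteq> topspace X"
  using clop_subset[OF Vclop[of 0]] V0 by simp

lemma Rclop: "R n \<in> clop"
  unfolding R_def using Vclop by blast

lemma xR: "x \<notin> R n"
  using xV by (simp add: R_def)

lemma R_in_V: "m \<le> n \<Longrightarrow> R n \<subseteq> V m"
  using Vanti[of m n] by (auto simp: R_def)

lemma R_notin_V: "n < m \<Longrightarrow> R n \<inter> V m = {}"
  using Vanti[of "Suc n" m] by (auto simp: R_def)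

lemma R_unique:
  assumes "y \<in> R m" "y \<in> R n"
  shows "m = n"
proof (rule ccontr)
  assume "m \<noteq> n"
  then consider "m < n" | "n < m" by linarith
  then show False
    using assms R_notin_V[of m n] R_notin_V[of n m] R_in_V[of n n] R_in_V[of m m] by cases auto
qed

lemma R_cover:
  assumes y: "y \<in> U" "y \<noteq> x"
  shows "\<exists>n. y \<in> R n"
proof -
  have yX: "y \<in> topspace X" using y UX by blast
  obtain A where A: "A \<in> clop" "x \<in> A" "y \<notin> A" using separate_points[OF xX yX] y by blast
  obtain n where "V n \<subseteq> A" using Vconv[OF A(1,2)] by blast
  then have ex: "\<exists>n. y \<notin> V n" using A by blast
  define k where "k = (LEAST n. y \<notin> V n)"
  have k: "y \<notin> V k" unfolding k_def by (rule LeastI_ex[OF ex])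
  have "k \<noteq> 0"
  proof
    assume "k = 0"
    then show False using k y(1) V0 by simp
  qed
  then obtain j where j: "k = Suc j" by (cases k) auto
  have "y \<in> V j"
    using not_less_Least[of j "\<lambda>n. y \<notin> V n"] j unfolding k_def by simp
  then have "y \<in> R j" using k j by (simp add: R_def)
  then show ?thesis ..
qed

lemma finite_R_meeting:
  assumes C: "C \<in> clop" "x \<notin> C"
  shows "finite {n. R n \<inter> C \<noteq> {}}"
proof -
  have "topspace X - C \<in> clop" "x \<in> topspace X - C" using C xX by auto
  then obtain n where n: "V n \<subseteq> topspace X - C" using Vconv by blast
  have "{n. R n \<inter> C \<noteq> {}} \<subseteq> {..<n}"
  proof
    fix m assume m: "m \<in> {n. R n \<inter> C \<noteq> {}}"
    show "m \<in> {..<n}"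
    proof (rule ccontr)
      assume "m \<notin> {..<n}"
      then have "R m \<subseteq> V n" using R_in_V[of n m] by simp
      then show False using m n by auto
    qed
  qed
  then show ?thesis by (rule finite_subset) simp
qed

lemma finite_R_outside:
  assumes W: "W \<in> clop" "x \<in> W"
  shows "finite {n. \<not> R n \<subseteq> W}"
proof -
  have "finite {n. R n \<inter> (topspace X - W) \<noteq> {}}"
    by (rule finite_R_meeting) (use W in auto)
  moreover have "{n. \<not> R n \<subseteq> W} \<subseteq> {n. R n \<inter> (topspace X - W) \<noteq> {}}"
    using clop_subset[OF Rclop] by auto
  ultimately show ?thesis by (rule rev_finite_subset)
qed

lemma RU: "R n \<subseteq> U"
  using VU[of n] by (auto simp: R_def)

text \<open>Let \<open>g\<close> fix \<open>x\<close> and be the identity on the annuli with index in the infinite set \<open>E\<close>. The support of \<open>g\<close> is contained in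
the union \<open>W\<close> of the other annuli, together with \<open>x\<close>. For every integer \<open>k \<noteq> 0\<close> a copy of \<open>W\<close> is placed into the free annuli:
the piece \<open>R j\<close> of the \<open>k\<close>-th copy is put into the free annulus \<open>R (spot j k)\<close>, where \<open>spot\<close> is injective
and exceeds \<open>j\<close>. The copy with \<open>k = 0\<close> is \<open>W\<close> itself. The pieces of all copies together converge to \<open>x\<close>, since
each lies in an annulus of its own.\<close>

context
  fixes g E
  assumes g: "g \<in> supp_in U" "g x = x" and E: "infinite E"
    and gE: "\<And>n y. n \<in> E \<Longrightarrow> y \<in> R n \<Longrightarrow> g y = y"
begin

lemma gX: "g \<in> Homeo X"
  by (rule supp_inD(1)[OF g(1)])

definition W where "W = (\<Union>j\<in>-E. R j)"

definition idx where "idx y = (THE n. y \<in> R n)"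

text \<open>Pairs \<open>(j, k)\<close> are numbered and the members of \<open>E\<close> enumerated in increasing order; the successor makes the
inequality \<open>j < spot j k\<close> strict, so that the embedding \<open>\<kappa> (spot j k)\<close> is available on \<open>R j\<close>.\<close>

definition spot :: "nat \<Rightarrow> int \<Rightarrow> nat" where
  "spot j k = enumerate E (Suc (prod_encode (j, int_encode k)))"

definition \<eta> :: "nat \<Rightarrow> int \<Rightarrow> 'a \<Rightarrow> 'a" where
  "\<eta> j k = (if k = 0 then (\<lambda>y. y) else \<kappa> (spot j k))"

definition loc :: "nat \<Rightarrow> int \<Rightarrow> nat" where
  "loc j k = (if k = 0 then j else spot j k)"

text \<open>The point of the \<open>k\<close>-th copy that corresponds to \<open>z \<in> W\<close>.\<close>

definition \<theta> :: "'a \<times> int \<Rightarrow> 'a" where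
  "\<theta> = (\<lambda>(z, k). \<eta> (idx z) k z)"

abbreviation dom where "dom \<equiv> W \<times> (UNIV :: int set)"

definition M where "M = \<theta> ` dom"

text \<open>The homeomorphism that acts on the copies by \<open>(z, k) \<mapsto> (b k z, \<pi> k)\<close> and fixes everything else. It serves both for
\<open>F\<close> (with \<open>b k\<close> equal to \<open>g\<close> for \<open>k \<ge> 0\<close> and \<open>\<pi>\<close> the identity) and for the shift.\<close>

definition lift :: "(int \<Rightarrow> 'a \<Rightarrow> 'a) \<Rightarrow> (int \<Rightarrow> int) \<Rightarrow> 'a \<Rightarrow> 'a" where
  "lift b \<pi> = restrict (\<lambda>y. if y \<in> M
     then \<theta> ((\<lambda>(z, k). (b k z, \<pi> k)) (inv_into dom \<theta> y)) else y) (topspace X)"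

lemma idx: "y \<in> R n \<Longrightarrow> idx y = n"
  unfolding idx_def using R_unique by blast

lemma spotE: "spot j k \<in> E"
  unfolding spot_def by (rule enumerate_in_set[OF E])

lemma spot_gt: "j < spot j k"
proof -
  have "j \<le> prod_encode (j, int_encode k)" by (rule le_prod_encode_1)
  also have "\<dots> < Suc (prod_encode (j, int_encode k))" by simp
  also have "\<dots> \<le> spot j k" unfolding spot_def by (rule le_enumerate[OF E])
  finally show ?thesis .
qed

lemma spot_inj: "spot j k = spot j' k' \<Longrightarrow> j = j' \<and> k = k'"
  unfolding spot_def
  using strict_mono_eq[OF strict_mono_enumerate[OF E]] prod_encode_eq int_encode_eq by auto

lemma loc_inj: "j \<notin> E \<Longrightarrow> j' \<notin> E \<Longrightarrow> loc j k = loc j' k' \<Longrightarrow> j = j' \<and> k = k'"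
  using spotE[of j k] spotE[of j' k'] spot_inj[of j k j' k']
  by (cases "k = 0"; cases "k' = 0") (auto simp: loc_def)

lemma \<eta>_emb: "emb (R j) (\<eta> j k)"
proof (cases "k = 0")
  case True
  have "emb (R j) (\<lambda>y. y)" using Rclop[of j] by (simp add: emb_def cont_at_id)
  then show ?thesis using True by (simp add: \<eta>_def)
next
  case False
  have "R j \<subseteq> U - V (spot j k)" using RU[of j] R_notin_V[OF spot_gt] by blast
  then have "emb (R j) (\<kappa> (spot j k))" by (rule emb_sub[OF \<kappa>(1) Rclop])
  then show ?thesis using False by (simp add: \<eta>_def)
qed

lemma \<eta>_image: "\<eta> j k ` R j \<subseteq> R (loc j k)"
proof (cases "k = 0")
  case False
  have "R j \<subseteq> U - V (spot j k)" using RU[of j] R_notin_V[OF spot_gt] by blast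
  then have "\<kappa> (spot j k) ` R j \<subseteq> \<kappa> (spot j k) ` (U - V (spot j k))" by (rule image_mono)
  then show ?thesis using \<kappa>(2)[of "spot j k"] False by (auto simp: \<eta>_def loc_def R_def)
qed (auto simp: \<eta>_def loc_def)

lemma W_obtain:
  assumes "z \<in> W"
  obtains j where "j \<notin> E" "z \<in> R j" "idx z = j"
  using assms idx by (auto simp: W_def)

lemma WU: "W \<subseteq> U" and WX: "W \<subseteq> topspace X" and xW: "x \<notin> W"
  using RU UX xR by (auto simp: W_def)

lemma \<theta>_in: "z \<in> R j \<Longrightarrow> \<theta> (z, k) = \<eta> j k z"
  by (simp add: \<theta>_def idx)

lemma \<theta>_zero: "\<theta> (z, 0) = z"
  by (simp add: \<theta>_def \<eta>_def)

lemma \<theta>_R: "z \<in> R j \<Longrightarrow> \<theta> (z, k) \<in> R (loc j k)"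
  using \<eta>_image \<theta>_in by auto

lemma \<theta>_inj: "inj_on \<theta> dom"
proof (rule inj_onI)
  fix u v assume "u \<in> dom" "v \<in> dom" and eq: "\<theta> u = \<theta> v"
  then obtain z k z' k' where uv: "u = (z, k)" "v = (z', k')" "z \<in> W" "z' \<in> W" by auto
  obtain j where j: "j \<notin> E" "z \<in> R j" by (rule W_obtain[OF uv(3)])
  obtain j' where j': "j' \<notin> E" "z' \<in> R j'" by (rule W_obtain[OF uv(4)])
  have e: "\<theta> (z, k) = \<theta> (z', k')" using eq uv by simp
  have "\<theta> (z, k) \<in> R (loc j k)" by (rule \<theta>_R[OF j(2)])
  moreover have "\<theta> (z, k) \<in> R (loc j' k')" unfolding e by (rule \<theta>_R[OF j'(2)])
  ultimately have "loc j k = loc j' k'" by (rule R_unique)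
  then have jk: "j = j'" "k = k'" using loc_inj[OF j(1) j'(1)] by auto
  have "\<eta> j k z = \<eta> j k z'" using eq uv \<theta>_in[OF j(2)] \<theta>_in[OF j'(2)] jk by simp
  then have "z = z'" using embD(3)[OF \<eta>_emb] j j' jk by (meson inj_onD)
  then show "u = v" using uv jk by simp
qed

lemma \<theta>_inv: "z \<in> W \<Longrightarrow> inv_into dom \<theta> (\<theta> (z, k)) = (z, k)"
  by (rule inv_into_f_f[OF \<theta>_inj]) simp

lemma M_in: "z \<in> W \<Longrightarrow> \<theta> (z, k) \<in> M"
  by (auto simp: M_def)

lemma MU: "M \<subseteq> U"
proof
  fix y assume "y \<in> M"
  then obtain z k where z: "z \<in> W" "y = \<theta> (z, k)" by (auto simp: M_def)
  obtain j where j: "j \<notin> E" "z \<in> R j" by (rule W_obtain[OF z(1)])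
  show "y \<in> U" using \<theta>_R[OF j(2), of k] RU z(2) by blast
qed

text \<open>Locally the map is a composition of an inverse embedding, \<open>b k\<close>, and an embedding. For the finiteness condition at
\<open>x\<close>, note that the preimage of an annulus under \<open>b k\<close> is a clopen set without \<open>x\<close> and so meets only
finitely many annuli.\<close>

lemma lift:
  assumes b: "\<And>k. b k \<in> Homeo X" "\<And>k. b k x = x" "\<And>k. b k ` W = W"
    and \<pi>: "bij \<pi>"
  shows "lift b \<pi> \<in> supp_in U"
    and "z \<in> W \<Longrightarrow> lift b \<pi> (\<theta> (z, k)) = \<theta> (b k z, \<pi> k)"
    and "y \<in> topspace X \<Longrightarrow> y \<notin> M \<Longrightarrow> lift b \<pi> y = y"
proof -
  define L where "L = (\<lambda>(z, k). (b k z, \<pi> k))"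
  define F where "F y = \<theta> (L (inv_into dom \<theta> y))" for y
  have F: "F (\<theta> (z, k)) = \<theta> (b k z, \<pi> k)" if "z \<in> W" for z k
    using \<theta>_inv[OF that] by (simp add: F_def L_def)
  have bW: "b k z \<in> W" if "z \<in> W" for k z using b(3)[of k] that by blast
  have Lbij: "bij_betw L dom dom"
    unfolding bij_betw_def
  proof
    show "inj_on L dom"
    proof (rule inj_onI)
      fix u v assume "u \<in> dom" "v \<in> dom" and eq: "L u = L v"
      then obtain z k z' k' where uv: "u = (z, k)" "v = (z', k')" "z \<in> W" "z' \<in> W" by auto
      have "k = k'" using eq uv bij_is_inj[OF \<pi>] by (simp add: L_def inj_eq)
      moreover have "z = z'"
        using eq uv \<open>k = k'\<close> Homeo_inj_eq[OF b(1)[of k]] WX by (auto simp: L_def)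
      ultimately show "u = v" using uv by simp
    qed
    show "L ` dom = dom"
    proof
      show "L ` dom \<subseteq> dom" using bW by (auto simp: L_def)
      show "dom \<subseteq> L ` dom"
      proof
        fix v assume "v \<in> dom"
        then obtain z k where v: "v = (z, k)" "z \<in> W" by auto
        obtain k0 where k0: "k = \<pi> k0" using bij_is_surj[OF \<pi>] by (metis surjD)
        obtain z0 where z0: "z0 \<in> W" "z = b k0 z0" using b(3)[of k0] v(2) by blast
        show "v \<in> L ` dom"
          using v k0 z0 by (intro image_eqI[of _ _ "(z0, k0)"]) (auto simp: L_def)
      qed
    qed
  qed
  have \<theta>bij: "bij_betw \<theta> dom M" using \<theta>_inj by (simp add: bij_betw_def M_def)
  have "bij_betw (\<theta> \<circ> (L \<circ> inv_into dom \<theta>)) M M"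
    by (intro bij_betw_trans[OF _ \<theta>bij] bij_betw_trans[OF bij_betw_inv_into[OF \<theta>bij]] Lbij)
  then have Fbij: "bij_betw F M M" by (simp add: F_def[abs_def] o_def)
  define I where "I = (-E) \<times> (UNIV :: int set)"
  define B where "B = (\<lambda>(j, k). \<eta> j k ` R j)"
  have M_eq: "M = \<Union>(B ` I)"
  proof
    show "M \<subseteq> \<Union>(B ` I)"
    proof
      fix y assume "y \<in> M"
      then obtain z k where z: "z \<in> W" "y = \<theta> (z, k)" by (auto simp: M_def)
      obtain j where j: "j \<notin> E" "z \<in> R j" by (rule W_obtain[OF z(1)])
      have "y \<in> B (j, k)" using z(2) \<theta>_in[OF j(2)] j(2) by (simp add: B_def)
      moreover have "(j, k) \<in> I" using j by (simp add: I_def)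
      ultimately show "y \<in> \<Union>(B ` I)" by blast
    qed
    show "\<Union>(B ` I) \<subseteq> M"
    proof
      fix y assume "y \<in> \<Union>(B ` I)"
      then obtain j k z where jk: "j \<notin> E" "z \<in> R j" "y = \<eta> j k z" by (auto simp: I_def B_def)
      then have "z \<in> W" by (auto simp: W_def)
      then show "y \<in> M" using M_in[of z k] \<theta>_in[OF jk(2)] jk(3) by simp
    qed
  qed
  have Bc: "B i \<in> clop" if "i \<in> I" for i
    using embD(2)[OF \<eta>_emb] by (cases i) (simp add: B_def)
  have BR: "B (j, k) \<subseteq> R (loc j k)" for j k
    using \<eta>_image by (simp add: B_def)
  have xB: "x \<notin> B i" if "i \<in> I" for i
    using BR xR by (cases i) blast
  have conv: "finite {i \<in> I. \<not> B i \<subseteq> C}" if C: "C \<in> clop" "x \<in> C" for C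
  proof (rule finite_imageD)
    have "(\<lambda>(j, k). loc j k) ` {i \<in> I. \<not> B i \<subseteq> C} \<subseteq> {n. \<not> R n \<subseteq> C}"
      using BR by fastforce
    then show "finite ((\<lambda>(j, k). loc j k) ` {i \<in> I. \<not> B i \<subseteq> C})"
      by (rule finite_subset[OF _ finite_R_outside[OF C]])
    show "inj_on (\<lambda>(j, k). loc j k) {i \<in> I. \<not> B i \<subseteq> C}"
      using loc_inj by (auto simp: inj_on_def I_def)
  qed
  have cont: "cont_at F y" if yM: "y \<in> M" for y
  proof -
    obtain z k where z: "z \<in> W" "y = \<theta> (z, k)" using yM by (auto simp: M_def)
    obtain j where j: "j \<notin> E" "z \<in> R j" by (rule W_obtain[OF z(1)])
    obtain j' where j': "j' \<notin> E" "b k z \<in> R j'" by (rule W_obtain[OF bW[OF z(1)]])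
    let ?Q = "R j \<inter> hinv (b k) ` R j'"
    have Q: "?Q \<in> clop" using Rclop Homeo_clop[OF hinv_closed[OF b(1)] Rclop] by blast
    have mQ: "w \<in> ?Q \<longleftrightarrow> w \<in> R j \<and> b k w \<in> R j'" for w
      using mem_hinv_image[OF b(1) clop_subset[OF Rclop]] clop_in[OF Rclop] by blast
    let ?N = "\<eta> j k ` ?Q"
    have N: "?N \<in> clop" by (rule emb_image[OF \<eta>_emb Q]) blast
    have y: "y = \<eta> j k z" using z \<theta>_in[OF j(2)] by simp
    have zQ: "z \<in> ?Q" by (rule mQ[THEN iffD2]) (use j j' in simp)
    have yN: "y \<in> ?N" using y zQ by blast
    note ei = emb_inv(1)[OF \<eta>_emb[of j k]]
    have inv: "inv_into (R j) (\<eta> j k) (\<eta> j k w) = w" if "w \<in> R j" for w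
      by (rule inv_into_f_f[OF embD(3)[OF \<eta>_emb] that])
    have c1: "cont_at (inv_into (R j) (\<eta> j k)) y"
      by (rule embD(4)[OF ei]) (use y j in simp)
    have c2: "cont_at (\<lambda>w. b k (inv_into (R j) (\<eta> j k) w)) y"
      by (rule cont_at_comp[OF c1 Homeo_cont_at[OF b(1)]])
        (use y inv[OF j(2)] clop_in[OF Rclop j(2)] in simp)
    have c3: "cont_at (\<lambda>w. \<eta> j' (\<pi> k) (b k (inv_into (R j) (\<eta> j k) w))) y"
      by (rule cont_at_comp[OF c2 embD(4)[OF \<eta>_emb]]) (use y inv[OF j(2)] j' in simp)
    show ?thesis
    proof (rule cont_at_cong[OF c3 clopD(1)[OF N] yN])
      fix w assume "w \<in> ?N"
      then obtain u where u: "u \<in> ?Q" "w = \<eta> j k u" by blast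
      then have uR: "u \<in> R j" "b k u \<in> R j'" using mQ by auto
      have "u \<in> W" using uR j by (auto simp: W_def)
      then have "F w = \<theta> (b k u, \<pi> k)" using F u(2) \<theta>_in[OF uR(1)] by metis
      then show "F w = \<eta> j' (\<pi> k) (b k (inv_into (R j) (\<eta> j k) w))"
        using \<theta>_in[OF uR(2)] u(2) inv[OF uR(1)] by simp
    qed
  qed
  have fin: "finite {i' \<in> I. F ` B i' \<inter> B i \<noteq> {}}" if i: "i \<in> I" for i
  proof -
    obtain j k where jk: "i = (j, k)" "j \<notin> E" using i by (auto simp: I_def)
    let ?k = "inv_into UNIV \<pi> k"
    let ?C = "hinv (b ?k) ` R j"
    have C: "?C \<in> clop" by (rule Homeo_clop[OF hinv_closed[OF b(1)] Rclop])
    have "x \<notin> ?C" using mem_hinv_image[OF b(1) clop_subset[OF Rclop] xX] b(2) xR by simp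
    then have fC: "finite {n. R n \<inter> ?C \<noteq> {}}" by (rule finite_R_meeting[OF C])
    have "{i' \<in> I. F ` B i' \<inter> B i \<noteq> {}} \<subseteq> {n. R n \<inter> ?C \<noteq> {}} \<times> {?k}"
    proof
      fix i' assume i': "i' \<in> {i' \<in> I. F ` B i' \<inter> B i \<noteq> {}}"
      obtain j' k' where jk': "i' = (j', k')" "j' \<notin> E" using i' by (auto simp: I_def)
      obtain y where y: "y \<in> B i'" "F y \<in> B i" using i' by blast
      obtain z where z: "z \<in> R j'" "y = \<eta> j' k' z" using y(1) jk' by (auto simp: B_def)
      have zW: "z \<in> W" using z jk' by (auto simp: W_def)
      have Fy: "F y = \<theta> (b k' z, \<pi> k')" using F[OF zW] z \<theta>_in by metis
      obtain m where m: "m \<notin> E" "b k' z \<in> R m" by (rule W_obtain[OF bW[OF zW]])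
      have "F y \<in> R (loc m (\<pi> k'))" using Fy \<theta>_R[OF m(2)] by simp
      moreover have "F y \<in> R (loc j k)" using y(2) jk BR by blast
      ultimately have "loc m (\<pi> k') = loc j k" by (rule R_unique)
      then have mj: "m = j" "\<pi> k' = k" using loc_inj[OF m(1) jk(2)] by auto
      have k': "k' = ?k" using mj(2) bij_is_inj[OF \<pi>] by (metis inv_f_f)
      have "z \<in> ?C"
        using mem_hinv_image[OF b(1) clop_subset[OF Rclop] clop_in[OF Rclop z(1)]] m(2) mj(1) k' by simp
      then show "i' \<in> {n. R n \<inter> ?C \<noteq> {}} \<times> {?k}" using jk' z(1) k' by auto
    qed
    then show ?thesis by (rule finite_subset) (use fC in simp)
  qed
  have "restrict (\<lambda>y. if y \<in> \<Union>(B ` I) then F y else y) (topspace X) \<in> Homeo X"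
    by (rule converging_homeo[OF xX Bc xB conv]) (use Fbij cont fin M_eq in auto)
  moreover have lF: "lift b \<pi> = restrict (\<lambda>y. if y \<in> M then F y else y) (topspace X)"
    by (simp only: lift_def F_def L_def)
  ultimately have H: "lift b \<pi> \<in> Homeo X" using M_eq by simp
  show out: "lift b \<pi> y = y" if "y \<in> topspace X" "y \<notin> M" for y
    using that lF by simp
  show "lift b \<pi> \<in> supp_in U"
    using H out MU by (auto simp: supp_in_def)
  show "lift b \<pi> (\<theta> (z, k)) = \<theta> (b k z, \<pi> k)" if "z \<in> W"
    using M_in[OF that, of k] F[OF that, of k] MU UX lF by auto
qed

lemma gW: "g ` W = W"
proof -
  have W_eq: "W = U - insert x (\<Union>(R ` E))"
  proof
    show "W \<subseteq> U - insert x (\<Union>(R ` E))"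
    proof
      fix z assume z: "z \<in> W"
      obtain j where j: "j \<notin> E" "z \<in> R j" by (rule W_obtain[OF z])
      have "z \<notin> \<Union>(R ` E)" using j R_unique[OF j(2)] by blast
      then show "z \<in> U - insert x (\<Union>(R ` E))" using z WU xW by blast
    qed
    show "U - insert x (\<Union>(R ` E)) \<subseteq> W"
      using R_cover by (fastforce simp: W_def)
  qed
  have sub: "insert x (\<Union>(R ` E)) \<subseteq> U" using RU xV[of 0] V0 by auto
  have "g y = y" if "y \<in> insert x (\<Union>(R ` E))" for y using that g(2) gE by auto
  then have 1: "g ` insert x (\<Union>(R ` E)) = insert x (\<Union>(R ` E))" by (metis image_cong image_ident)
  have "g ` W = g ` U - g ` insert x (\<Union>(R ` E))"
    unfolding W_eq by (rule inj_on_image_set_diff[OF Homeo_inj[OF gX]]) (use UX sub in auto)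
  also have "g ` U = U" by (rule supp_in_set_image[OF g(1) _ UX]) simp
  finally show ?thesis unfolding 1 using W_eq by simp
qed

lemma g\<theta>:
  assumes "z \<in> W" "k \<noteq> 0"
  shows "g (\<theta> (z, k)) = \<theta> (z, k)"
proof -
  obtain j where j: "j \<notin> E" "z \<in> R j" by (rule W_obtain[OF assms(1)])
  have "\<theta> (z, k) \<in> R (spot j k)" using \<theta>_R[OF j(2), of k] assms(2) by (simp add: loc_def)
  then show ?thesis by (rule gE[OF spotE])
qed

lemma gM:
  assumes y: "y \<in> topspace X" "y \<notin> M"
  shows "g y = y"
proof (cases "y \<in> U \<and> y \<noteq> x")
  case True
  then obtain n where n: "y \<in> R n" using R_cover by blast
  have "y \<notin> W" using y(2) M_in[of y 0] \<theta>_zero by auto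
  then have "n \<in> E" using n by (auto simp: W_def)
  then show ?thesis using gE n by blast
next
  case False
  then show ?thesis using g(2) supp_inD(2)[OF g(1) y(1)] by auto
qed

text \<open>The conjugate of \<open>F\<close> by the shift \<open>\<phi>\<close> acts as \<open>g\<close> on the copies with index \<open>k \<ge> 1\<close> only, so its quotient with \<open>F\<close> is \<open>g\<close> on the
copy with index \<open>0\<close>, which is \<open>g\<close> itself.\<close>

lemma swindle:
  "\<exists>a\<in>supp_in U. \<exists>b\<in>supp_in U. a \<star> b \<star> hinv a \<star> hinv b = g"
proof -
  define F where "F = lift (\<lambda>k. if k \<ge> 0 then g else hone) (\<lambda>k. k)"
  define \<phi> where "\<phi> = lift (\<lambda>k. hone) (\<lambda>k. k + 1)"
  have bj: "bij (\<lambda>k::int. k)" "bij (\<lambda>k::int. k + 1)"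
    by (rule bij_betw_byWitness[where f' = "\<lambda>k. k"]; simp)
      (rule bij_betw_byWitness[where f' = "\<lambda>k. k - 1"]; simp)
  note lF = lift[of "\<lambda>k. if k \<ge> 0 then g else hone" "\<lambda>k. k"]
  note l\<phi> = lift[of "\<lambda>k. hone" "\<lambda>k. k + 1"]
  have bb: "(if k \<ge> 0 then g else hone) \<in> Homeo X" "(if k \<ge> 0 then g else hone) x = x"
    "(if k \<ge> 0 then g else hone) ` W = W" for k :: int
    using gX g(2) gW hone_image[OF WX] xX by auto
  have hh: "hone \<in> Homeo X" "hone x = x" "hone ` W = W"
    using hone_image[OF WX] xX by auto
  have F: "F \<in> supp_in U" "\<And>z k. z \<in> W \<Longrightarrow> F (\<theta> (z, k)) = \<theta> (if k \<ge> 0 then g z else z, k)"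
    "\<And>y. y \<in> topspace X \<Longrightarrow> y \<notin> M \<Longrightarrow> F y = y"
    unfolding F_def using lF[OF bb bj(1)] WX by auto
  have \<phi>: "\<phi> \<in> supp_in U" "\<And>z k. z \<in> W \<Longrightarrow> \<phi> (\<theta> (z, k)) = \<theta> (z, k + 1)"
    "\<And>y. y \<in> topspace X \<Longrightarrow> y \<notin> M \<Longrightarrow> \<phi> y = y"
    unfolding \<phi>_def using l\<phi>[OF hh bj(2)] WX by auto
  have FX: "F \<in> Homeo X" "\<phi> \<in> Homeo X" using F(1) \<phi>(1) supp_inD(1) by auto
  \<comment> \<open>The commutator identity without inverses; only k = -1, where the shift enters the region on which F acts, uses the factor g.\<close>
  have key: "F \<star> \<phi> = g \<star> \<phi> \<star> F"
  proof (rule Homeo_eqI)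
    fix y assume y: "y \<in> topspace X"
    show "(F \<star> \<phi>) y = (g \<star> \<phi> \<star> F) y"
    proof (cases "y \<in> M")
      case False
      then show ?thesis using y F(3) \<phi>(3) gM FX gX by simp
    next
      case True
      then obtain z k where z: "z \<in> W" "y = \<theta> (z, k)" by (auto simp: M_def)
      have gz: "g z \<in> W" using gW z(1) by blast
      have "F (\<phi> y) = g (\<phi> (F y))"
      proof -
        consider "k \<ge> 0" | "k = -1" | "k < -1" by linarith
        then show ?thesis
        proof cases
          case 1
          then show ?thesis using z gz by (simp add: F(2) \<phi>(2) g\<theta>)
        next
          case 2
          have "F z = g z" using F(2)[OF z(1), of 0] \<theta>_zero by simp
          then show ?thesis using 2 z gz by (simp add: F(2) \<phi>(2) \<theta>_zero)
        next
          case 3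
          then show ?thesis using z gz by (simp add: F(2) \<phi>(2) g\<theta>)
        qed
      qed
      then show ?thesis using y FX gX by simp
    qed
  qed (use FX gX in simp_all)
  have "F \<star> \<phi> \<star> hinv F \<star> hinv \<phi> = g \<star> \<phi> \<star> F \<star> hinv F \<star> hinv \<phi>"
    using key by simp
  also have "\<dots> = g" using FX gX by (simp add: H.m_assoc)
  finally show ?thesis using F(1) \<phi>(1) by blast
qed

end

section \<open>Perfectness at a stable point\<close>

text \<open>The supports \<open>D j\<close> lie in disjoint blocks of four consecutive annuli; the blocks start at the multiples of five, so every
fifth annulus stays free.\<close>

lemma infinite_product:
  assumes s: "\<And>j. s j \<in> supp_in (D j)" and D: "\<And>j. D j \<in> clop"
    and DV: "\<And>j. D j \<subseteq> V (5 * j) - V (5 * j + 4)"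
  obtains p where "p \<in> supp_in U" "\<forall>j. \<forall>y\<in>D j. p y = s j y"
    "\<forall>y\<in>topspace X. (\<forall>j. y \<notin> D j) \<longrightarrow> p y = y"
proof -
  have disj: "i = j" if "y \<in> D i" "y \<in> D j" for i j y
  proof (rule ccontr)
    assume "i \<noteq> j"
    moreover have False if "y \<in> D i" "y \<in> D j" "i < j" for i j
    proof -
      have "y \<notin> V (5 * i + 4)" "y \<in> V (5 * j)" using that DV by blast+
      moreover have "V (5 * j) \<subseteq> V (5 * i + 4)" using that(3) by (intro Vanti) simp
      ultimately show False by blast
    qed
    ultimately show False using that by (meson linorder_neqE_nat)
  qed
  define blk where "blk y = (THE j. y \<in> D j)" for y
  have blk: "blk y = j" if "y \<in> D j" for y j
    unfolding blk_def using that disj by blast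
  define F where "F y = s (blk y) y" for y
  have F: "F y = s j y" if "y \<in> D j" for y j using blk[OF that] by (simp add: F_def)
  have sD: "s j ` D j = D j" for j
    by (rule supp_in_set_image[OF s _ clop_subset[OF D]]) simp
  have FD: "F ` D j = D j" for j using sD[of j] F by (metis image_cong)
  let ?M = "\<Union>(D ` UNIV)"
  have H: "restrict (\<lambda>y. if y \<in> ?M then F y else y) (topspace X) \<in> Homeo X"
  proof (rule converging_homeo[OF xX, where I = UNIV and B = D])
    show "D i \<in> clop" for i by (rule D)
    show "x \<notin> D i" for i using DV[of i] xV by blast
    show "finite {i \<in> UNIV. \<not> D i \<subseteq> C}" if C: "C \<in> clop" "x \<in> C" for C
    proof -
      obtain n where n: "V n \<subseteq> C" using Vconv[OF C] by blast
      have "{i \<in> UNIV. \<not> D i \<subseteq> C} \<subseteq> {..<n}"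
      proof
        fix i assume i: "i \<in> {i \<in> UNIV. \<not> D i \<subseteq> C}"
        show "i \<in> {..<n}"
        proof (rule ccontr)
          assume "i \<notin> {..<n}"
          then have "V (5 * i) \<subseteq> V n" by (intro Vanti) simp
          then show False using i DV[of i] n by auto
        qed
      qed
      then show ?thesis by (rule finite_subset) simp
    qed
    show "bij_betw F ?M ?M"
      unfolding bij_betw_def
    proof
      show "F ` ?M = ?M" using FD by (simp add: image_UN)
      show "inj_on F ?M"
      proof (rule inj_onI)
        fix y z assume "y \<in> ?M" "z \<in> ?M" and eq: "F y = F z"
        then obtain i j where ij: "y \<in> D i" "z \<in> D j" by blast
        have "F y \<in> D i" using FD[of i] ij(1) by blast
        moreover have "F y \<in> D j" using FD[of j] ij(2) unfolding eq by blast
        ultimately have "i = j" by (rule disj)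
        then have "s i y = s i z" using F ij eq by metis
        then show "y = z"
          using Homeo_inj_eq[OF supp_inD(1)[OF s]] ij clop_in[OF D] by metis
      qed
    qed
    show "cont_at F y" if y: "y \<in> ?M" for y
    proof -
      obtain j where j: "y \<in> D j" using y by blast
      show ?thesis
        by (rule cont_at_cong[OF Homeo_cont_at[OF supp_inD(1)[OF s] clop_in[OF D j]] clopD(1)[OF D] j F])
    qed
    show "finite {j \<in> UNIV. F ` D j \<inter> D i \<noteq> {}}" for i
    proof (rule finite_subset)
      show "{j \<in> UNIV. F ` D j \<inter> D i \<noteq> {}} \<subseteq> {i}" using FD disj by auto
    qed simp
  qed
  let ?p = "restrict (\<lambda>y. if y \<in> ?M then F y else y) (topspace X)"
  have 1: "?p y = s j y" if "y \<in> D j" for y j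
    using F[OF that] that clop_in[OF D that] by auto
  have 2: "?p y = y" if "y \<in> topspace X" "\<forall>j. y \<notin> D j" for y
    using that by auto
  have "?M \<subseteq> U" using DV VU by blast
  then have "?p \<in> supp_in U" using H by (auto simp: supp_in_def)
  moreover have "\<forall>j. \<forall>y\<in>D j. ?p y = s j y" using 1 by simp
  moreover have "\<forall>y\<in>topspace X. (\<forall>j. y \<notin> D j) \<longrightarrow> ?p y = y" using 2 by blast
  ultimately show ?thesis by (rule that)
qed

lemma block_avoids:
  assumes "y \<in> R (5 * i + 4)"
  shows "y \<notin> V (5 * j) - V (5 * j + 4)"
proof (cases "j \<le> i")
  case True
  then have "R (5 * i + 4) \<subseteq> V (5 * j + 4)" by (intro R_in_V) simp
  then show ?thesis using assms by blast
next
  case False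
  then have "R (5 * i + 4) \<inter> V (5 * j) = {}" by (intro R_notin_V) simp
  then show ?thesis using assms by blast
qed

text \<open>The aim is a product \<open>a b\<close> that agrees with \<open>f\<close> on infinitely many annuli while \<open>a\<close> and \<open>b\<close> are trivial on infinitely
many others: then the swindle applies to each of \<open>a\<close>, \<open>b\<close> and \<open>(a b)\<inverse> f\<close>. For a single annulus \<open>P\<close>
with a copy \<open>k P\<close> disjoint from \<open>P\<close> and from \<open>f P\<close>, let \<open>b\<close> exchange \<open>P\<close> with \<open>k P\<close>, and let \<open>a\<close> exchange \<open>f P\<close> with \<open>k P\<close> in such a
way that \<open>k y\<close> goes to \<open>f y\<close>. The detour through \<open>k P\<close> works however \<open>f P\<close> overlaps \<open>P\<close>. It is taken for all annuli of index
\<open>5 j + 1\<close> at once: \<open>f\<close> moves points by at most one annulus, so \<open>f P\<close> stays in the annuli \<open>5 j\<close> to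
\<open>5 j + 2\<close>; the copy is taken in the annulus \<open>5 j + 3\<close>, and the annulus \<open>5 j + 4\<close> is left alone.\<close>

lemma factor_fixing_centre:
  assumes f: "f \<in> supp_in U" and fV: "\<And>n. f ` V (Suc n) \<subseteq> V n" "\<And>n. hinv f ` V (Suc n) \<subseteq> V n"
  obtains a b where "a \<in> supp_in U" "b \<in> supp_in U"
    "\<forall>i. \<forall>y\<in>R (5 * i + 4). a y = y \<and> b y = y"
    "a x = x" "b x = x" "\<forall>i. \<forall>y\<in>R (5 * i + 1). a (b y) = f y"
proof -
  have fX: "f \<in> Homeo X" by (rule supp_inD(1)[OF f])
  define k where "k j = \<kappa> (5 * j + 3)" for j
  define P where "P j = R (5 * j + 1)" for j
  have Pc: "P j \<in> clop" for j unfolding P_def by (rule Rclop)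
  have kP: "emb (P j) (k j)" "k j ` P j \<subseteq> R (5 * j + 3)" for j
  proof -
    have "P j \<subseteq> U - V (5 * j + 3)"
      using RU[of "5 * j + 1"] R_notin_V[of "5 * j + 1" "5 * j + 3"] unfolding P_def by auto
    then show "emb (P j) (k j)" "k j ` P j \<subseteq> R (5 * j + 3)"
      using emb_sub[OF \<kappa>(1)[of "5 * j + 3"] Pc] \<kappa>(2)[of "5 * j + 3"] by (auto simp: k_def R_def)
  qed
  have RD: "R (5 * j + 3) \<subseteq> V (5 * j) - V (5 * j + 4)" for j
    using R_in_V[of "5 * j" "5 * j + 3"] by (auto simp: R_def numeral_eq_Suc)
  have PD: "P j \<subseteq> V (5 * j) - V (5 * j + 3)" for j
    using R_in_V[of "5 * j" "5 * j + 1"] R_notin_V[of "5 * j + 1" "5 * j + 3"] by (auto simp: P_def)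
  have V34: "V (5 * j + 4) \<subseteq> V (5 * j + 3)" for j by (rule Vanti) simp
  have PR: "(V (5 * j) - V (5 * j + 3)) \<inter> R (5 * j + 3) = {}" for j
    by (auto simp: R_def)
  have kd: "P j \<inter> k j ` P j = {}" for j using PD kP(2) PR by blast
  let ?D1 = "\<lambda>j. P j \<union> k j ` P j"
  have s1: "swap (P j) (k j) \<in> supp_in (?D1 j)" for j by (rule swap_supp[OF kP(1) kd])
  have c1: "?D1 j \<in> clop" for j by (rule clop_Un[OF Pc embD(2)[OF kP(1)]])
  have D1V: "?D1 j \<subseteq> V (5 * j) - V (5 * j + 4)" for j using PD[of j] kP(2)[of j] RD[of j] V34[of j] by blast
  obtain b where b0: "b \<in> supp_in U" "\<forall>j. \<forall>y\<in>?D1 j. b y = swap (P j) (k j) y"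
    "\<forall>y\<in>topspace X. (\<forall>j. y \<notin> ?D1 j) \<longrightarrow> b y = y"
    by (rule infinite_product[of "\<lambda>j. swap (P j) (k j)" ?D1, OF s1 c1 D1V])
  have b: "b \<in> supp_in U" "\<And>j y. y \<in> ?D1 j \<Longrightarrow> b y = swap (P j) (k j) y"
    "\<And>y. y \<in> topspace X \<Longrightarrow> \<forall>j. y \<notin> ?D1 j \<Longrightarrow> b y = y"
    using b0 by auto
  let ?Q = "\<lambda>j. f ` P j"
  define h where "h j = (\<lambda>y. k j (hinv f y))" for j
  have PX: "P j \<subseteq> topspace X" for j by (rule clop_subset[OF Pc])
  have Qc: "?Q j \<in> clop" for j by (rule Homeo_clop[OF fX Pc])
  have hf: "h j (f y) = k j y" if "y \<in> P j" for j y
    using that PX fX by (auto simp: h_def subset_iff)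
  have hQ: "h j ` ?Q j = k j ` P j" for j
    unfolding image_image using hf by (rule image_cong[OF refl])
  have eh: "emb (?Q j) (h j)" for j
    unfolding h_def
  proof (rule emb_comp[OF Homeo_emb[OF hinv_closed[OF fX] Qc]])
    show "emb (hinv f ` ?Q j) (k j)" using hinv_image(1)[OF fX PX] kP(1) by simp
  qed
  have QD: "?Q j \<subseteq> V (5 * j) - V (5 * j + 3)" for j
  proof (rule image_subsetI)
    fix y assume y: "y \<in> P j"
    have "y \<in> V (Suc (5 * j))" "y \<notin> V (Suc (Suc (5 * j)))" using y by (simp_all add: P_def R_def)
    then have "f y \<in> V (5 * j)" using fV(1)[of "5 * j"] by blast
    moreover have "f y \<notin> V (5 * j + 3)"
    proof
      assume "f y \<in> V (5 * j + 3)"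
      then have "hinv f (f y) \<in> V (Suc (Suc (5 * j)))"
        using fV(2)[of "Suc (Suc (5 * j))"] by (auto simp: numeral_eq_Suc)
      then show False using \<open>y \<notin> V (Suc (Suc (5 * j)))\<close> fX PX y by (auto simp: subset_iff)
    qed
    ultimately show "f y \<in> V (5 * j) - V (5 * j + 3)" by blast
  qed
  have hd: "?Q j \<inter> h j ` ?Q j = {}" for j using QD[of j] kP(2)[of j] PR[of j] unfolding hQ by blast
  let ?D2 = "\<lambda>j. ?Q j \<union> h j ` ?Q j"
  have s2: "swap (?Q j) (h j) \<in> supp_in (?D2 j)" for j by (rule swap_supp[OF eh hd])
  have c2: "?D2 j \<in> clop" for j by (rule clop_Un[OF Qc embD(2)[OF eh]])
  have D2V: "?D2 j \<subseteq> V (5 * j) - V (5 * j + 4)" for j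
    using QD[of j] kP(2)[of j] RD[of j] V34[of j] unfolding hQ by blast
  obtain a where a0: "a \<in> supp_in U" "\<forall>j. \<forall>y\<in>?D2 j. a y = swap (?Q j) (h j) y"
    "\<forall>y\<in>topspace X. (\<forall>j. y \<notin> ?D2 j) \<longrightarrow> a y = y"
    by (rule infinite_product[of "\<lambda>j. swap (?Q j) (h j)" ?D2, OF s2 c2 D2V])
  have a: "a \<in> supp_in U" "\<And>j y. y \<in> ?D2 j \<Longrightarrow> a y = swap (?Q j) (h j) y"
    "\<And>y. y \<in> topspace X \<Longrightarrow> \<forall>j. y \<notin> ?D2 j \<Longrightarrow> a y = y"
    using a0 by auto
  have out: "y \<notin> ?D1 j" "y \<notin> ?D2 j" if "y \<notin> V (5 * j) - V (5 * j + 4)" for y j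
    using that D1V[of j] D2V[of j] by blast+
  have free: "a y = y" "b y = y" if y: "y \<in> R (5 * i + 4)" for i y
    by (rule a(3)[OF clop_in[OF Rclop y] allI[OF out(2)[OF block_avoids[OF y]]]])
      (rule b(3)[OF clop_in[OF Rclop y] allI[OF out(1)[OF block_avoids[OF y]]]])
  have xout: "x \<notin> V (5 * j) - V (5 * j + 4)" for j using xV[of "5 * j + 4"] by simp
  have cen: "a x = x" "b x = x"
    by (rule a(3)[OF xX allI[OF out(2)[OF xout]]]) (rule b(3)[OF xX allI[OF out(1)[OF xout]]])
  have fin: "a (b y) = f y" if "y \<in> R (5 * i + 1)" for i y
  proof -
    have y: "y \<in> P i" using that by (simp add: P_def)
    have "b y = k i y" using b(2)[of y i] swap_apply(1)[OF kP(1) kd y] y by simp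
    also have "k i y = h i (f y)" using hf[OF y] by simp
    finally have e: "b y = h i (f y)" .
    have "a (h i (f y)) = swap (?Q i) (h i) (h i (f y))" using y by (intro a(2)) blast
    also have "\<dots> = f y" by (rule swap_apply(2)[OF eh hd]) (use y in blast)
    finally show ?thesis using e by simp
  qed
  show ?thesis by (rule that[OF a(1) b(1) _ cen]) (use free fin in auto)
qed

end

context stone_space begin

text \<open>Given \<open>V n\<close>, stability yields an embedding of \<open>U\<close> onto \<open>V n\<close> that fixes \<open>x\<close>. It maps the complement of \<open>V n\<close> to a
clopen subset of \<open>V n\<close> without \<open>x\<close>, and the next set is chosen so small that it avoids this image, besides meeting the
conditions imposed by \<open>f\<close> and by a countable neighbourhood basis.\<close>

lemma annuli_exist:
  assumes U: "stable_nbhd X x U" and f: "f \<in> Homeo X" "f x = x"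
  obtains V \<kappa> where "annuli X x U V \<kappa>" "\<forall>n. f ` V (Suc n) \<subseteq> V n \<and> hinv f ` V (Suc n) \<subseteq> V n"
proof -
  note Uc = stable_nbhdD[OF U]
  have xX: "x \<in> topspace X" by (rule clop_in[OF Uc])
  let ?\<N> = "{A \<in> clop. x \<in> A}"
  have ne: "?\<N> \<noteq> {}" using Uc by blast
  have ct: "countable ?\<N>" by (rule countable_subset[OF _ countable_clop]) blast
  define W where "W = from_nat_into ?\<N>"
  have W: "W n \<in> clop" "x \<in> W n" for n using from_nat_into[OF ne, of n] by (auto simp: W_def)
  have Wsurj: "\<exists>n. W n = A" if "A \<in> clop" "x \<in> A" for A
    using from_nat_into_surj[OF ct, of A] that by (auto simp: W_def)
  let ?P = "\<lambda>n V. V \<in> clop \<and> x \<in> V \<and> V \<subseteq> U \<and> (n = 0 \<longrightarrow> V = U)"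
  let ?S = "\<lambda>n V V'. V' \<subseteq> V \<and> V' \<subseteq> W n \<and> f ` V' \<subseteq> V \<and> hinv f ` V' \<subseteq> V \<and>
     (\<exists>\<kappa>. emb (U - V) \<kappa> \<and> \<kappa> ` (U - V) \<subseteq> V - V')"
  have "\<exists>V. \<forall>n. ?P n (V n) \<and> ?S n (V n) (V (Suc n))"
  proof (rule dependent_nat_choice)
    show "\<exists>V. ?P 0 V" using Uc by blast
    fix V and n :: nat assume V: "?P n V"
    obtain h where h: "emb U h" "h ` U = V" "h x = x" using stable_emb[OF U, of V] V by blast
    let ?A = "h ` (U - V)"
    have UV: "U - V \<in> clop" using Uc V by blast
    have A: "?A \<in> clop" by (rule emb_image[OF h(1) UV]) blast
    have xA: "x \<notin> ?A"
    proof
      assume "x \<in> ?A"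
      then obtain z where z: "z \<in> U - V" "h z = h x" using h(3) by auto
      then have "z = x" using inj_onD[OF embD(3)[OF h(1)] z(2)] Uc by blast
      then show False using z V by blast
    qed
    have VX: "V \<subseteq> topspace X" using V clop_subset by blast
    let ?V = "V \<inter> W n \<inter> hinv f ` V \<inter> f ` V - ?A"
    have Vc: "V \<in> clop" using V by simp
    have "?V \<in> clop"
      by (intro clop_Diff clop_Int A Vc W(1) Homeo_clop[OF f(1) Vc] Homeo_clop[OF hinv_closed[OF f(1)] Vc])
    moreover have "x \<in> ?V"
    proof -
      have "x \<in> hinv f ` V" using mem_hinv_image[OF f(1) VX xX] f(2) V by simp
      moreover have "x \<in> f ` V" using f(2) V by (metis imageI)
      ultimately show ?thesis using V W xA by blast
    qed
    moreover have "f ` ?V \<subseteq> V"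
    proof -
      have "f ` ?V \<subseteq> f ` (hinv f ` V)" by (rule image_mono) blast
      then show ?thesis using hinv_image(2)[OF f(1) VX] by simp
    qed
    moreover have "hinv f ` ?V \<subseteq> V"
    proof -
      have "hinv f ` ?V \<subseteq> hinv f ` (f ` V)" by (rule image_mono) blast
      then show ?thesis using hinv_image(1)[OF f(1) VX] by simp
    qed
    moreover have "emb (U - V) h" by (rule emb_sub[OF h(1) UV]) blast
    moreover have "?A \<subseteq> V - ?V" using h(2) by blast
    ultimately show "\<exists>V'. ?P (Suc n) V' \<and> ?S n V V'"
      using V by (intro exI[of _ ?V] conjI exI[of _ h]) auto
  qed
  then obtain V where V': "\<forall>n. ?P n (V n) \<and> ?S n (V n) (V (Suc n))" ..
  have V: "?P n (V n)" "?S n (V n) (V (Suc n))" for n using V'[rule_format, of n] by simp_all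
  have "\<forall>n. \<exists>\<kappa>. emb (U - V n) \<kappa> \<and> \<kappa> ` (U - V n) \<subseteq> V n - V (Suc n)" using V(2) by simp
  then obtain \<kappa> where \<kappa>: "\<And>n. emb (U - V n) (\<kappa> n)" "\<And>n. \<kappa> n ` (U - V n) \<subseteq> V n - V (Suc n)"
    by metis
  have "annuli X x U V \<kappa>"
  proof unfold_locales
    show "V 0 = U" using V(1)[of 0] by simp
    show "V n \<in> clop" "x \<in> V n" for n using V(1)[of n] by auto
    show "V (Suc n) \<subseteq> V n" for n using V(2)[of n] by blast
    show "\<exists>n. V n \<subseteq> C" if C: "C \<in> clop" "x \<in> C" for C
    proof -
      obtain n where "W n = C" using Wsurj[OF C] by blast
      then show ?thesis using V(2)[of n] by blast
    qed
    show "emb (U - V n) (\<kappa> n)" "\<kappa> n ` (U - V n) \<subseteq> V n - V (Suc n)" for n by (rule \<kappa>)+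
  qed
  then show ?thesis
  proof (rule that)
    show "\<forall>n. f ` V (Suc n) \<subseteq> V n \<and> hinv f ` V (Suc n) \<subseteq> V n" using V(2) by simp
  qed
qed

text \<open>If \<open>f\<close> fixes \<open>x\<close>, then \<open>factor_fixing_centre\<close> reduces the claim to the swindle. If \<open>f\<close> moves \<open>x\<close>, let \<open>V\<close> be
a small neighbourhood of \<open>x\<close> and \<open>\<sigma>\<close> the exchange of \<open>V\<close> with \<open>f V\<close>. The product \<open>\<sigma> f\<close> is trivial near \<open>x\<close>, so the swindle applies
to it. The set \<open>f V\<close> also has a copy close to \<open>x\<close> but outside \<open>V\<close>; the exchange \<open>\<rho>\<close> of \<open>f V\<close> with that copy is trivial near \<open>x\<close>, and \<open>\<sigma>\<close>
is conjugate to \<open>\<rho>\<close> by the exchange \<open>\<psi>\<close> of \<open>V\<close> with the copy.\<close>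

theorem stable_perfect:
  assumes U: "stable_nbhd X x U"
    and K: "\<And>a b. a \<in> K \<Longrightarrow> b \<in> K \<Longrightarrow> a \<star> b \<in> K"
    and comm: "\<And>a b. a \<in> supp_in U \<Longrightarrow> b \<in> supp_in U \<Longrightarrow> a \<star> b \<star> hinv a \<star> hinv b \<in> K"
  shows "supp_in U \<subseteq> K"
proof
  fix f assume f: "f \<in> supp_in U"
  have fX: "f \<in> Homeo X" by (rule supp_inD(1)[OF f])
  have xX: "x \<in> topspace X" by (rule clop_in[OF stable_nbhdD[OF U]])
  show "f \<in> K"
  proof (cases "f x = x")
    case True
    obtain V \<kappa> where an: "annuli X x U V \<kappa>"
      and fV0: "\<forall>n. f ` V (Suc n) \<subseteq> V n \<and> hinv f ` V (Suc n) \<subseteq> V n"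
      by (rule annuli_exist[OF U fX True])
    have fV: "f ` V (Suc n) \<subseteq> V n" "hinv f ` V (Suc n) \<subseteq> V n" for n using fV0 by simp_all
    interpret A: annuli X x U V \<kappa> by (rule an)
    have sw: "g \<in> K" if sw0: "g \<in> supp_in U" "g x = x" "infinite E" "\<And>n y. n \<in> E \<Longrightarrow> y \<in> A.R n \<Longrightarrow> g y = y" for g E
    proof -
      have "\<exists>a\<in>supp_in U. \<exists>b\<in>supp_in U. a \<star> b \<star> hinv a \<star> hinv b = g"
        by (rule A.swindle[OF sw0(1-3)]) (rule sw0(4))
      then show ?thesis using comm by blast
    qed
    obtain a b where a: "a \<in> supp_in U" and b: "b \<in> supp_in U"
      and fr: "\<forall>i. \<forall>y\<in>A.R (5 * i + 4). a y = y \<and> b y = y"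
      and cen: "a x = x" "b x = x"
      and ab: "\<forall>i. \<forall>y\<in>A.R (5 * i + 1). a (b y) = f y"
      by (rule A.factor_fixing_centre[OF f fV])
    have inf: "infinite (range (\<lambda>i::nat. 5 * i + 4))" "infinite (range (\<lambda>i::nat. 5 * i + 1))"
      by (rule range_inj_infinite, simp add: inj_on_def)+
    have aK: "a \<in> K" by (rule sw[OF a cen(1) inf(1)]) (use fr in auto)
    have bK: "b \<in> K" by (rule sw[OF b cen(2) inf(1)]) (use fr in auto)
    have X: "a \<in> Homeo X" "b \<in> Homeo X" using a b supp_inD(1) by auto
    let ?c = "hinv (a \<star> b) \<star> f"
    have ab1: "hinv (a \<star> b) (a (b y)) = y" if "y \<in> topspace X" for y
      using hinv_app(1)[of "a \<star> b" y] X that by simp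
    have cs: "?c \<in> supp_in U" using supp_in_mul[OF supp_in_hinv[OF supp_in_mul[OF a b]] f] .
    have cK: "?c \<in> K"
    proof (rule sw[OF cs _ inf(2)])
      show "?c x = x" using ab1[OF xX] cen True X fX xX by simp
      show "?c y = y" if n: "n \<in> range (\<lambda>i::nat. 5 * i + 1)" and y: "y \<in> A.R n" for n y
      proof -
        have yX: "y \<in> topspace X" by (rule clop_in[OF A.Rclop y])
        have "a (b y) = f y" using ab n y by auto
        then show ?thesis using ab1[OF yX] X fX yX by simp
      qed
    qed
    have "f = (a \<star> b) \<star> ?c" using H.inv_mult_cancel(2)[of "a \<star> b" f] X fX by simp
    then show ?thesis using K[OF K[OF aK bK] cK] by simp
  next
    case False
    obtain V \<kappa> where an: "annuli X x U V \<kappa>" and "\<forall>n. hone ` V (Suc n) \<subseteq> V n \<and> hinv hone ` V (Suc n) \<subseteq> V n"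
      by (rule annuli_exist[OF U hone_closed hone_app[OF xX]])
    interpret A: annuli X x U V \<kappa> by (rule an)
    have fxX: "f x \<in> topspace X" using fX xX by simp
    obtain C where C: "C \<in> clop" "x \<in> C" "f x \<notin> C" using separate_points[OF xX fxX] False by metis
    let ?N = "C \<inter> hinv f ` (topspace X - C)"
    have CX: "topspace X - C \<in> clop" by (rule clop_Diff[OF clop_top C(1)])
    have N: "?N \<in> clop" using C(1) Homeo_clop[OF hinv_closed[OF fX] CX] by blast
    have mN: "y \<in> ?N \<longleftrightarrow> y \<in> C \<and> f y \<notin> C" for y
      using mem_hinv_image[OF fX clop_subset[OF CX]] clop_in[OF C(1)] fX by auto
    have xN: "x \<in> ?N" using mN C by blast
    obtain n where n: "V n \<subseteq> ?N" using A.Vconv[OF N xN] by blast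
    let ?V = "V (Suc n)"
    have Vc: "?V \<in> clop" by (rule A.Vclop)
    have Vn: "?V \<subseteq> V n" by (rule A.Vdec)
    have fV: "f ` ?V \<subseteq> U - V n"
    proof (rule image_subsetI)
      fix y assume y: "y \<in> ?V"
      have "y \<in> ?N" using y Vn n by blast
      then have "f y \<notin> C" using mN by blast
      then have "f y \<notin> V n" using n by blast
      moreover have "f y \<in> U"
        using supp_in_image[OF f] y A.VU[of "Suc n"] clop_in[OF Vc y] by blast
      ultimately show "f y \<in> U - V n" by blast
    qed
    have fVc: "f ` ?V \<in> clop" by (rule Homeo_clop[OF fX Vc])
    let ?k = "\<kappa> n"
    have ef: "emb ?V f" by (rule Homeo_emb[OF fX Vc])
    have ek: "emb (f ` ?V) ?k" by (rule emb_sub[OF A.\<kappa>(1) fVc fV])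
    have kV: "?k ` f ` ?V \<subseteq> V n - ?V" using image_mono[OF fV, of ?k] A.\<kappa>(2)[of n] by blast
    let ?h = "\<lambda>y. ?k (f y)"
    have eh: "emb ?V ?h" by (rule emb_comp[OF ef ek])
    have hV: "?h ` ?V = ?k ` f ` ?V" by (simp add: image_image)
    have d1: "?V \<inter> f ` ?V = {}" using fV Vn by blast
    have d2: "f ` ?V \<inter> ?k ` f ` ?V = {}" using fV kV by blast
    have d3: "?V \<inter> ?h ` ?V = {}" using kV hV by blast
    define \<sigma> where "\<sigma> = swap ?V f"
    define \<psi> where "\<psi> = swap ?V ?h"
    define \<rho> where "\<rho> = swap (f ` ?V) ?k"
    have VU: "?V \<subseteq> U" "V n \<subseteq> U" by (rule A.VU)+
    have s\<sigma>: "\<sigma> \<in> supp_in U" unfolding \<sigma>_def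
      by (rule subsetD[OF supp_in_mono swap_supp[OF ef d1]]) (use fV VU in blast)
    have s\<psi>: "\<psi> \<in> supp_in U" unfolding \<psi>_def
      by (rule subsetD[OF supp_in_mono swap_supp[OF eh d3]]) (use kV hV VU in blast)
    have s\<rho>: "\<rho> \<in> supp_in U" unfolding \<rho>_def
      by (rule subsetD[OF supp_in_mono swap_supp[OF ek d2]]) (use kV fV VU in blast)
    note a\<sigma> = swap_apply[OF ef d1, folded \<sigma>_def] and a\<psi> = swap_apply[OF eh d3, folded \<psi>_def]
      and a\<rho> = swap_apply[OF ek d2, folded \<rho>_def]
    have X: "\<sigma> \<in> Homeo X" "\<psi> \<in> Homeo X" "\<rho> \<in> Homeo X" using s\<sigma> s\<psi> s\<rho> supp_inD(1) by auto
    have sw: "g \<in> K" if g: "g \<in> supp_in U" "\<And>y. y \<in> ?V \<Longrightarrow> g y = y" for g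
    proof -
      have "g x = x" by (rule g(2)[OF A.xV])
      moreover have "infinite {m. Suc n \<le> m}" by (simp add: infinite_Ici flip: atLeast_def)
      moreover have "g y = y" if "m \<in> {m. Suc n \<le> m}" "y \<in> A.R m" for m y
        using g(2) that A.R_in_V[of "Suc n" m] by blast
      ultimately obtain a b where "a \<in> supp_in U" "b \<in> supp_in U" "a \<star> b \<star> hinv a \<star> hinv b = g"
        using A.swindle[OF g(1), of "{m. Suc n \<le> m}"] by blast
      then show ?thesis using comm by blast
    qed
    have VX: "y \<in> topspace X" if "y \<in> ?V" for y using clop_in[OF Vc that] .
    have \<rho>K: "\<rho> \<in> K"
    proof (rule sw[OF s\<rho>])
      fix y assume y: "y \<in> ?V"
      show "\<rho> y = y" by (rule a\<rho>(3)[OF VX[OF y]]) (use y d1 kV in blast)+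
    qed
    have conj: "\<psi> \<star> \<sigma> = \<rho> \<star> \<psi>"
    proof (rule Homeo_eqI)
      fix y assume y: "y \<in> topspace X"
      have n1: "f z \<notin> ?V" "f z \<notin> ?h ` ?V" "?h z \<notin> ?V" "?h z \<notin> f ` ?V" "z \<notin> f ` ?V" "z \<notin> ?k ` f ` ?V"
        if "z \<in> ?V" for z
        using that d1 d2 d3 hV by blast+
      consider "y \<in> ?V" | z where "z \<in> ?V" "y = f z" | z where "z \<in> ?V" "y = ?h z"
        | "y \<notin> ?V" "y \<notin> f ` ?V" "y \<notin> ?h ` ?V" by blast
      then have "\<psi> (\<sigma> y) = \<rho> (\<psi> y)"
      proof cases
        case 1
        have "f y \<in> f ` ?V" using 1 by blast
        then have "\<psi> (f y) = f y" "\<rho> (?k (f y)) = f y" using n1[OF 1] a\<psi>(3) a\<rho>(2) fX y by auto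
        then show ?thesis using a\<sigma>(1)[OF 1] a\<psi>(1)[OF 1] by simp
      next
        case (2 z)
        have "f z \<in> f ` ?V" using 2 by blast
        then have "\<psi> (f z) = f z" "\<rho> (f z) = ?k (f z)" using n1[OF 2(1)] a\<psi>(3) a\<rho>(1) y 2 by auto
        then show ?thesis using a\<sigma>(2)[OF 2(1)] a\<psi>(1)[OF 2(1)] 2 by simp
      next
        case (3 z)
        have "\<sigma> y = y" "\<rho> z = z"
          using n1[OF 3(1)] a\<sigma>(3)[of y] a\<rho>(3)[of z] y 3 VX by auto
        then show ?thesis using a\<psi>(2)[OF 3(1)] 3 by simp
      next
        case 4
        then show ?thesis using a\<sigma>(3)[OF y] a\<psi>(3)[OF y] a\<rho>(3)[OF y] hV by simp
      qed
      then show "(\<psi> \<star> \<sigma>) y = (\<rho> \<star> \<psi>) y" using y X by simp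
    qed (use X in simp_all)
    \<comment> \<open>A conjugate of \<rho> differs from \<rho> by a commutator.\<close>
    have "\<rho> \<star> (hinv \<rho> \<star> hinv \<psi> \<star> \<rho> \<star> \<psi>) = hinv \<psi> \<star> (\<rho> \<star> \<psi>)"
      using X H.inv_mult_cancel by (simp add: H.m_assoc)
    also have "\<dots> = \<sigma>" using X H.inv_mult_cancel conj[symmetric] by simp
    finally have \<sigma>e: "\<sigma> = \<rho> \<star> (hinv \<rho> \<star> hinv \<psi> \<star> \<rho> \<star> \<psi>)" by simp
    have "hinv \<rho> \<star> hinv \<psi> \<star> hinv (hinv \<rho>) \<star> hinv (hinv \<psi>) \<in> K"
      by (rule comm[OF supp_in_hinv[OF s\<rho>] supp_in_hinv[OF s\<psi>]])
    then have "hinv \<rho> \<star> hinv \<psi> \<star> \<rho> \<star> \<psi> \<in> K" using X by simp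
    then have \<sigma>K: "\<sigma> \<in> K" using K[OF \<rho>K] \<sigma>e by simp
    have "\<sigma> \<star> f \<in> K"
      by (rule sw[OF supp_in_mul[OF s\<sigma> f]]) (use a\<sigma>(2) X fX VX in simp)
    moreover have "f = \<sigma> \<star> (\<sigma> \<star> f)"
    proof (rule Homeo_eqI)
      show "f y = (\<sigma> \<star> (\<sigma> \<star> f)) y" if "y \<in> topspace X" for y
        using swap_involution[OF ef d1, folded \<sigma>_def] that X fX by simp
    qed (use X fX in simp_all)
    ultimately show ?thesis using K[OF \<sigma>K] by metis
  qed
qed

end

section \<open>Exactly two isolated points\<close>

context stone_space begin

lemma cut_supp:
  assumes g: "g \<in> Homeo X" and U: "U \<in> clop" "g ` U = U"
  shows "restrict (\<lambda>y. if y \<in> U then g y else y) (topspace X) \<in> supp_in U"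
proof -
  let ?c = "\<lambda>y. if y \<in> U then g y else y"
  have UX: "U \<subseteq> topspace X" by (rule clop_subset[OF U(1)])
  have "inj_on g U" by (rule inj_on_subset[OF Homeo_inj[OF g] UX])
  then have "bij_betw g U U" using U(2) by (simp add: bij_betw_def)
  then have "bij_betw ?c U U" by (simp cong: bij_betw_cong)
  moreover have "bij_betw ?c (topspace X - U) (topspace X - U)"
    by (rule bij_betw_cong[THEN iffD2, OF _ bij_betw_id]) simp
  ultimately have "bij_betw ?c (U \<union> (topspace X - U)) (U \<union> (topspace X - U))"
    by (rule bij_betw_combine) auto
  moreover have "U \<union> (topspace X - U) = topspace X" using UX by auto
  ultimately have "bij_betw ?c (topspace X) (topspace X)" by simp
  moreover have "cont_at ?c y" if y: "y \<in> topspace X" for y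
  proof (cases "y \<in> U")
    case True
    then show ?thesis by (intro cont_at_cong[OF Homeo_cont_at[OF g y] clopD(1)[OF U(1)]]) auto
  next
    case False
    have c: "topspace X - U \<in> clop" by (rule clop_Diff[OF clop_top U(1)])
    show ?thesis by (rule cont_at_cong[OF cont_at_id clopD(1)[OF c]]) (use False y in auto)
  qed
  ultimately have "restrict ?c (topspace X) \<in> Homeo X" by (rule Homeo_restrictI)
  then show ?thesis by (auto simp: supp_in_def)
qed

text \<open>Induction on the number of sets of the cover on whose union \<open>g\<close> may be non-trivial: the restriction of \<open>g\<close> to \<open>U\<close>, extended by
the identity, is supported in \<open>U\<close>, and dividing by it makes \<open>g\<close> trivial on \<open>U\<close> without spoiling the
invariance of the other sets.\<close>

lemma generated_by_cover:
  assumes fin: "finite \<W>" "\<W> \<subseteq> \<U>" and \<U>: "\<U> \<subseteq> clop"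
    and K: "hone \<in> K" "\<And>a b. a \<in> K \<Longrightarrow> b \<in> K \<Longrightarrow> a \<star> b \<in> K"
    and sub: "\<And>U. U \<in> \<U> \<Longrightarrow> supp_in U \<subseteq> K"
    and g: "g \<in> Homeo X" "\<And>U. U \<in> \<U> \<Longrightarrow> g ` U = U"
      "\<And>y. y \<in> topspace X \<Longrightarrow> y \<notin> \<Union>\<W> \<Longrightarrow> g y = y"
  shows "g \<in> K"
  using fin g
proof (induction \<W> arbitrary: g rule: finite_induct)
  case empty
  have "g = hone" by (rule Homeo_eqI) (use empty in simp_all)
  then show ?case using K(1) by simp
next
  case (insert U \<W>)
  have UU: "U \<in> \<U>" using insert.prems(1) by simp
  have U: "U \<in> clop" using UU \<U> by blast
  have gX: "g \<in> Homeo X" by (rule insert.prems(2))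
  have gU: "g ` U = U" by (rule insert.prems(3)[OF UU])
  let ?c = "restrict (\<lambda>y. if y \<in> U then g y else y) (topspace X)"
  have c: "?c \<in> supp_in U" by (rule cut_supp[OF gX U gU])
  have cX: "?c \<in> Homeo X" by (rule supp_inD(1)[OF c])
  let ?g = "hinv ?c \<star> g"
  have g'X: "?g \<in> Homeo X" using cX gX by simp
  have g1: "?g y = y" if y: "y \<in> U" for y
  proof -
    have yX: "y \<in> topspace X" by (rule clop_in[OF U y])
    have "?c y = g y" using y yX by simp
    then have "?g y = hinv ?c (?c y)" using cX gX yX by (simp only: mul_app hinv_closed)
    then show ?thesis using hinv_app(1)[OF cX yX] by (simp only:)
  qed
  have g2: "?g y = g y" if y: "y \<in> topspace X" "y \<notin> U" for y
  proof -
    have "g y \<notin> U"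
    proof
      assume "g y \<in> U"
      then have "g y \<in> g ` U" using gU by simp
      then obtain z where z: "z \<in> U" "g y = g z" by blast
      then have "y = z" using Homeo_inj_eq[OF gX y(1) clop_in[OF U]] by blast
      then show False using z y by simp
    qed
    then have "hinv ?c (g y) = g y"
      by (rule supp_inD(2)[OF supp_in_hinv[OF c] Homeo_in[OF gX y(1)]])
    then show ?thesis using cX gX y by (simp only: mul_app hinv_closed)
  qed
  have gK: "?g \<in> K"
  proof (rule insert.IH)
    show "\<W> \<subseteq> \<U>" using insert.prems(1) by simp
    show "?g \<in> Homeo X" by (rule g'X)
    show "?g y = y" if "y \<in> topspace X" "y \<notin> \<Union>\<W>" for y
    proof (cases "y \<in> U")
      case False
      then have "g y = y" using insert.prems(4)[OF that(1)] that(2) by simp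
      then show ?thesis using g2[OF that(1) False] by (simp only:)
    qed (rule g1)
    show "?g ` U' = U'" if U': "U' \<in> \<U>" for U'
    proof -
      have U'X: "U' \<subseteq> topspace X" using U' \<U> clop_subset by blast
      have "?g ` (U' \<inter> U) = (\<lambda>y. y) ` (U' \<inter> U)" by (rule image_cong[OF refl]) (use g1 in blast)
      moreover have "?g ` (U' - U) = g ` (U' - U)"
        by (rule image_cong[OF refl]) (use g2 U'X in blast)
      moreover have "g ` (U' - U) = g ` U' - g ` U"
        by (rule inj_on_image_set_diff[OF Homeo_inj[OF gX]]) (use U'X clop_subset[OF U] in auto)
      moreover have "g ` U' = U'" by (rule insert.prems(3)[OF U'])
      ultimately have "?g ` (U' \<inter> U) \<union> ?g ` (U' - U) = U'" using gU by auto
      then show ?thesis by (simp only: image_Un[symmetric] Int_Diff_Un)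
    qed
  qed
  have "?c \<in> K" by (rule subsetD[OF sub[OF UU] c])
  then have "?c \<star> ?g \<in> K" using gK by (rule K(2))
  then show ?case using H.inv_mult_cancel(2)[of ?c g] cX gX by simp
qed

end

text \<open>The transposition \<open>t\<close> of the two isolated points is central, and \<open>untwist\<close> is the projection of the group onto the
stabiliser of \<open>p\<close> with kernel \<open>{1, t}\<close>.\<close>

locale two_isolated = polish_homeo X T for X :: "'a topology" and T +
  fixes p q :: 'a
  assumes iso: "isolated = {p, q}" and pq: "p \<noteq> q"
begin

abbreviation t where "t \<equiv> flip p q"

lemma pqX: "p \<in> topspace X" "q \<in> topspace X"
  using iso isolatedD(1) by auto

lemma tr: "t \<in> supp_in {p, q}" "t \<in> Homeo X" "t p = q" "t q = p"
  "\<And>y. y \<in> topspace X \<Longrightarrow> y \<noteq> p \<Longrightarrow> y \<noteq> q \<Longrightarrow> t y = y"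
  using flip[of p q] iso pq by auto

lemma perm:
  assumes g: "g \<in> Homeo X"
  shows "g p = p \<and> g q = q \<or> g p = q \<and> g q = p"
    and "y \<in> topspace X \<Longrightarrow> y \<noteq> p \<Longrightarrow> y \<noteq> q \<Longrightarrow> g y \<noteq> p \<and> g y \<noteq> q"
proof -
  have im: "{g p, g q} = {p, q}" using Homeo_isolated[OF g] iso by simp
  then show 1: "g p = p \<and> g q = q \<or> g p = q \<and> g q = p" by (auto simp: doubleton_eq_iff)
  show "g y \<noteq> p \<and> g y \<noteq> q" if "y \<in> topspace X" "y \<noteq> p" "y \<noteq> q"
    using 1 Homeo_inj_eq[OF g that(1) pqX(1)] Homeo_inj_eq[OF g that(1) pqX(2)] that(2,3) by auto
qed

lemma t_t: "t \<star> t = hone"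
proof (rule Homeo_eqI)
  show "(t \<star> t) y = hone y" if "y \<in> topspace X" for y
    using that tr pqX by (cases "y = p"; cases "y = q") simp_all
qed (use tr in simp_all)

lemma t_cancel: "g \<in> Homeo X \<Longrightarrow> t \<star> (t \<star> g) = g"
  using t_t tr(2) H.m_assoc[of t t g] by simp

lemma t_central:
  assumes g: "g \<in> Homeo X"
  shows "g \<star> t = t \<star> g"
proof (rule Homeo_eqI)
  show "(g \<star> t) y = (t \<star> g) y" if y: "y \<in> topspace X" for y
    using y g tr pqX perm(1)[OF g] perm(2)[OF g y] by (cases "y = p"; cases "y = q") auto
qed (use g tr in simp_all)

definition untwist :: "('a \<Rightarrow> 'a) \<Rightarrow> 'a \<Rightarrow> 'a" where
  "untwist g = (if g p = p then g else t \<star> g)"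

lemma untwist_closed: "g \<in> Homeo X \<Longrightarrow> untwist g \<in> Homeo X"
  using tr(2) by (simp add: untwist_def)

lemma untwist_fix: "g \<in> Homeo X \<Longrightarrow> untwist g p = p" "g \<in> Homeo X \<Longrightarrow> untwist g q = q"
  using perm(1)[of g] tr pqX pq by (auto simp: untwist_def)

lemma untwist_other:
  assumes "g \<in> Homeo X" "y \<in> topspace X" "y \<noteq> p" "y \<noteq> q"
  shows "untwist g y = g y"
  using perm(2)[OF assms] assms tr by (simp add: untwist_def)

lemma untwist_mult:
  assumes g: "g \<in> Homeo X" and h: "h \<in> Homeo X"
  shows "untwist (g \<star> h) = untwist g \<star> untwist h"
proof (rule Homeo_eqI)
  show "untwist (g \<star> h) \<in> Homeo X" "untwist g \<star> untwist h \<in> Homeo X" using g h untwist_closed by auto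
  fix y assume y: "y \<in> topspace X"
  show "untwist (g \<star> h) y = (untwist g \<star> untwist h) y"
  proof (cases "y = p \<or> y = q")
    case True
    then show ?thesis using untwist_fix g h untwist_closed pqX by auto
  next
    case False
    then show ?thesis using untwist_other g h y perm(2)[OF h y] untwist_closed by simp
  qed
qed

lemma untwist_image:
  assumes g: "g \<in> Homeo X" and A: "A \<subseteq> topspace X" "p \<notin> A" "q \<notin> A"
  shows "untwist g ` A = g ` A"
  by (rule image_cong[OF refl], rule untwist_other[OF g]) (use A in auto)

lemma pq_clop: "{p, q} \<in> clop"
  by (rule finite_isolated_clop) (use iso in auto)

text \<open>The image of \<open>A\<close> under \<open>untwist g\<close> is determined by the image under \<open>g\<close> of the part of \<open>A\<close> without isolated points, and
the stabiliser of that part is already known to be open.\<close>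

lemma untwist_cont: "continuous_map T htop untwist"
proof (rule continuous_map_into_htop)
  show "untwist \<in> topspace T \<rightarrow> Homeo X" using untwist_closed by simp
  fix A B assume AB: "A \<in> clop" "B \<in> clop"
  let ?A = "A - {p, q}" and ?B = "B - {p, q}"
  have A': "?A \<in> clop" by (rule clop_Diff[OF AB(1) pq_clop])
  have iff: "untwist g ` A = B \<longleftrightarrow> A \<inter> {p, q} = B \<inter> {p, q} \<and> g ` ?A = ?B" if g: "g \<in> Homeo X" for g
  proof -
    have 1: "untwist g ` ?A = g ` ?A" by (rule untwist_image[OF g]) (use clop_subset[OF A'] in auto)
    have "untwist g y = y" if "y \<in> A \<inter> {p, q}" for y using untwist_fix[OF g] that by auto
    then have 2: "untwist g ` (A \<inter> {p, q}) = A \<inter> {p, q}" by simp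
    have 3: "g ` ?A \<inter> {p, q} = {}" using perm(2)[OF g] clop_subset[OF AB(1)] by auto
    have "untwist g ` A = untwist g ` (?A \<union> A \<inter> {p, q})" by (rule arg_cong[of _ _ "\<lambda>S. untwist g ` S"]) blast
    also have "\<dots> = g ` ?A \<union> A \<inter> {p, q}" by (simp only: image_Un 1 2)
    finally show ?thesis using 3 by auto
  qed
  have eq: "{g \<in> topspace T. untwist g ` A = B} =
    (if A \<inter> {p, q} = B \<inter> {p, q} then {g \<in> Homeo X. g ` ?A = ?B} else {})"
    by (cases "A \<inter> {p, q} = B \<inter> {p, q}") (simp_all add: iff cong: conj_cong)
  show "openin T {g \<in> topspace T. untwist g ` A = B}"
    unfolding eq using open_transporter_T[OF A' stab_open_perfect[OF A']] iso by simp
qed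

lemma untwist_range: "untwist ` carrier HG = {g \<in> Homeo X. g ` {p} = {p}}"
proof
  show "untwist ` carrier HG \<subseteq> {g \<in> Homeo X. g ` {p} = {p}}" using untwist_closed untwist_fix by auto
  show "{g \<in> Homeo X. g ` {p} = {p}} \<subseteq> untwist ` carrier HG"
  proof
    fix g assume "g \<in> {g \<in> Homeo X. g ` {p} = {p}}"
    then have "g \<in> Homeo X" "untwist g = g" by (auto simp: untwist_def)
    then show "g \<in> untwist ` carrier HG" by (metis carrier_HG imageI)
  qed
qed

lemma nbhd_prod:
  assumes W: "openin T W" "hone \<in> W"
  shows "\<exists>V. openin T V \<and> hone \<in> V \<and> V \<subseteq> W \<and> (\<forall>a\<in>V. \<forall>b\<in>V. a \<star> b \<in> W)"
proof -
  have c: "continuous_map (prod_topology T T) T (\<lambda>(x, y). x \<star> y)"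
    using pol by (simp add: Polish_group_topology_def topological_group_def)
  obtain V where V: "openin T V" "hone \<in> V" "\<forall>a\<in>V. \<forall>b\<in>V. a \<star> b \<in> W"
    using PT.nbhd_pairs[OF c W(1)] W(2) by auto
  have "V \<subseteq> W"
  proof
    fix a assume a: "a \<in> V"
    then have "a \<in> Homeo X" using openin_subset[OF V(1)] by auto
    moreover have "a \<star> hone \<in> W" using V a by blast
    ultimately show "a \<in> W" by simp
  qed
  then show ?thesis using V by blast
qed

lemma small_nbhd:
  obtains N where "openin T N" "hone \<in> N" "N \<subseteq> Homeo X" "\<forall>a\<in>N. hinv a \<in> N"
    "\<forall>a\<in>N. \<forall>b\<in>N. \<forall>c\<in>N. \<forall>d\<in>N. \<forall>e\<in>N. a \<star> b \<star> (c \<star> d) \<star> e \<noteq> t"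
proof -
  have "t \<noteq> hone" using tr(3) pq pqX by auto
  have "closedin T {t}" using closedin_Hausdorff_singleton[OF hausT] tr(2) by simp
  then have "openin T (topspace T - {t})" by blast
  then obtain V1 where V1: "openin T V1" "hone \<in> V1" "\<forall>a\<in>V1. \<forall>b\<in>V1. a \<star> b \<in> topspace T - {t}"
    using nbhd_prod[of "topspace T - {t}"] \<open>t \<noteq> hone\<close> by auto
  obtain V2 where V2: "openin T V2" "hone \<in> V2" "V2 \<subseteq> V1" "\<forall>a\<in>V2. \<forall>b\<in>V2. a \<star> b \<in> V1"
    using nbhd_prod[OF V1(1,2)] by blast
  obtain V3 where V3: "openin T V3" "hone \<in> V3" "V3 \<subseteq> V2" "\<forall>a\<in>V3. \<forall>b\<in>V3. a \<star> b \<in> V2"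
    using nbhd_prod[OF V2(1,2)] by blast
  have V3X: "V3 \<subseteq> Homeo X" using openin_subset[OF V3(1)] by simp
  let ?N = "V3 \<inter> {g \<in> topspace T. hinv g \<in> V3}"
  have "openin T {g \<in> topspace T. hinv g \<in> V3}"
    by (rule openin_continuous_map_preimage[OF PT.cont_inv[OF PT.cont_id] V3(1)])
  then have "openin T ?N" using V3(1) by blast
  moreover have "hone \<in> ?N" using V3(2) by simp
  moreover have "?N \<subseteq> Homeo X" using V3X by blast
  moreover have "\<forall>a\<in>?N. hinv a \<in> ?N" by simp
  moreover have "\<forall>a\<in>?N. \<forall>b\<in>?N. \<forall>c\<in>?N. \<forall>d\<in>?N. \<forall>e\<in>?N. a \<star> b \<star> (c \<star> d) \<star> e \<noteq> t"
  proof (intro ballI)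
    fix a b c d e assume "a \<in> ?N" "b \<in> ?N" "c \<in> ?N" "d \<in> ?N" "e \<in> ?N"
    then have n: "a \<in> V3" "b \<in> V3" "c \<in> V3" "d \<in> V3" "e \<in> V3" by auto
    have "a \<star> b \<in> V2" "c \<star> d \<in> V2" using V3(4) n by auto
    then have "a \<star> b \<star> (c \<star> d) \<in> V1" using V2(4) by auto
    moreover have "e \<in> V1" using n V3(3) V2(3) by blast
    ultimately have "a \<star> b \<star> (c \<star> d) \<star> e \<in> topspace T - {t}" using V1(3) by blast
    then show "a \<star> b \<star> (c \<star> d) \<star> e \<noteq> t" by blast
  qed
  ultimately show ?thesis by (rule that)
qed

text \<open>Let \<open>N\<close> be a small symmetric neighbourhood of the identity for \<open>T\<close>. By the open mapping theorem for \<open>untwist\<close> there is a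
subgroup \<open>V\<close>, given by finitely many clopen sets, such that each \<open>v \<in> V\<close> has exactly one of \<open>v\<close> and \<open>t v\<close> in \<open>N\<close>. This
choice is a homomorphism from \<open>V\<close> to \<open>{1, t}\<close> with kernel \<open>K = V \<inter> N\<close>. The kernel contains all commutators, hence all homeomorphisms
supported in small stable neighbourhoods, and by compactness a whole subgroup given by finitely many clopen sets without isolated points.
Near the identity in \<open>T\<close>, therefore, no element can exchange \<open>p\<close> and \<open>q\<close>.\<close>

lemma stab_point_open_two: "openin T (stab {p})"
proof -
  obtain N where N: "openin T N" "hone \<in> N" "N \<subseteq> Homeo X" and Ninv: "\<forall>a\<in>N. hinv a \<in> N"
    and N5: "\<forall>a\<in>N. \<forall>b\<in>N. \<forall>c\<in>N. \<forall>d\<in>N. \<forall>e\<in>N. a \<star> b \<star> (c \<star> d) \<star> e \<noteq> t"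
    by (rule small_nbhd)
  have N2: "a \<star> b \<noteq> t" if "a \<in> N" "b \<in> N" for a b
    using N5[rule_format, OF that N(2) N(2) N(2)] that N(3) by (auto simp: subset_iff)
  have N3: "a \<star> b \<star> c \<noteq> t" if "a \<in> N" "b \<in> N" "c \<in> N" for a b c
    using N5[rule_format, OF that(1,2,3) N(2) N(2)] that N(3) by (auto simp: subset_iff)
  interpret PH: topgroup HG htop
    by unfold_locales (rule topological_group_htop)
  interpret P: polish_hom HG HG T htop untwist
  proof unfold_locales
    show "untwist \<in> hom HG HG" using untwist_closed untwist_mult by (simp add: hom_def)
    show "openin htop (untwist ` carrier HG)"
      unfolding untwist_range by (rule open_transporter) (use isolatedD(2) iso in blast)
  qed (use untwist_cont sepT cmT completely_metrizable_htop in auto)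
  obtain Q where Q: "openin htop Q" "hone \<in> Q" "Q \<subseteq> untwist ` N"
    using P.open_at_one[OF N(1,2)] by blast
  obtain F where F: "finite F" "F \<subseteq> clop" "{h \<in> Homeo X. \<forall>A\<in>F. h ` A = hone ` A} \<subseteq> Q"
    using htop_basis[OF Q(1,2)] by blast
  define V where "V = {h \<in> Homeo X. \<forall>A\<in>F. h ` A = A}"
  have VX: "V \<subseteq> Homeo X" by (auto simp: V_def)
  have VF: "h ` A = hone ` A" if "h \<in> V" "A \<in> F" for h A
    using that F(2) hone_image[OF clop_subset] by (auto simp: V_def)
  have "V \<subseteq> {h \<in> Homeo X. \<forall>A\<in>F. h ` A = hone ` A}"
    by (intro subsetI CollectI conjI ballI VF) (rule subsetD[OF VX])
  then have VQ: "V \<subseteq> untwist ` N" using F(3) Q(3) by (meson subset_trans)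
  have Vmul: "a \<star> b \<in> V" if "a \<in> V" "b \<in> V" for a b
  proof -
    have ab: "a \<in> Homeo X" "b \<in> Homeo X" using that VX by auto
    have "(a \<star> b) ` A = A" if A: "A \<in> F" for A
    proof -
      have AX: "A \<subseteq> topspace X" using A F(2) clop_subset by blast
      have "a ` A = A" "b ` A = A" using A \<open>a \<in> V\<close> \<open>b \<in> V\<close> by (auto simp: V_def)
      then show ?thesis using mul_image[OF ab AX] by simp
    qed
    then show ?thesis using ab by (simp add: V_def)
  qed
  have Vinv: "hinv a \<in> V" if "a \<in> V" for a
  proof -
    have aX: "a \<in> Homeo X" using that VX by auto
    have "hinv a ` A = A" if A: "A \<in> F" for A
    proof -
      have AX: "A \<subseteq> topspace X" using clop_subset F(2) A by blast
      show ?thesis using hinv_image_eq[OF aX AX AX] A \<open>a \<in> V\<close> by (simp add: V_def)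
    qed
    then show ?thesis using aX by (simp add: V_def)
  qed
  have dich: "v \<in> N \<or> t \<star> v \<in> N" if v: "v \<in> V" for v
  proof -
    obtain n where n: "n \<in> N" "v = untwist n" using VQ v by blast
    have nX: "n \<in> Homeo X" using n N(3) by blast
    show ?thesis using n t_cancel[OF nX] by (cases "n p = p") (auto simp: untwist_def)
  qed
  define K where "K = V \<inter> N"
  have Kmul: "a \<star> b \<in> K" if a: "a \<in> K" and b: "b \<in> K" for a b
  proof -
    have ab: "a \<in> V" "b \<in> V" "a \<in> N" "b \<in> N" using a b by (auto simp: K_def)
    have X: "a \<in> Homeo X" "b \<in> Homeo X" using ab VX by auto
    have "t \<star> (a \<star> b) \<notin> N"
    proof
      assume n: "t \<star> (a \<star> b) \<in> N"
      have "t \<star> (a \<star> b) \<star> hinv b \<star> hinv a = t"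
        using X tr(2) by (simp add: H.m_assoc)
      then show False using N3[OF n] Ninv ab by blast
    qed
    then show ?thesis using dich[OF Vmul[OF ab(1,2)]] Vmul[OF ab(1,2)] by (simp add: K_def)
  qed
  have Kcomm: "a \<star> b \<star> hinv a \<star> hinv b \<in> K" if a: "a \<in> V" and b: "b \<in> V" for a b
  proof -
    have X: "a \<in> Homeo X" "b \<in> Homeo X" using a b VX by auto
    have cV: "a \<star> b \<star> hinv a \<star> hinv b \<in> V" by (intro Vmul Vinv a b)
    \<comment> \<open>Multiplying a and b by the central element t does not change their commutator, so both may be taken in N.\<close>
    have lift: "\<exists>a'\<in>N. a' \<in> Homeo X \<and> (\<forall>z\<in>Homeo X. a' \<star> z \<star> hinv a' = a \<star> z \<star> hinv a)" if "a \<in> V" for a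
    proof -
      have aX: "a \<in> Homeo X" using that VX by auto
      have "(t \<star> a) \<star> z \<star> hinv (t \<star> a) = a \<star> z \<star> hinv a" if z: "z \<in> Homeo X" for z
      proof -
        have "(t \<star> a) \<star> z \<star> hinv (t \<star> a) = t \<star> (a \<star> z \<star> hinv a) \<star> hinv t"
          by (rule conj_conj[OF tr(2) aX z])
        also have "\<dots> = (a \<star> z \<star> hinv a) \<star> t \<star> hinv t"
          using t_central[of "a \<star> z \<star> hinv a"] aX z by simp
        also have "\<dots> = a \<star> z \<star> hinv a" using aX z tr(2) by (simp add: H.m_assoc)
        finally show ?thesis .
      qed
      then show ?thesis using dich[OF \<open>a \<in> V\<close>] aX tr(2) by (elim disjE) (auto intro: bexI[of _ a] bexI[of _ "t \<star> a"])
    qed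
    obtain a' where a': "a' \<in> N" "a' \<in> Homeo X" "\<And>z. z \<in> Homeo X \<Longrightarrow> a' \<star> z \<star> hinv a' = a \<star> z \<star> hinv a"
      using lift[OF a] by blast
    obtain b' where b': "b' \<in> N" "b' \<in> Homeo X" "\<And>z. z \<in> Homeo X \<Longrightarrow> b' \<star> z \<star> hinv b' = b \<star> z \<star> hinv b"
      using lift[OF b] by blast
    have "a' \<star> b' \<star> hinv a' \<star> hinv b' = a \<star> b' \<star> hinv a \<star> hinv b'"
      using a'(3)[OF b'(2)] by simp
    also have "\<dots> = a \<star> (b' \<star> hinv a \<star> hinv b')" using X a' b' by (simp add: H.m_assoc)
    also have "\<dots> = a \<star> (b \<star> hinv a \<star> hinv b)" using b'(3)[of "hinv a"] X by simp
    also have "\<dots> = a \<star> b \<star> hinv a \<star> hinv b" using X by (simp add: H.m_assoc)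
    finally have ce: "a \<star> b \<star> hinv a \<star> hinv b = a' \<star> b' \<star> hinv a' \<star> hinv b'" by simp
    have "t \<star> (a \<star> b \<star> hinv a \<star> hinv b) \<notin> N"
    proof
      assume n: "t \<star> (a \<star> b \<star> hinv a \<star> hinv b) \<in> N"
      have "t \<star> (a \<star> b \<star> hinv a \<star> hinv b) \<star> b' \<star> (a' \<star> hinv b') \<star> hinv a' = t"
        unfolding ce using a'(2) b'(2) tr(2) H.inv_mult_cancel by (simp add: H.m_assoc)
      then show False using N5 n a'(1) b'(1) Ninv by blast
    qed
    then show ?thesis using dich[OF cV] cV by (simp add: K_def)
  qed
  have honeV: "hone \<in> V" using hone_image[OF clop_subset] F(2) by (auto simp: V_def)
  have honeK: "hone \<in> K" using N(2) honeV by (simp add: K_def)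
  let ?Y = "topspace X - {p, q}"
  have Y: "?Y \<in> clop" by (rule clop_Diff[OF clop_top pq_clop])
  have cellex: "\<exists>U. U \<in> clop \<and> x \<in> U \<and> U \<subseteq> ?Y \<and> supp_in U \<subseteq> K" if x: "x \<in> ?Y" for x
  proof -
    \<comment> \<open>The cell of x in the partition generated by the clopen sets that define V.\<close>
    let ?C = "?Y \<inter> (topspace X \<inter> \<Inter>{A \<in> F. x \<in> A}) - \<Union>{A \<in> F. x \<notin> A}"
    have "topspace X \<inter> \<Inter>{A \<in> F. x \<in> A} \<in> clop" by (rule clop_Inter) (use F(1,2) in auto)
    moreover have "\<Union>{A \<in> F. x \<notin> A} \<in> clop" by (rule clop_Union) (use F(1,2) in auto)
    ultimately have C: "?C \<in> clop" by (intro clop_Diff[of "_ \<inter> _"] clop_Int[OF Y])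
    have xC: "x \<in> ?C" using x by blast
    obtain U where U: "stable_nbhd X x U" "U \<subseteq> ?C" using stable_nbhd_in[OF st clopD(1)[OF C] xC] by blast
    have sV: "supp_in U \<subseteq> V"
    proof
      fix g assume g: "g \<in> supp_in U"
      have "g ` A = A" if A: "A \<in> F" for A
      proof -
        have AX: "A \<subseteq> topspace X" using A F(2) clop_subset by blast
        show ?thesis
        proof (cases "x \<in> A")
          case True
          then have "U \<subseteq> A" using U(2) A by blast
          then show ?thesis by (rule supp_in_set_image[OF g _ AX])
        next
          case False
          then have "U \<inter> A = {}" using U(2) A by blast
          then show ?thesis by (rule supp_in_disjoint_image[OF g _ AX])
        qed
      qed
      then show "g \<in> V" using supp_inD(1)[OF g] by (simp add: V_def)
    qed
    have "supp_in U \<subseteq> K"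
      by (rule stable_perfect[OF U(1) Kmul Kcomm]) (use sV in blast)+
    then show ?thesis using stable_nbhdD[OF U(1)] U(2) by blast
  qed
  define \<C> where "\<C> = {U \<in> clop. U \<subseteq> ?Y \<and> supp_in U \<subseteq> K}"
  have "compactin X ?Y" by (rule closedin_compact_space[OF compact clopD(2)[OF Y]])
  moreover have "\<And>U. U \<in> \<C> \<Longrightarrow> openin X U" by (simp add: \<C>_def clopD(1))
  moreover have "?Y \<subseteq> \<Union>\<C>"
  proof
    fix x assume "x \<in> ?Y"
    then obtain U where "U \<in> clop" "x \<in> U" "U \<subseteq> ?Y" "supp_in U \<subseteq> K" using cellex by blast
    then show "x \<in> \<Union>\<C>" unfolding \<C>_def by blast
  qed
  ultimately obtain \<U> where \<U>: "finite \<U>" "\<U> \<subseteq> \<C>" "?Y \<subseteq> \<Union>\<U>"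
    using compactinD[of X ?Y \<C>] by blast
  have \<U>c: "\<U> \<subseteq> clop" using \<U>(2) by (auto simp: \<C>_def)
  have \<U>Y: "U \<subseteq> ?Y" "supp_in U \<subseteq> K" if "U \<in> \<U>" for U using \<U>(2) that by (auto simp: \<C>_def)
  have gen: "g \<in> K" if g: "g \<in> Homeo X" "g p = p" "g q = q" "\<And>U. U \<in> \<U> \<Longrightarrow> g ` U = U" for g
  proof (rule generated_by_cover[OF \<U>(1) subset_refl \<U>c honeK Kmul \<U>Y(2) g(1,4)])
    show "g y = y" if "y \<in> topspace X" "y \<notin> \<Union>\<U>" for y
      using that \<U>(3) g(2,3) by blast
  qed
  let ?S = "N \<inter> (topspace T \<inter> \<Inter>(stab ` \<U>))"
  have "openin T (topspace T \<inter> \<Inter>(stab ` \<U>))"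
  proof (cases "\<U> = {}")
    case False
    have "openin T (\<Inter>(stab ` \<U>))"
    proof (rule openin_Inter)
      show "openin T S" if S: "S \<in> stab ` \<U>" for S
      proof -
        obtain U where U: "U \<in> \<U>" "S = stab U" using S by blast
        have "U \<inter> isolated = {}" using \<U>Y(1)[OF U(1)] iso by auto
        then show ?thesis using stab_open_perfect[of U] U \<U>c by blast
      qed
    qed (use False \<U>(1) in auto)
    then show ?thesis by (intro openin_Int openin_topspace)
  next
    case True
    then show ?thesis by (simp only: image_empty Inter_empty Int_UNIV_right openin_topspace)
  qed
  then have oS: "openin T ?S" by (rule openin_Int[OF N(1)])
  have oneS: "hone \<in> ?S"
    using N(2) hone_image[OF clop_subset] \<U>c by (auto simp: stab_def)
  have sub: "?S \<subseteq> stab {p}"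
  proof
    fix g assume g: "g \<in> ?S"
    then have gX: "g \<in> Homeo X" "g \<in> N" "\<And>U. U \<in> \<U> \<Longrightarrow> g ` U = U" by (auto simp: stab_def)
    show "g \<in> stab {p}"
    proof (rule ccontr)
      assume "g \<notin> stab {p}"
      then have np: "g p \<noteq> p" using gX by (simp add: stab_def)
      then have rg: "untwist g = t \<star> g" by (simp add: untwist_def)
      have rgU: "untwist g ` U = U" if U: "U \<in> \<U>" for U
      proof -
        have "untwist g ` U = g ` U" by (rule untwist_image[OF gX(1)]) (use \<U>Y(1)[OF U] in auto)
        then show ?thesis using gX(3)[OF U] by simp
      qed
      have "untwist g \<in> K" by (rule gen[OF untwist_closed[OF gX(1)] untwist_fix[OF gX(1)] rgU])
      then have "t \<star> g \<in> N" using rg by (simp add: K_def)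
      moreover have "t \<star> g \<star> hinv g = t" using gX(1) tr(2) by (simp add: H.m_assoc)
      ultimately show False using N2[of "t \<star> g" "hinv g"] Ninv gX(2) by simp
    qed
  qed
  have "subgroup (stab {p}) HG" by (rule stab_subgroup) (use pqX in simp)
  then show ?thesis by (rule PT.open_of_nbhd[OF _ oS oneS sub])
qed

end

section \<open>Uniqueness of the Polish group topology\<close>

theorem (in polish_homeo) unique_topology: "T = htop"
proof (rule eq_htop)
  fix A assume A: "A \<in> clop"
  show "openin T (stab A)"
  proof (rule stab_open[OF _ A])
    fix p assume p: "p \<in> isolated"
    show "openin T (stab {p})"
    proof (cases "\<exists>q. q \<noteq> p \<and> isolated = {p, q}")
      case True
      then obtain q where q: "q \<noteq> p" "isolated = {p, q}" by blast
      interpret two_isolated X T p q by unfold_locales (use q in auto)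
      show ?thesis by (rule stab_point_open_two)
    next
      case False
      then show ?thesis by (intro stab_point_open[OF p]) blast
    qed
  qed
qed

theorem corollary1p7:
  fixes X :: "'a topology"
  assumes "second_countable_Stone_space X"
    and "stable_space X"
  shows "\<exists>!T. Polish_group_topology (HomeoGroup X) T"
proof -
  interpret S: stone_space X by unfold_locales (rule assms(1))
  show ?thesis
  proof (rule ex1I[of _ S.htop])
    show "Polish_group_topology (HomeoGroup X) S.htop" by (rule S.Polish_htop)
    fix T assume "Polish_group_topology (HomeoGroup X) T"
    then interpret P: polish_homeo X T
      by unfold_locales (use assms(2) in auto)
    show "T = S.htop" by (rule P.unique_topology)
  qed
qed

end
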